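(* Let $N>6$ be an integer and let $k$ be an integer with $3\le k<N/2$. Put $\delta=\gcd(k,N)$ and assume that either (i) $\delta=1$, or (ii) $\delta>1$, $\gcd(\delta,3)=1$ and $N/\delta$ is not a power of a prime number. Let $\alpha\in\mathfrak H$ be an imaginary quadratic point. Then $\Lambda_k(\alpha)$ is an algebraic integer.
   Context: $\mathfrak H$ is the complex upper half plane. For $\tau\in\mathfrak H$, $L_\tau=\mathbf Z+\mathbf Z\tau$ and $\wp(z;\tau)=\wp(z;L_\tau)$ is the Weierstrass $\wp$-function of the lattice $L_\tau$. For an integer $k$ with $2<k<N/2$, $$\Lambda_k(\tau)=\frac{\wp(k/N;\tau)-\wp(1/N;\tau)}{\wp(2/N;\tau)-\wp(1/N;\tau)}.$$ A point $\alpha\in\mathfrak H$ is called an imaginary quadratic point if $\mathbf Q(\alpha)$ is an imaginary quadratic field. *)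

theory Defs
  imports
    "HOL-Analysis.Analysis"
    "HOL-Algebra.Algebraic_Closure_Type"
    "HOL-Algebra.Generated_Fields"
    "HOL-Algebra.Embedded_Algebras"
    "HOL-Number_Theory.Prime_Powers"
begin

definition lattice_of :: "complex \<Rightarrow> complex set" where
  "lattice_of \<tau> = {of_int m + of_int n * \<tau> | m n :: int. True}"

(* For a lattice L the series converges absolutely at every z outside L, so the unordered
   sum infsum is its usual value.  At the poles (z in L) the value is arbitrary. *)
definition weierstrass_p :: "complex \<Rightarrow> complex set \<Rightarrow> complex" where
  "weierstrass_p z L = 1 / z\<^sup>2 + (\<Sum>\<^sub>\<infinity>w\<in>L - {0}. 1 / (z - w)\<^sup>2 - 1 / w\<^sup>2)"

definition Lambda_fun :: "int \<Rightarrow> int \<Rightarrow> complex \<Rightarrow> complex" where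
  "Lambda_fun N k \<tau> =
     (weierstrass_p (of_int k / of_int N) (lattice_of \<tau>) -
      weierstrass_p (1 / of_int N) (lattice_of \<tau>)) /
     (weierstrass_p (2 / of_int N) (lattice_of \<tau>) -
      weierstrass_p (1 / of_int N) (lattice_of \<tau>))"

abbreviation complex_field :: "complex ring" where
  "complex_field \<equiv> ring_of_type_algebra"

(* A subfield of the complex numbers of degree 2 over the rationals that is not real. *)
definition imaginary_quadratic_field :: "complex set \<Rightarrow> bool" where
  "imaginary_quadratic_field K \<longleftrightarrow>
     subfield K complex_field \<and> ring.dimension complex_field 2 \<rat> K \<and> \<not> K \<subseteq> \<real>"

(* generate_field takes the subfield generated over the prime field, which here is \<rat>. *)
definition imaginary_quadratic_point :: "complex \<Rightarrow> bool" where
  "imaginary_quadratic_point \<alpha> \<longleftrightarrow>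
     Im \<alpha> > 0 \<and> imaginary_quadratic_field (generate_field complex_field {\<alpha>})"

end

theory Submission
  imports
    Defs
    "HOL-Complex_Analysis.Complex_Analysis"
    "HOL-Number_Theory.Residues"
begin

text \<open>
  A complex number is an algebraic integer if it lies in every valuation ring \<open>V\<close> of the complex
  field, so it suffices to study the curve of the lattice at one place.

  If the \<open>j\<close>-invariant is not in \<open>V\<close>, the curve has a model \<open>y\<^sup>2 + x y + b y = x\<^sup>3\<close> with \<open>b\<close> in the
  maximal ideal, whose reduction is a nodal cubic with smooth part the multiplicative group. Complex
  multiplication by \<open>\<mu>\<close> with \<open>\<mu>\<^sup>2 = t \<mu> - n\<close> and \<open>D = 4 n - t\<^sup>2 > 0\<close>, where \<open>\<mu>\<close> is replaced by
  \<open>3 \<mu>\<close> to preserve the points with smooth reduction, would act on the roots of unity of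
  order \<open>m\<close> through an integer \<open>d\<close> with \<open>d\<^sup>2 - t d + n\<close> divisible by \<open>m\<close>, so that \<open>- D\<close> would be a
  square modulo \<open>m\<close>. For \<open>m = 4 D s\<^sup>2 - 1\<close> this makes \<open>-1\<close> a square modulo \<open>m\<close>, which is
  impossible since \<open>m\<close> is 3 modulo 4; taking for \<open>s\<close> a multiple of the residue characteristic
  keeps \<open>m\<close> invertible.

  Hence the curve has good reduction. There the valuation of \<open>wp z - wp w\<close> is determined by how deep
  \<open>z\<close>, \<open>w\<close>, \<open>z + w\<close> and \<open>z - w\<close> lie in the kernel of reduction, and torsion points whose order is not
  a prime power do not lie in it at all. The hypotheses on \<open>k\<close> and \<open>N\<close> then make the valuation of the
  quotient nonnegative.
\<close>

hide_const (open) Polynomials.lead_coeff Polynomials.degree up_ring.coeff up_ring.monom module.smult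

section \<open>Valuation rings\<close>

text \<open>Points are handled through their \<open>x\<close>-coordinates only. Without
  \<open>y\<close> a point is known up to sign, so the group law enters through the sum and the
  product of \<open>x (z + w)\<close> and \<open>x (z - w)\<close>, and congruent coordinates only
  show that \<open>z + w\<close> or \<open>z - w\<close> reduces to the origin. The value group is
  arbitrary, so neither a uniformizer nor a Tate parametrization is used. The equation with
  parameter \<open>b\<close> is chosen because its reduction has a node in every residue
  characteristic, 2 and 3 included, and because it carries a visible 3-torsion point that reduces to
  the node. The factor 3 comes from the components. For \<open>z\<close> in general position,
  \<open>x (\<mu> * z)\<close> and \<open>x (\<mu> * (2 * z))\<close> have the same valuation, so a
  component class c agrees with 2 c up to sign; both signs force 3 c = 0. At good places only the
  square of the final quotient is controlled, which suffices because valuation rings are integrally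
  closed.\<close>

locale valuation_ring =
  fixes V :: "'a::field set"
  assumes one_mem: "1 \<in> V"
    and add_mem: "x \<in> V \<Longrightarrow> y \<in> V \<Longrightarrow> x + y \<in> V"
    and uminus_mem: "x \<in> V \<Longrightarrow> - x \<in> V"
    and mult_mem: "x \<in> V \<Longrightarrow> y \<in> V \<Longrightarrow> x * y \<in> V"
    and inverse_mem: "x \<notin> V \<Longrightarrow> inverse x \<in> V"
begin

text \<open>The maximal ideal, as the set of nonunits. The element 0 is listed separately because
  \<open>inverse 0 = 0\<close> lies in \<open>V\<close>.\<close>

definition M :: "'a set" where
  "M = {x \<in> V. x = 0 \<or> inverse x \<notin> V}"

lemma zero_mem: "0 \<in> V"
  using add_mem[OF one_mem uminus_mem[OF one_mem]] by simp

lemma diff_mem: "x \<in> V \<Longrightarrow> y \<in> V \<Longrightarrow> x - y \<in> V"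
  using add_mem[of x "- y"] uminus_mem by simp

lemma power_mem: "x \<in> V \<Longrightarrow> x ^ n \<in> V"
  by (induction n) (auto intro: one_mem mult_mem)

lemma of_nat_mem: "of_nat n \<in> V"
  by (induction n) (auto intro: zero_mem one_mem add_mem)

lemma of_int_mem: "of_int n \<in> V"
  by (cases n) (auto intro: of_nat_mem uminus_mem simp del: of_nat_Suc)

lemma numeral_mem: "numeral n \<in> V"
  using of_nat_mem[of "numeral n"] by simp

lemmas V_intros = zero_mem one_mem numeral_mem of_nat_mem of_int_mem
  add_mem diff_mem uminus_mem mult_mem power_mem

lemma sum_mem: "(\<And>i. i \<in> A \<Longrightarrow> f i \<in> V) \<Longrightarrow> sum f A \<in> V"
  by (induction A rule: infinite_finite_induct) (auto intro: V_intros)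

lemma prod_mem: "(\<And>i. i \<in> A \<Longrightarrow> f i \<in> V) \<Longrightarrow> prod f A \<in> V"
  by (induction A rule: infinite_finite_induct) (auto intro: V_intros)

lemma M_imp_V: "x \<in> M \<Longrightarrow> x \<in> V"
  by (simp add: M_def)

lemma M_zero: "0 \<in> M"
  by (simp add: M_def zero_mem)

lemma M_one: "1 \<notin> M"
  by (simp add: M_def one_mem)

lemma unit_inverse: "x \<in> V \<Longrightarrow> x \<notin> M \<Longrightarrow> inverse x \<in> V"
  by (auto simp: M_def)

lemma unit_nonzero: "x \<notin> M \<Longrightarrow> x \<noteq> 0"
  using M_zero by auto

lemma unit_divide: "x \<in> V \<Longrightarrow> y \<in> V \<Longrightarrow> y \<notin> M \<Longrightarrow> x / y \<in> V"
  by (simp add: divide_inverse mult_mem unit_inverse)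

lemma M_mult: "x \<in> M \<Longrightarrow> y \<in> V \<Longrightarrow> x * y \<in> M"
proof -
  assume x: "x \<in> M" and y: "y \<in> V"
  show ?thesis
  proof (cases "x * y = 0")
    case False
    have "inverse (x * y) \<notin> V"
    proof
      assume "inverse (x * y) \<in> V"
      then have "inverse (x * y) * y \<in> V" using y mult_mem by blast
      moreover have "inverse (x * y) * y = inverse x" using False by (simp add: field_simps)
      ultimately have "inverse x \<in> V" by (simp only:)
      then show False using x False by (simp add: M_def)
    qed
    then show ?thesis using x y by (auto simp: M_def mult_mem)
  qed (auto simp: M_def zero_mem)
qed

lemma M_mult': "x \<in> V \<Longrightarrow> y \<in> M \<Longrightarrow> x * y \<in> M"
  using M_mult[of y x] by (simp add: mult.commute)

lemma M_uminus: "x \<in> M \<Longrightarrow> - x \<in> M"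
  using M_mult[of x "-1"] uminus_mem[OF one_mem] by simp

lemma M_prime: "x \<in> V \<Longrightarrow> y \<in> V \<Longrightarrow> x * y \<in> M \<Longrightarrow> x \<in> M \<or> y \<in> M"
proof (rule ccontr)
  assume "x \<in> V" "y \<in> V" "x * y \<in> M" "\<not> (x \<in> M \<or> y \<in> M)"
  then have "inverse x * inverse y \<in> V" "x \<noteq> 0" "y \<noteq> 0"
    using unit_inverse mult_mem unit_nonzero by auto
  with \<open>x * y \<in> M\<close> show False
    by (auto simp: M_def nonzero_inverse_mult_distrib mult.commute)
qed

text \<open>One of \<open>y / x\<close> and \<open>x / y\<close> lies in \<open>V\<close>, so the
  sum is a multiple of \<open>x\<close> or of \<open>y\<close>.\<close>

lemma M_add: "x \<in> M \<Longrightarrow> y \<in> M \<Longrightarrow> x + y \<in> M"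
proof -
  assume x: "x \<in> M" and y: "y \<in> M"
  show ?thesis
  proof (cases "x = 0 \<or> y = 0")
    case False
    have "y / x \<in> V \<or> x / y \<in> V"
      using inverse_mem[of "y / x"] by auto
    moreover have "x + y = x * (1 + y / x)" "x + y = y * (1 + x / y)"
      using False by (auto simp: field_simps)
    ultimately show ?thesis
      using M_mult x y add_mem one_mem by metis
  qed (use x y in auto)
qed

lemma M_diff: "x \<in> M \<Longrightarrow> y \<in> M \<Longrightarrow> x - y \<in> M"
  using M_add[of x "- y"] M_uminus by simp

lemma M_power: "x \<in> M \<Longrightarrow> n > 0 \<Longrightarrow> x ^ n \<in> M"
  by (cases n) (auto intro: M_mult M_imp_V V_intros)

lemma M_prime_power: "x \<in> V \<Longrightarrow> x ^ n \<in> M \<Longrightarrow> x \<in> M"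
  by (induction n) (use M_one M_prime in \<open>auto intro: V_intros\<close>)

lemma M_sum: "(\<And>i. i \<in> A \<Longrightarrow> f i \<in> M) \<Longrightarrow> sum f A \<in> M"
  by (induction A rule: infinite_finite_induct) (auto intro: M_zero M_add)

lemma M_prime_prod: "(\<And>i. i \<in> A \<Longrightarrow> f i \<in> V) \<Longrightarrow> prod f A \<in> M \<Longrightarrow> \<exists>i\<in>A. f i \<in> M"
proof (induction A rule: infinite_finite_induct)
  case (insert x F)
  then show ?case using M_prime[of "f x" "prod f F"] prod_mem[of F f] by auto
qed (use M_one in auto)

lemmas M_intros = M_zero M_add M_diff M_uminus M_mult M_mult'

lemma unit_mult: "x \<in> V \<Longrightarrow> x \<notin> M \<Longrightarrow> y \<in> V \<Longrightarrow> y \<notin> M \<Longrightarrow> x * y \<notin> M"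
  using M_prime by blast

lemma inverse_in_M: "x \<notin> V \<Longrightarrow> inverse x \<in> M"
  by (auto simp: M_def inverse_mem)

lemma inverse_in_M': "x \<notin> V \<Longrightarrow> 1 / x \<in> M"
  using inverse_in_M by (simp add: divide_inverse)

text \<open>If \<open>x\<close> were outside \<open>V\<close>, its inverse would lie in
  \<open>M\<close>, and dividing the equation by \<open>x ^ n\<close> would put 1 into
  \<open>M\<close>.\<close>

lemma monic_root_mem:
  assumes "poly p x = 0" "lead_coeff p = 1" "\<And>i. coeff p i \<in> V"
  shows "x \<in> V"
proof (rule ccontr)
  assume x: "x \<notin> V"
  then have x0: "x \<noteq> 0" using zero_mem by auto
  define n where "n = degree p"
  define y where "y = inverse x"
  have y: "y \<in> M" using inverse_in_M[OF x] by (simp add: y_def)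
  have "0 = (\<Sum>i\<le>n. coeff p i * x ^ i)"
    using assms(1) by (simp add: poly_altdef n_def)
  also have "\<dots> = (\<Sum>i<n. coeff p i * x ^ i) + x ^ n"
    using assms(2) by (simp add: n_def lessThan_Suc_atMost[symmetric])
  finally have "0 = ((\<Sum>i<n. coeff p i * x ^ i) + x ^ n) * y ^ n"
    by simp
  also have "\<dots> = (\<Sum>i<n. coeff p i * y ^ (n - i)) + 1"
  proof -
    have "x ^ i * y ^ n = y ^ (n - i)" if "i \<le> n" for i
    proof -
      have "y ^ n = y ^ i * y ^ (n - i)" using that by (simp flip: power_add)
      moreover have "x ^ i * y ^ i = 1" using x0 by (simp add: y_def flip: power_mult_distrib)
      ultimately show ?thesis by (metis mult.assoc mult_1)
    qed
    then show ?thesis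
      by (auto simp: distrib_right sum_distrib_right mult.assoc intro!: sum.cong)
  qed
  finally have "1 = - (\<Sum>i<n. coeff p i * y ^ (n - i))"
    by (simp add: eq_neg_iff_add_eq_0 add.commute)
  moreover have "(\<Sum>i<n. coeff p i * y ^ (n - i)) \<in> M"
    using assms(3) y by (intro M_sum M_mult' M_power) auto
  ultimately show False using M_one M_uminus by metis
qed

lemma quadratic_root_mem:
  assumes "x\<^sup>2 - s * x + p = 0" "s \<in> V" "p \<in> V"
  shows "x \<in> V"
proof (rule monic_root_mem[of "[:p, - s, 1:]"])
  show "coeff [:p, - s, 1:] i \<in> V" for i
    using assms by (auto simp: coeff_pCons intro: V_intros split: nat.split)
qed (use assms in \<open>auto simp: power2_eq_square algebra_simps\<close>)

text \<open>Values at \<open>z + w\<close> and \<open>z - w\<close> are only known through their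
  symmetric functions; integral closedness recovers integrality of each.\<close>

lemma sum_prod_mem:
  assumes "x + y \<in> V" "x * y \<in> V"
  shows "x \<in> V" "y \<in> V"
  using quadratic_root_mem[of x "x + y" "x * y"] quadratic_root_mem[of y "x + y" "x * y"] assms
  by (auto simp: power2_eq_square algebra_simps)

lemma square_mem: "x\<^sup>2 \<in> V \<Longrightarrow> x \<in> V"
  using quadratic_root_mem[of x 0 "- x\<^sup>2"] by (auto intro: V_intros)

end

text \<open>Chevalley's extension theorem in the case needed here: a subring that is maximal among those
  in which \<open>inverse x\<close> is not invertible is a valuation ring.\<close>

theorem algebraic_int_valuation_criterion:
  fixes x :: "'a::field"
  assumes "\<And>V. valuation_ring V \<Longrightarrow> x \<in> V"
  shows "algebraic_int x"
proof (rule ccontr)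
  assume nint: "\<not> algebraic_int x"
  then have x0: "x \<noteq> 0" by auto
  define y where "y = inverse x"
  have y0: "y \<noteq> 0" using x0 by (simp add: y_def)
  define R where "R = (\<lambda>A::'a set. 1 \<in> A \<and> (\<forall>a\<in>A. \<forall>b\<in>A. a + b \<in> A \<and> a * b \<in> A \<and> - a \<in> A) \<and> y \<in> A)"
  define S where "S = {A. R A \<and> inverse y \<notin> A}"
  \<comment> \<open>The ring generated by \<open>1 / x\<close> over the integers. It contains
    \<open>x\<close> only if \<open>x\<close> is integral.\<close>
  define Zy where "Zy = {poly p y | p. \<forall>i. coeff p i \<in> \<int>}"
  have "R Zy"
    unfolding R_def
  proof (intro conjI ballI)
    show "1 \<in> Zy" unfolding Zy_def by (auto intro!: exI[of _ 1])
    show "y \<in> Zy" unfolding Zy_def by (auto intro!: exI[of _ "[:0, 1:]"] simp: coeff_pCons split: nat.split)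
    fix a b assume "a \<in> Zy" "b \<in> Zy"
    then obtain p q where pq: "a = poly p y" "b = poly q y" "\<forall>i. coeff p i \<in> \<int>" "\<forall>i. coeff q i \<in> \<int>"
      unfolding Zy_def by auto
    have "a + b = poly (p + q) y" "a * b = poly (p * q) y" "- a = poly (- p) y"
      by (simp_all add: pq)
    moreover have "\<forall>i. coeff (p + q) i \<in> \<int>" "\<forall>i. coeff (p * q) i \<in> \<int>" "\<forall>i. coeff (- p) i \<in> \<int>"
      using pq(3,4) by (auto simp: coeff_mult)
    ultimately show "a + b \<in> Zy" "a * b \<in> Zy" "- a \<in> Zy"
      unfolding Zy_def by blast+
  qed
  moreover have "inverse y \<notin> Zy"
  proof
    assume "inverse y \<in> Zy"
    then obtain p where p: "x = poly p y" "\<forall>i. coeff p i \<in> \<int>"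
      unfolding Zy_def y_def by auto
    define n where "n = degree p"
    \<comment> \<open>Multiplying \<open>x = poly p (inverse x)\<close> by \<open>x ^ n\<close>
      gives a monic equation of degree \<open>n + 1\<close>.\<close>
    define q where "q = monom 1 (Suc n) - reflect_poly p"
    have "coeff (reflect_poly p) i = 0" if "i > n" for i
      using that n_def degree_reflect_poly_le[of "p"]
      by (intro coeff_eq_0) simp
    then have c: "coeff q (Suc n) = 1" "\<And>i. i > Suc n \<Longrightarrow> coeff q i = 0"
      by (auto simp: q_def)
    then have "degree q = Suc n"
      by (metis antisym degree_le le_degree zero_neq_one)
    moreover have "poly q x = 0"
    proof -
      have "poly (reflect_poly p) x = x ^ n * poly p (inverse x)"
        using x0 n_def by (simp add: poly_reflect_poly_nz)
      also have "\<dots> = x ^ Suc n" using p(1) by (simp add: y_def)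
      finally show ?thesis by (simp add: q_def poly_monom)
    qed
    moreover have "coeff q i \<in> \<int>" for i
      using p(2) by (auto simp: q_def coeff_reflect_poly)
    ultimately have "algebraic_int x"
      using c(1) unfolding algebraic_int.simps by (intro exI[of _ q]) auto
    then show False using nint by simp
  qed
  ultimately have "Zy \<in> S" by (simp add: S_def)
  have "\<exists>V\<in>S. \<forall>U\<in>S. V \<subseteq> U \<longrightarrow> U = V"
  proof (rule subset_Zorn_nonempty)
    show "S \<noteq> {}" using \<open>Zy \<in> S\<close> by auto
    fix C assume C: "C \<noteq> {}" "subset.chain S C"
    have "R (\<Union>C)"
      unfolding R_def
    proof (intro conjI ballI)
      show "1 \<in> \<Union>C" "y \<in> \<Union>C"
        using C by (auto simp: subset_chain_def S_def R_def)
      fix a b assume "a \<in> \<Union>C" "b \<in> \<Union>C"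
      then obtain A B where AB: "A \<in> C" "a \<in> A" "B \<in> C" "b \<in> B" by blast
      then have "A \<subseteq> B \<or> B \<subseteq> A" using C(2) unfolding subset_chain_def by blast
      then obtain A where "A \<in> C" "a \<in> A" "b \<in> A" using AB by blast
      moreover have "R A" using C \<open>A \<in> C\<close> by (auto simp: subset_chain_def S_def)
      ultimately show "a + b \<in> \<Union>C" "a * b \<in> \<Union>C" "- a \<in> \<Union>C"
        unfolding R_def by blast+
    qed
    then show "\<Union>C \<in> S"
      using C by (auto simp: subset_chain_def S_def)
  qed
  then obtain V where "V \<in> S" and max: "\<And>U. U \<in> S \<Longrightarrow> V \<subseteq> U \<Longrightarrow> U = V" by blast
  have RV: "R V" and xV: "inverse y \<notin> V" using \<open>V \<in> S\<close> by (auto simp: S_def)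
  have V1: "1 \<in> V" and yV: "y \<in> V" and Vadd: "a \<in> V \<Longrightarrow> b \<in> V \<Longrightarrow> a + b \<in> V"
    and Vmult: "a \<in> V \<Longrightarrow> b \<in> V \<Longrightarrow> a * b \<in> V" and Vneg: "a \<in> V \<Longrightarrow> - a \<in> V" for a b
    using RV by (auto simp: R_def)
  have V0: "0 \<in> V" using Vadd[OF V1 Vneg[OF V1]] by simp
  define P where "P = {p :: 'a poly. \<forall>i. coeff p i \<in> V}"
  have Vsum: "(\<And>i. i \<in> I \<Longrightarrow> f i \<in> V) \<Longrightarrow> sum f I \<in> V" for f :: "nat \<Rightarrow> 'a" and I
    by (induction I rule: infinite_finite_induct) (auto intro: V0 Vadd)
  have Vpow: "a \<in> V \<Longrightarrow> a ^ n \<in> V" for a n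
    by (induction n) (auto intro: V1 Vmult)
  have Padd: "p \<in> P \<Longrightarrow> q \<in> P \<Longrightarrow> p + q \<in> P" and Pmult: "p \<in> P \<Longrightarrow> q \<in> P \<Longrightarrow> p * q \<in> P"
    and Pneg: "p \<in> P \<Longrightarrow> - p \<in> P" and Pc: "a \<in> V \<Longrightarrow> [:a:] \<in> P"
    and Pmonom: "monom a n \<in> P \<longleftrightarrow> a \<in> V" for p q a n
    unfolding P_def
    by (auto simp: coeff_mult coeff_pCons V0 Vadd Vneg Vmult coeff_monom
          intro!: Vsum split: nat.split if_splits)
  \<comment> \<open>The ring obtained by adjoining \<open>z\<close> is strictly larger than
    \<open>V\<close>, so by maximality it must contain \<open>inverse y\<close>.\<close>
  have adj: "\<exists>p\<in>P. inverse y = poly p z" if z: "z \<notin> V" for z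
  proof (rule ccontr)
    assume *: "\<not> ?thesis"
    define U where "U = (\<lambda>p. poly p z) ` P"
    have VU: "V \<subseteq> U"
      unfolding U_def using Pc by (force intro: image_eqI[of _ _ "[:_:]"])
    have "R U"
      unfolding R_def
    proof (intro conjI ballI)
      show "1 \<in> U" "y \<in> U" using VU V1 yV by auto
      fix a b assume "a \<in> U" "b \<in> U"
      then show "a + b \<in> U" "a * b \<in> U" "- a \<in> U"
        unfolding U_def using Padd Pmult Pneg by (auto simp flip: poly_add poly_mult poly_minus)
    qed
    then have "U \<in> S" using * by (auto simp: S_def U_def)
    then have "U = V" using max VU by blast
    moreover have "z \<in> U" unfolding U_def
      using Pmonom[of 1 1] V1 by (auto intro!: image_eqI[of _ _ "monom 1 1"] simp: poly_monom)
    ultimately show False using z by simp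
  qed
  text \<open>Elements congruent to 1 modulo \<open>y\<close> are invertible, by maximality.\<close>
  have unit: "inverse (1 - y * a) \<in> V" if a: "a \<in> V" for a
  proof (rule ccontr)
    define s where "s = 1 - y * a"
    assume "inverse (1 - y * a) \<notin> V"
    then obtain p where p: "p \<in> P" "inverse y = poly p (inverse s)"
      using adj s_def by blast
    have s0: "s \<noteq> 0" using \<open>inverse (1 - y * a) \<notin> V\<close> V0 s_def by auto
    have sV: "s \<in> V" unfolding s_def using Vadd[OF V1 Vneg[OF Vmult[OF yV a]]] by simp
    define n where "n = degree p"
    have "inverse y * s ^ n = (\<Sum>i\<le>n. coeff p i * s ^ (n - i))"
    proof -
      have "inverse s ^ i * s ^ n = s ^ (n - i)" if "i \<le> n" for i
      proof -
        have "s ^ n = s ^ i * s ^ (n - i)" using that by (simp flip: power_add)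
        moreover have "inverse s ^ i * s ^ i = 1" using s0 by (simp flip: power_mult_distrib)
        ultimately show ?thesis by (metis mult.assoc mult_1)
      qed
      then show ?thesis
        unfolding p(2) by (auto simp: poly_altdef n_def[symmetric] sum_distrib_right mult.assoc intro!: sum.cong)
    qed
    also have "\<dots> \<in> V" using p(1) sV by (auto intro!: Vsum Vmult Vpow simp: P_def)
    finally have 1: "inverse y * s ^ n \<in> V" .
    \<comment> \<open>As \<open>s\<close> is congruent to 1 modulo \<open>y\<close>, so is
      \<open>s ^ n\<close>. Hence \<open>inverse y\<close> differs from
      \<open>inverse y * s ^ n\<close>, already known to lie in \<open>V\<close>, by an element of
      \<open>V\<close>.\<close>
    have "\<exists>c\<in>V. s ^ n = 1 - y * c"
    proof (induction n)
      case (Suc n)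
      then obtain c where c: "c \<in> V" "s ^ n = 1 - y * c" by auto
      have "s ^ Suc n = 1 - y * (c + a - y * a * c)"
        by (simp add: c(2)) (simp add: s_def algebra_simps)
      moreover have "c + a - y * a * c \<in> V"
        using Vadd[OF Vadd[OF c(1) a] Vneg[OF Vmult[OF Vmult[OF yV a] c(1)]]] by simp
      ultimately show ?case by blast
    qed (auto intro!: bexI[of _ 0] V0)
    then obtain c where c: "c \<in> V" "s ^ n = 1 - y * c" by auto
    have "inverse y = inverse y * s ^ n + c" using c y0 by (simp add: field_simps)
    then show False using xV Vadd[OF 1 c(1)] by simp
  qed
  have "valuation_ring V"
  proof
    show "1 \<in> V" by (rule V1)
    fix z assume zV: "z \<notin> V"
    then have z0: "z \<noteq> 0" using V0 by auto
    show "inverse z \<in> V"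
    proof (rule ccontr)
      assume zV': "inverse z \<notin> V"
      define Q where "Q = (\<lambda>n u. \<exists>p\<in>P. degree p \<le> n \<and> inverse y = poly p u)"
      text \<open>The degree of a relation for \<open>u\<close> can be lowered with a relation for \<open>inverse u\<close> of
        at most the same degree.\<close>
      have lower: "\<exists>k<n. Q k u" if n: "Q n u" and m: "Q m (inverse u)" and "m \<le> n" "u \<noteq> 0" for n m u
      proof -
        obtain p q where p: "p \<in> P" "degree p \<le> n" "inverse y = poly p u"
          and q: "q \<in> P" "degree q \<le> m" "inverse y = poly q (inverse u)"
          using n m unfolding Q_def by blast
        have pV: "coeff p i \<in> V" and qV: "coeff q i \<in> V" for i
          using p(1) q(1) by (auto simp: P_def)
        have "m \<noteq> 0"
        proof
          assume "m = 0"
          then have "inverse y = coeff q 0"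
            using q(2,3) by (metis degree_eq_zeroE coeff_pCons_0 le_zero_eq poly_pCons mult_zero_right poly_0 add.right_neutral)
          then show False using qV xV by metis
        qed
        define c where "c = inverse (1 - y * coeff q 0)"
        have c: "c \<in> V" using unit qV by (simp add: c_def)
        have nz: "1 - y * coeff q 0 \<noteq> 0"
        proof
          assume "1 - y * coeff q 0 = 0"
          then have "inverse y = coeff q 0" using y0 by (simp add: field_simps)
          then show False using qV xV by metis
        qed
        \<comment> \<open>Multiplied by \<open>u ^ n\<close>, the relation for
          \<open>inverse u\<close> has the top term \<open>(inverse y - coeff q 0) * u ^ n\<close>.
          The factor \<open>c\<close> turns it into \<open>u ^ n = y * poly s u\<close> with
          \<open>s\<close> of degree below \<open>n\<close>, which serves to replace the leading
          term of \<open>p\<close>.\<close>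
        define s where "s = (\<Sum>i<m. monom (c * coeff q (Suc i)) (n - 1 - i))"
        have sP: "s \<in> P"
          unfolding s_def P_def using c qV
          by (auto simp: coeff_sum coeff_monom V0 intro!: Vsum Vmult)
        have degs: "degree s \<le> n - 1"
          unfolding s_def by (intro degree_sum_le) (auto intro: order.trans[OF degree_monom_le])
        have "u ^ n * inverse y = u ^ n * (\<Sum>i\<le>m. coeff q i * inverse u ^ i)"
        proof -
          have "poly q (inverse u) = (\<Sum>i\<le>m. coeff q i * inverse u ^ i)"
            unfolding poly_altdef using q(2)
            by (intro sum.mono_neutral_left) (auto simp: coeff_eq_0)
          then show ?thesis using q(3) by simp
        qed
        also have "\<dots> = u ^ n * coeff q 0 + u ^ n * (\<Sum>i<m. coeff q (Suc i) * inverse u ^ Suc i)"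
          using \<open>m \<noteq> 0\<close> by (simp add: sum.atMost_shift distrib_left)
        finally have "u ^ n * (inverse y - coeff q 0) = (\<Sum>i<m. coeff q (Suc i) * (u ^ n * inverse u ^ Suc i))"
          by (simp add: algebra_simps sum_distrib_left)
        also have "\<dots> = (\<Sum>i<m. coeff q (Suc i) * u ^ (n - 1 - i))"
        proof (intro sum.cong refl)
          fix i assume "i \<in> {..<m}"
          then have *: "u ^ n = u ^ (n - 1 - i) * u ^ Suc i"
            using \<open>m \<le> n\<close> by (simp flip: power_add power_Suc)
          have "u ^ Suc i * inverse u ^ Suc i = 1"
            using \<open>u \<noteq> 0\<close> by (simp flip: power_mult_distrib del: power_Suc)
          then have "u ^ n * inverse u ^ Suc i = u ^ (n - 1 - i)"
            unfolding * mult.assoc by (simp only: mult_1_right)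
          then show "coeff q (Suc i) * (u ^ n * inverse u ^ Suc i) = coeff q (Suc i) * u ^ (n - 1 - i)"
            by (simp only:)
        qed
        finally have "c * (u ^ n * (inverse y - coeff q 0)) = poly s u"
          by (simp add: s_def poly_sum poly_monom sum_distrib_left mult.assoc)
        moreover have "c * (u ^ n * (inverse y - coeff q 0)) * y = u ^ n"
          using nz y0 by (simp add: c_def field_simps)
        ultimately have un: "u ^ n = y * poly s u" by (simp add: mult.commute)
        define p' where "p' = p - monom (coeff p n) n + [:y * coeff p n:] * s"
        have "p' \<in> P"
          unfolding p'_def using Padd[OF Padd[OF p(1) Pneg] Pmult[OF Pc sP]] Pmonom pV Vmult yV by simp
        moreover have "degree p' \<le> n - 1"
          unfolding p'_def
        proof (rule degree_add_le)
          have "coeff (p - monom (coeff p n) n) i = 0" if "i > n - 1" for i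
            using that p(2) by (cases "i = n") (auto intro: coeff_eq_0)
          then show "degree (p - monom (coeff p n) n) \<le> n - 1"
            by (intro degree_le) auto
          show "degree ([:y * coeff p n:] * s) \<le> n - 1"
            using degs degree_smult_le[of "y * coeff p n" s] by simp
        qed
        moreover have "inverse y = poly p' u"
          using p(3) un by (simp add: p'_def poly_monom)
        ultimately show ?thesis
          using \<open>m \<noteq> 0\<close> \<open>m \<le> n\<close> unfolding Q_def by (intro exI[of _ "n - 1"]) auto
      qed
      have ex: "\<exists>n. Q n z" "\<exists>n. Q n (inverse z)"
        using adj[OF zV] adj[OF zV'] unfolding Q_def by auto
      define n where "n = (LEAST n. Q n z)"
      define m where "m = (LEAST m. Q m (inverse z))"
      have nm: "Q n z" "Q m (inverse z)"
        using ex unfolding n_def m_def by (metis LeastI)+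
      show False
      proof (cases "m \<le> n")
        case True
        then obtain k where "k < n" "Q k z" using lower[OF nm True z0] by auto
        then show False unfolding n_def using not_less_Least by blast
      next
        case False
        then obtain k where "k < m" "Q k (inverse z)"
          using lower[of m "inverse z" n] nm z0 by auto
        then show False unfolding m_def using not_less_Least by blast
      qed
    qed
  qed (auto intro: Vadd Vmult Vneg)
  then have "x \<in> V" using assms by blast
  then show False using xV by (simp add: y_def)
qed

section \<open>Polynomials over an algebraically closed valued field\<close>

locale alg_closed_valuation_ring = valuation_ring V for V :: "'a::alg_closed_field set"
begin

text \<open>At a root of the product of all \<open>p\<close> minus 1, which is integral, the values
  multiply to 1 and so are units. This yields points that avoid finitely many residue classes
  without a discussion of the size of the residue field.\<close>

lemma exists_unit_values:
  assumes "finite A" "\<And>p. p \<in> A \<Longrightarrow> lead_coeff p = 1 \<and> degree p > 0 \<and> (\<forall>i. coeff p i \<in> V)"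
  obtains x where "x \<in> V" "\<And>p. p \<in> A \<Longrightarrow> poly p x \<in> V \<and> poly p x \<notin> M"
proof (cases "A = {}")
  case False
  define P where "P = prod (\<lambda>p. p) A"
  have coeffs: "coeff (prod (\<lambda>p. p) B) i \<in> V" if "B \<subseteq> A" "finite B" for B i
    using that(2,1)
  proof (induction B arbitrary: i rule: finite_induct)
    case (insert p B)
    then show ?case using assms(2)[of p] by (auto simp: coeff_mult intro!: sum_mem mult_mem)
  qed (auto simp: coeff_1 V_intros)
  have lead: "lead_coeff P = 1"
    unfolding P_def using assms(2) by (simp add: lead_coeff_prod)
  have "0 \<notin> A" using assms(2)[of 0] by auto
  then have "degree P = (\<Sum>p\<in>A. degree p)"
    unfolding P_def by (intro degree_prod_eq_sum_degree) auto
  then have deg: "degree P > 0"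
    using assms False by (auto simp: sum_pos)
  have deg': "degree (P - 1) = degree P"
    using deg degree_add_eq_left[of "- 1" P] by simp
  then obtain x where x: "poly (P - 1) x = 0"
    using alg_closed_imp_poly_has_root[of "P - 1"] deg by auto
  have "x \<in> V"
  proof (rule monic_root_mem[OF x])
    show "lead_coeff (P - 1) = 1" using lead deg deg' by simp
    show "coeff (P - 1) i \<in> V" for i
      using coeffs[of A i] assms(1) by (auto simp: P_def coeff_1 intro!: V_intros)
  qed
  moreover have "poly p x \<in> V \<and> poly p x \<notin> M" if "p \<in> A" for p
  proof -
    have mem: "poly q x \<in> V" if "q \<in> A" for q
      unfolding poly_altdef using assms(2)[OF that] \<open>x \<in> V\<close> by (auto intro!: sum_mem V_intros)
    have "poly p x * (\<Prod>q\<in>A - {p}. poly q x) = 1"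
      using x \<open>p \<in> A\<close> assms(1) by (simp add: P_def poly_prod prod.remove)
    moreover have "(\<Prod>q\<in>A - {p}. poly q x) \<in> V" using mem by (intro prod_mem) auto
    ultimately show ?thesis using M_mult[of "poly p x"] M_one mem[OF that] by metis
  qed
  ultimately show ?thesis using that by blast
qed (use that zero_mem in auto)

text \<open>A polynomial has constant valuation away from the residue classes of its integral roots,
  and congruent arguments then give values whose ratio is congruent to 1.\<close>

lemma poly_ratio:
  fixes f :: "'a poly"
  assumes "f \<noteq> 0"
  obtains S where "finite S" "S \<subseteq> V"
    "\<And>x y. x \<in> V \<Longrightarrow> y \<in> V \<Longrightarrow> \<forall>s\<in>S. x - s \<notin> M \<and> y - s \<notin> M \<Longrightarrow>
       poly f x \<noteq> 0 \<and> poly f x / poly f y \<in> V \<and> (x - y \<in> M \<longrightarrow> poly f x / poly f y - 1 \<in> M)"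
proof -
  obtain A where A: "f = smult (lead_coeff f) (\<Prod>a\<in>#A. [:- a, 1:])"
    using alg_closed_imp_factorization[OF assms] by metis
  define S where "S = set_mset A \<inter> V"
  have main: "(\<Prod>a\<in>#B. x - a) \<noteq> 0 \<and> (\<Prod>a\<in>#B. x - a) / (\<Prod>a\<in>#B. y - a) \<in> V \<and>
      (x - y \<in> M \<longrightarrow> (\<Prod>a\<in>#B. x - a) / (\<Prod>a\<in>#B. y - a) - 1 \<in> M)"
    if "B \<subseteq># A" and xy: "x \<in> V" "y \<in> V" and S: "\<forall>s\<in>S. x - s \<notin> M \<and> y - s \<notin> M" for B x y
    using that(1)
  proof (induction B)
    case (add a B)
    define r where "r = (\<Prod>a\<in>#B. x - a) / (\<Prod>a\<in>#B. y - a)"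
    define t where "t = (x - a) / (y - a)"
    have B: "B \<subseteq># A" and aA: "a \<in># A" using add.prems
      by (auto dest: mset_subset_eq_insertD simp: subset_mset.less_imp_le)
    have t: "x - a \<noteq> 0 \<and> t \<in> V \<and> (x - y \<in> M \<longrightarrow> t - 1 \<in> M)"
    proof (cases "a \<in> V")
      case True
      then have a: "x - a \<notin> M" "y - a \<notin> M" using S aA by (auto simp: S_def)
      have "inverse (y - a) \<in> V" using a True xy by (auto intro!: unit_inverse V_intros)
      moreover have "t = (x - a) * inverse (y - a)" "t - 1 = (x - y) * inverse (y - a)"
        using unit_nonzero[OF a(2)] by (auto simp: t_def field_simps)
      moreover have "x - a \<in> V" using xy True by (auto intro: V_intros)
      ultimately show ?thesis
        using unit_nonzero[OF a(1)] by (auto intro: mult_mem M_mult)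
    next
      case False
      have a0: "a \<noteq> 0" using False zero_mem by auto
      \<comment> \<open>For a root outside \<open>V\<close>, \<open>x - a\<close> is
        \<open>- a\<close> times an element congruent to 1, and the factor \<open>- a\<close>
        cancels in the quotient.\<close>
      have ia: "inverse a \<in> M" using inverse_in_M[OF False] .
      have m: "x * inverse a \<in> M" "y * inverse a \<in> M" using ia xy by (auto intro: M_mult')
      have u: "y * inverse a - 1 \<notin> M"
        using m(2) M_one M_diff[of "y * inverse a" "y * inverse a - 1"] by auto
      have uV: "y * inverse a - 1 \<in> V" "x * inverse a - 1 \<in> V" "x * inverse a - y * inverse a \<in> M"
        using m M_imp_V by (auto intro: V_intros M_diff)
      have ne: "x \<noteq> a" "y \<noteq> a" using xy False by auto
      have "t = (x * inverse a - 1) * inverse (y * inverse a - 1)"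
        using a0 ne by (simp add: t_def field_simps)
      moreover have "t - 1 = (x * inverse a - y * inverse a) * inverse (y * inverse a - 1)"
        using a0 ne by (simp add: t_def field_simps)
      moreover have "inverse (y * inverse a - 1) \<in> V" using u uV by (intro unit_inverse)
      ultimately show ?thesis using ne uV by (auto intro: mult_mem M_mult)
    qed
    have r: "(\<Prod>a\<in>#B. x - a) \<noteq> 0 \<and> r \<in> V \<and> (x - y \<in> M \<longrightarrow> r - 1 \<in> M)"
      using add.IH[OF B] unfolding r_def .
    have "t * r - 1 = (t - 1) * r + (r - 1)" by (simp add: algebra_simps)
    then have "x - y \<in> M \<longrightarrow> t * r - 1 \<in> M" using r t M_mult M_add by metis
    moreover have "(\<Prod>a\<in>#add_mset a B. x - a) / (\<Prod>a\<in>#add_mset a B. y - a) = t * r"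
      by (simp add: t_def r_def)
    ultimately show ?case using r t mult_mem by simp
  qed (auto intro: V_intros M_intros)
  have eval: "poly f x = lead_coeff f * (\<Prod>a\<in>#A. x - a)" for x
  proof -
    have "poly (\<Prod>a\<in>#A. [:- a, 1:]) x = (\<Prod>a\<in>#A. x - a)"
      by (induction A) (simp_all add: algebra_simps)
    then show ?thesis by (subst A) simp
  qed
  have "finite S" "S \<subseteq> V" by (auto simp: S_def)
  then show ?thesis
    using that[of S] main[OF subset_mset.order_refl] assms by (simp add: eval)
qed

end

section \<open>The Weierstrass function\<close>

text \<open>One-variable factor of the majorant of \<open>1 / norm w ^ 3\<close>, with half its
  exponent. The maximum with 1 is needed since \<open>0 powr (- (3/2))\<close> is 0 and would not
  majorize anything.\<close>

lemma summable_on_int_power: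
  "(\<lambda>m::int. real_of_int (max 1 \<bar>m\<bar>) powr (- (3/2))) summable_on UNIV"
proof -
  let ?f = "\<lambda>m::int. real_of_int (max 1 \<bar>m\<bar>) powr (- (3/2))"
  have "summable (\<lambda>n::nat. real n powr (- (3/2)))"
    using summable_real_powr_iff[of "- (3/2)"] by simp
  then have "(\<lambda>n::nat. real n powr (- (3/2))) summable_on UNIV"
    by (subst summable_on_UNIV_nonneg_real_iff) auto
  then have nat: "(\<lambda>n::nat. real n powr (- (3/2))) summable_on {1..}"
    by (rule summable_on_subset_banach) auto
  have "bij_betw (\<lambda>m::int. nat m) {1..} {1..}"
    by (rule bij_betwI[where g = int]) auto
  from summable_on_reindex_bij_betw[OF this, of "\<lambda>n. real n powr (- (3/2))"] nat
  have "(\<lambda>m::int. real (nat m) powr (- (3/2))) summable_on {1..}" by simp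
  then have pos: "?f summable_on {1..}"
    by (rule summable_on_cong[THEN iffD1, rotated]) auto
  have "bij_betw (\<lambda>m::int. - m) {..-1} {1..}"
    by (rule bij_betwI[where g = uminus]) auto
  from summable_on_reindex_bij_betw[OF this, of ?f] pos
  have "?f summable_on {..-1}" by simp
  with pos have "?f summable_on ({..-1} \<union> {1..})"
    by (intro summable_on_Un_disjoint) auto
  then have "?f summable_on insert 0 ({..-1} \<union> {1..})"
    by (subst summable_on_insert_iff)
  moreover have "insert 0 ({..-1} \<union> {1..}) = (UNIV :: int set)" by auto
  ultimately show ?thesis by simp
qed

section \<open>The period lattice and convergence of the defining series\<close>

locale period_ratio =
  fixes \<tau> :: complex
  assumes Im_pos: "Im \<tau> > 0"
begin

abbreviation "L \<equiv> lattice_of \<tau>"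
abbreviation "wp z \<equiv> weierstrass_p z L"

lemma lattice_intro: "of_int m + of_int n * \<tau> \<in> L"
  unfolding lattice_of_def by blast

lemma latticeE:
  assumes "w \<in> L"
  obtains m n where "w = of_int m + of_int n * \<tau>"
  using assms unfolding lattice_of_def by blast

lemma zero_in_lattice: "0 \<in> L"
  using lattice_intro[of 0 0] by simp

lemma one_in_lattice: "1 \<in> L" and tau_in_lattice: "\<tau> \<in> L"
  using lattice_intro[of 1 0] lattice_intro[of 0 1] by simp_all

lemma add_in_lattice: "v \<in> L \<Longrightarrow> w \<in> L \<Longrightarrow> v + w \<in> L"
proof -
  assume "v \<in> L" "w \<in> L"
  then obtain m n m' n' where "v = of_int m + of_int n * \<tau>" "w = of_int m' + of_int n' * \<tau>"
    by (metis latticeE)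
  then have "v + w = of_int (m + m') + of_int (n + n') * \<tau>" by (simp add: algebra_simps)
  then show ?thesis by (simp only: lattice_intro)
qed

lemma uminus_in_lattice: "v \<in> L \<Longrightarrow> - v \<in> L"
proof -
  assume "v \<in> L"
  then obtain m n where "v = of_int m + of_int n * \<tau>"
    by (metis latticeE)
  then have "- v = of_int (- m) + of_int (- n) * \<tau>" by (simp add: algebra_simps)
  then show ?thesis by (simp only: lattice_intro)
qed

lemma diff_in_lattice: "v \<in> L \<Longrightarrow> w \<in> L \<Longrightarrow> v - w \<in> L"
  using add_in_lattice[of v "- w"] uminus_in_lattice by simp

lemma uminus_in_lattice_iff: "- v \<in> L \<longleftrightarrow> v \<in> L"
  using uminus_in_lattice[of v] uminus_in_lattice[of "- v"] by auto

lemma add_in_lattice_iff: "w \<in> L \<Longrightarrow> v + w \<in> L \<longleftrightarrow> v \<in> L"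
  using add_in_lattice[of v w] diff_in_lattice[of "v + w" w] by auto

lemma of_int_mult_in_lattice: "w \<in> L \<Longrightarrow> of_int k * w \<in> L"
proof -
  assume "w \<in> L"
  then obtain m n where "w = of_int m + of_int n * \<tau>"
    by (metis latticeE)
  then have "of_int k * w = of_int (k * m) + of_int (k * n) * \<tau>" by (simp add: algebra_simps)
  then show ?thesis by (simp only: lattice_intro)
qed

lemma real_coordinates:
  obtains s t where "z = of_real s + of_real t * \<tau>"
proof
  show "z = of_real (Re z - Im z / Im \<tau> * Re \<tau>) + of_real (Im z / Im \<tau>) * \<tau>"
    using Im_pos by (simp add: complex_eq_iff)
qed

lemma coordinates_eq_iff:
  fixes s t s' t' :: real
  shows "of_real s + of_real t * \<tau> = of_real s' + of_real t' * \<tau> \<longleftrightarrow> s = s' \<and> t = t'"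
  using Im_pos by (auto simp: complex_eq_iff)

lemma in_lattice_iff:
  fixes s t :: real
  shows "of_real s + of_real t * \<tau> \<in> L \<longleftrightarrow> s \<in> \<int> \<and> t \<in> \<int>"
proof
  assume "of_real s + of_real t * \<tau> \<in> L"
  then obtain m n where "of_real s + of_real t * \<tau> = of_int m + of_int n * \<tau>"
    by (elim latticeE)
  then have "of_real s + of_real t * \<tau> = of_real (of_int m) + of_real (of_int n) * \<tau>" by simp
  then show "s \<in> \<int> \<and> t \<in> \<int>" unfolding coordinates_eq_iff by auto
next
  assume "s \<in> \<int> \<and> t \<in> \<int>"
  then obtain m n where "s = of_int m" "t = of_int n" by (metis Ints_cases)
  then show "of_real s + of_real t * \<tau> \<in> L" using lattice_intro[of m n] by simp
qed

definition fundamental_domain :: "complex set" where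
  "fundamental_domain = (\<lambda>(s, t). of_real s + of_real t * \<tau>) ` ({0..1} \<times> {0..1})"

lemma compact_fundamental_domain: "compact fundamental_domain"
  unfolding fundamental_domain_def case_prod_unfold
  by (intro compact_continuous_image compact_Times compact_Icc continuous_intros)

lemma fundamental_domain_cover:
  obtains w where "w \<in> L" "z + w \<in> fundamental_domain"
proof -
  obtain s t where z: "z = of_real s + of_real t * \<tau>" by (rule real_coordinates)
  define w where "w = of_int (- \<lfloor>s\<rfloor>) + of_int (- \<lfloor>t\<rfloor>) * \<tau>"
  have "z + w = of_real (frac s) + of_real (frac t) * \<tau>"
    by (simp add: z w_def frac_def algebra_simps)
  then have "z + w \<in> fundamental_domain"
    unfolding fundamental_domain_def
    by (auto intro!: image_eqI[of _ _ "(frac s, frac t)"] simp: frac_lt_1 less_imp_le)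
  then show ?thesis using that lattice_intro unfolding w_def by blast
qed

lemma coordinate_bound:
  obtains K where "K > 0" "\<And>m n. max \<bar>real_of_int m\<bar> \<bar>real_of_int n\<bar> \<le> K * norm (of_int m + of_int n * \<tau>)"
proof
  define K where "K = 1 + 1 / Im \<tau> + norm \<tau> / Im \<tau>"
  show "K > 0" unfolding K_def using Im_pos by (auto intro!: add_pos_nonneg)
  fix m n
  define w where "w = of_int m + of_int n * \<tau>"
  have "\<bar>real_of_int n\<bar> * Im \<tau> = \<bar>Im w\<bar>"
    using Im_pos by (simp add: w_def abs_mult)
  also have "\<dots> \<le> norm w" by (rule abs_Im_le_cmod)
  finally have n: "\<bar>real_of_int n\<bar> \<le> norm w / Im \<tau>"
    using Im_pos by (simp add: field_simps)
  have "\<bar>real_of_int m\<bar> = norm (w - of_int n * \<tau>)"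
    by (simp add: w_def)
  also have "\<dots> \<le> norm w + \<bar>real_of_int n\<bar> * norm \<tau>"
    by (metis norm_triangle_ineq4 norm_mult norm_of_int)
  also have "\<dots> \<le> norm w + norm w / Im \<tau> * norm \<tau>"
    using n by (intro add_left_mono mult_right_mono) auto
  finally have m: "\<bar>real_of_int m\<bar> \<le> norm w + norm w / Im \<tau> * norm \<tau>" .
  have "K * norm w = norm w + norm w / Im \<tau> + norm w / Im \<tau> * norm \<tau>"
    by (simp add: K_def algebra_simps)
  moreover have "norm w / Im \<tau> \<ge> 0" "norm w / Im \<tau> * norm \<tau> \<ge> 0"
    using Im_pos by simp_all
  ultimately show "max \<bar>real_of_int m\<bar> \<bar>real_of_int n\<bar> \<le> K * norm (of_int m + of_int n * \<tau>)"
    using n m norm_ge_zero[of w] unfolding w_def[symmetric] by (simp del: norm_ge_zero)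
qed

lemma lattice_min_norm:
  obtains d where "d > 0" "\<And>w. w \<in> L \<Longrightarrow> w \<noteq> 0 \<Longrightarrow> norm w \<ge> d"
proof -
  obtain K where K: "K > 0" "\<And>m n. max \<bar>real_of_int m\<bar> \<bar>real_of_int n\<bar> \<le> K * norm (of_int m + of_int n * \<tau>)"
    by (rule coordinate_bound) auto
  have "norm w \<ge> 1 / K" if "w \<in> L" "w \<noteq> 0" for w
  proof -
    from that(1) obtain m n where w: "w = of_int m + of_int n * \<tau>" by (rule latticeE)
    with that have "m \<noteq> 0 \<or> n \<noteq> 0" by auto
    then have "1 \<le> max \<bar>real_of_int m\<bar> \<bar>real_of_int n\<bar>" by linarith
    also have "\<dots> \<le> K * norm w" unfolding w by (rule K(2))
    finally show ?thesis using K(1) by (simp add: field_simps)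
  qed
  then show ?thesis using that[of "1 / K"] K(1) by auto
qed

text \<open>Both coordinates of \<open>w\<close> are at most \<open>K * norm w\<close>. Splitting
  the exponent 3 evenly between them bounds the term by \<open>K ^ 3\<close> times a product of two
  summable one-variable terms.\<close>

lemma summable_inverse_cube: "(\<lambda>w. 1 / norm w ^ 3) summable_on (L - {0})"
proof -
  obtain K where K: "K > 0" "\<And>m n. max \<bar>real_of_int m\<bar> \<bar>real_of_int n\<bar> \<le> K * norm (of_int m + of_int n * \<tau>)"
    by (rule coordinate_bound) auto
  let ?g = "\<lambda>m::int. real_of_int (max 1 \<bar>m\<bar>) powr (- (3/2))"
  have g: "(\<lambda>(m, n). ?g m * ?g n) summable_on UNIV \<times> UNIV"
    by (rule summable_on_SigmaI[where g = "\<lambda>m. ?g m * infsum ?g UNIV"])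
       (auto intro!: has_sum_cmult_right summable_on_cmult_left summable_on_int_power has_sum_infsum)
  have "(\<lambda>(m, n). K ^ 3 * (?g m * ?g n)) summable_on UNIV \<times> UNIV"
    using summable_on_cmult_right[OF g, of "K ^ 3"] by (simp add: case_prod_unfold)
  then have g': "(\<lambda>(m, n). K ^ 3 * (?g m * ?g n)) summable_on UNIV - {(0, 0)}"
    by (rule summable_on_subset_banach) auto
  have "(\<lambda>(m, n). 1 / norm (of_int m + of_int n * \<tau>) ^ 3) summable_on UNIV - {(0, 0)}"
  proof (rule summable_on_comparison_test[OF g'])
    fix p :: "int \<times> int" assume "p \<in> UNIV - {(0, 0)}"
    then obtain m n where p: "p = (m, n)" and mn: "(m, n) \<noteq> (0, 0)" by (cases p) auto
    define w where "w = of_int m + of_int n * \<tau>"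
    have "real_of_int (max 1 \<bar>m\<bar>) \<le> max \<bar>real_of_int m\<bar> \<bar>real_of_int n\<bar>"
      "real_of_int (max 1 \<bar>n\<bar>) \<le> max \<bar>real_of_int m\<bar> \<bar>real_of_int n\<bar>"
      using mn by auto
    then have le: "real_of_int (max 1 \<bar>m\<bar>) \<le> K * norm w" "real_of_int (max 1 \<bar>n\<bar>) \<le> K * norm w"
      using K(2)[of m n] unfolding w_def by linarith+
    have pos: "K * norm w > 0" using le(1) by linarith
    have *: "(K * norm w) powr (- (3/2)) \<le> ?g m" "(K * norm w) powr (- (3/2)) \<le> ?g n"
      using le pos by (auto intro!: powr_mono2')
    have "(K * norm w) powr (- (3/2)) * (K * norm w) powr (- (3/2)) \<le> ?g m * ?g n"
      using * by (intro mult_mono) auto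
    also have "(K * norm w) powr (- (3/2)) * (K * norm w) powr (- (3/2)) = 1 / (K * norm w) ^ 3"
    proof -
      have "(K * norm w) powr (- (3/2)) * (K * norm w) powr (- (3/2)) = (K * norm w) powr (- (real 3))"
        by (subst powr_add[symmetric]) simp
      also have "\<dots> = 1 / (K * norm w) ^ 3"
        using powr_realpow[OF pos, of 3] by (simp only: powr_minus divide_inverse mult_1)
      finally show ?thesis .
    qed
    finally have "K ^ 3 * (1 / (K * norm w) ^ 3) \<le> K ^ 3 * (?g m * ?g n)"
      using K(1) by (intro mult_left_mono) auto
    then show "(case p of (m, n) \<Rightarrow> 1 / norm (of_int m + of_int n * \<tau>) ^ 3) \<le> (case p of (m, n) \<Rightarrow> K ^ 3 * (?g m * ?g n))"
      using K(1) by (simp add: p w_def power_mult_distrib)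
  qed auto
  moreover have "bij_betw (\<lambda>(m, n). of_int m + of_int n * \<tau>) (UNIV - {(0, 0)}) (L - {0})"
  proof (rule bij_betw_imageI)
    have *: "of_int m + of_int n * \<tau> = of_int m' + of_int n' * \<tau> \<longleftrightarrow> m = m' \<and> n = n'" for m n m' n'
      using coordinates_eq_iff[of "of_int m" "of_int n" "of_int m'" "of_int n'"] by simp
    show "inj_on (\<lambda>(m, n). of_int m + of_int n * \<tau>) (UNIV - {(0, 0)})"
      by (auto simp: inj_on_def *)
    show "(\<lambda>(m, n). of_int m + of_int n * \<tau>) ` (UNIV - {(0, 0)}) = L - {0}"
    proof (intro equalityI subsetI)
      fix w assume w: "w \<in> L - {0}"
      then obtain m n where "w = of_int m + of_int n * \<tau>" using latticeE by blast
      with w show "w \<in> (\<lambda>(m, n). of_int m + of_int n * \<tau>) ` (UNIV - {(0, 0)})"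
        by (auto intro!: image_eqI[of _ _ "(m, n)"])
    qed (use *[of _ _ 0 0] lattice_intro in auto)
  qed
  note summable_on_reindex_bij_betw[OF this, of "\<lambda>w. 1 / norm w ^ 3"]
  ultimately show ?thesis by (simp add: case_prod_unfold)
qed

definition wp_term :: "complex \<Rightarrow> complex \<Rightarrow> complex" where
  "wp_term w z = 1 / (z - w)\<^sup>2 - 1 / w\<^sup>2"

text \<open>The part of \<open>wp\<close> left after removing the double pole at 0. Since it is
  holomorphic there, the behaviour of \<open>wp\<close> at the pole can be read off from
  limits.\<close>

definition wp_reg :: "complex \<Rightarrow> complex" where
  "wp_reg z = (\<Sum>\<^sub>\<infinity>w\<in>L - {0}. wp_term w z)"

lemma wp_eq: "wp z = 1 / z\<^sup>2 + wp_reg z"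
  by (simp add: weierstrass_p_def wp_reg_def wp_term_def)

text \<open>If \<open>norm w\<close> is at least \<open>2 * R\<close>, then
  \<open>norm (z - w)\<close> is at least half of \<open>norm w\<close>, which gives the constant
  \<open>10 * R\<close>. For smaller \<open>w\<close> the distance \<open>r\<close> gives the other
  summand; adding the two yields one constant for all \<open>w\<close>.\<close>

lemma wp_term_bound:
  assumes "w \<noteq> 0" "norm z \<le> R" "r > 0" "norm (z - w) \<ge> r" "R > 0"
  shows "norm (wp_term w z) \<le> (10 * R + 10 * R ^ 3 / r\<^sup>2) * (1 / norm w ^ 3)"
proof -
  have zw: "z \<noteq> w" using assms by auto
  have "wp_term w z = z * (2 * w - z) / ((z - w)\<^sup>2 * w\<^sup>2)"
    using zw assms(1) by (simp add: wp_term_def divide_simps) (simp add: power2_eq_square algebra_simps)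
  then have eq: "norm (wp_term w z) = norm z * norm (2 * w - z) / ((norm (z - w))\<^sup>2 * (norm w)\<^sup>2)"
    by (simp add: norm_divide norm_mult norm_power)
  have w0: "norm w > 0" using assms(1) by simp
  have nz: "norm (2 * w - z) \<le> 2 * norm w + norm z"
    using norm_triangle_ineq4[of "2 * w" z] by (simp add: norm_mult)
  show ?thesis
  proof (cases "norm w \<ge> 2 * R")
    case True
    have "norm (z - w) \<ge> norm w / 2"
      using norm_triangle_ineq3[of w z] True assms(2) by (simp add: norm_minus_commute)
    then have "(norm w / 2)\<^sup>2 \<le> (norm (z - w))\<^sup>2"
      using w0 by (intro power_mono) auto
    then have "norm (wp_term w z) \<le> R * (5 / 2 * norm w) / ((norm w / 2)\<^sup>2 * (norm w)\<^sup>2)"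
      unfolding eq using nz True assms w0 by (intro frac_le mult_mono) auto
    also have "\<dots> = 10 * R * (1 / norm w ^ 3)"
      using w0 by (simp add: field_simps power2_eq_square power3_eq_cube)
    also have "\<dots> \<le> (10 * R + 10 * R ^ 3 / r\<^sup>2) * (1 / norm w ^ 3)"
      using w0 assms by (intro mult_right_mono) auto
    finally show ?thesis .
  next
    case False
    have "r\<^sup>2 \<le> (norm (z - w))\<^sup>2" using assms by (intro power_mono) auto
    then have "norm (wp_term w z) \<le> R * (5 * R) / (r\<^sup>2 * (norm w)\<^sup>2)"
      unfolding eq using nz False assms w0 by (intro frac_le mult_mono) (auto simp: less_imp_le[OF assms(5)])
    also have "\<dots> = 5 * R\<^sup>2 * norm w / r\<^sup>2 * (1 / norm w ^ 3)"
      using w0 by (simp add: field_simps power2_eq_square power3_eq_cube)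
    also have "\<dots> \<le> 5 * R\<^sup>2 * (2 * R) / r\<^sup>2 * (1 / norm w ^ 3)"
      using w0 assms False by (intro mult_right_mono divide_right_mono mult_left_mono) auto
    also have "\<dots> = 10 * R ^ 3 / r\<^sup>2 * (1 / norm w ^ 3)"
      by (simp add: power2_eq_square power3_eq_cube)
    also have "\<dots> \<le> (10 * R + 10 * R ^ 3 / r\<^sup>2) * (1 / norm w ^ 3)"
      using w0 assms by (intro mult_right_mono) auto
    finally show ?thesis .
  qed
qed

lemma lattice_dist:
  obtains d where "d > 0" "\<And>v w. v \<in> L \<Longrightarrow> w \<in> L \<Longrightarrow> v \<noteq> w \<Longrightarrow> dist v w \<ge> d"
proof -
  obtain d where d: "d > 0" "\<And>w. w \<in> L \<Longrightarrow> w \<noteq> 0 \<Longrightarrow> norm w \<ge> d"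
    by (rule lattice_min_norm) auto
  show ?thesis
    by (rule that[OF d(1)]) (auto simp: dist_norm intro!: d(2) diff_in_lattice)
qed

lemma closed_lattice_subset: "S \<subseteq> L \<Longrightarrow> closed S"
proof -
  assume S: "S \<subseteq> L"
  obtain d where d: "d > 0" "\<And>v w. v \<in> L \<Longrightarrow> w \<in> L \<Longrightarrow> v \<noteq> w \<Longrightarrow> dist v w \<ge> d"
    by (rule lattice_dist) auto
  show "closed S"
    by (rule discrete_imp_closed[OF d(1)]) (use d(2) S in \<open>force simp: dist_commute\<close>)
qed

lemma countable_lattice: "countable L"
proof -
  have "L = range (\<lambda>(m::int, n::int). of_int m + of_int n * \<tau>)"
    unfolding lattice_of_def by auto
  then show ?thesis by simp
qed

lemma wp_reg_holomorphic: "wp_reg holomorphic_on - (L - {0})"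
  and wp_term_summable: "z \<notin> L - {0} \<Longrightarrow> (\<lambda>w. wp_term w z) summable_on (L - {0})"
proof -
  have local: "\<exists>r>0. wp_reg holomorphic_on ball z r \<and> (\<lambda>w. wp_term w z) summable_on (L - {0})"
    if z: "z \<notin> L - {0}" for z
  proof -
    have "open (- (L - {0}))" by (intro open_Compl closed_lattice_subset) auto
    then obtain r' where r': "r' > 0" "ball z r' \<subseteq> - (L - {0})"
      using z open_contains_ball by (metis ComplI)
    \<comment> \<open>Halving the radius keeps every point of the closed ball at distance at least
      \<open>r\<close> from the nonzero lattice points.\<close>
    define r where "r = r' / 2"
    have r: "r > 0" using r' by (simp add: r_def)
    define R where "R = norm z + r"
    have R: "R > 0" using r by (simp add: R_def add_nonneg_pos)
    have bound: "norm (wp_term w y) \<le> (10 * R + 10 * R ^ 3 / r\<^sup>2) * (1 / norm w ^ 3)"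
      if "w \<in> L - {0}" "y \<in> cball z r" for w y
    proof (rule wp_term_bound)
      show "norm y \<le> R"
        using that(2) norm_triangle_ineq2[of y z] by (simp add: R_def dist_norm norm_minus_commute)
      have "w \<notin> ball z r'" using r' that by auto
      then have "r' \<le> dist z w" by simp
      also have "\<dots> \<le> dist z y + dist y w" by (rule dist_triangle)
      finally show "r \<le> norm (y - w)" using that(2) by (simp add: r_def dist_norm)
    qed (use that r R in auto)
    have summ: "(\<lambda>w. (10 * R + 10 * R ^ 3 / r\<^sup>2) * (1 / norm w ^ 3)) summable_on (L - {0})"
      by (intro summable_on_cmult_right summable_inverse_cube)
    have lim: "uniform_limit (cball z r) (\<lambda>A y. \<Sum>w\<in>A. wp_term w y) wp_reg (finite_subsets_at_top (L - {0}))"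
      unfolding wp_reg_def using bound summ by (rule Weierstrass_m_test_general)
    have hol: "(\<lambda>y. \<Sum>w\<in>A. wp_term w y) holomorphic_on cball z r" if "A \<subseteq> L - {0}" for A
    proof -
      have "y \<noteq> w" if "w \<in> A" "y \<in> cball z r" for w y
        using r' that \<open>A \<subseteq> L - {0}\<close> r unfolding r_def by force
      then show ?thesis
        unfolding wp_term_def by (intro holomorphic_intros) (auto simp: power2_eq_square)
    qed
    have "\<forall>\<^sub>F A in finite_subsets_at_top (L - {0}).
        continuous_on (cball z r) (\<lambda>y. \<Sum>w\<in>A. wp_term w y) \<and> (\<lambda>y. \<Sum>w\<in>A. wp_term w y) holomorphic_on ball z r"
    proof (rule eventually_finite_subsets_at_top_weakI)
      fix A assume "A \<subseteq> L - {0}"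
      then show "continuous_on (cball z r) (\<lambda>y. \<Sum>w\<in>A. wp_term w y) \<and> (\<lambda>y. \<Sum>w\<in>A. wp_term w y) holomorphic_on ball z r"
        using hol[of A] holomorphic_on_imp_continuous_on holomorphic_on_subset ball_subset_cball by blast
    qed
    then have "wp_reg holomorphic_on ball z r"
      by (rule holomorphic_uniform_limit[OF _ lim]) auto
    moreover have "(\<lambda>w. norm (wp_term w z)) summable_on (L - {0})"
      by (rule Infinite_Sum.abs_summable_on_comparison_test'[OF summ bound]) (use r in auto)
    then have "(\<lambda>w. wp_term w z) summable_on (L - {0})"
      by (rule abs_summable_summable)
    ultimately show ?thesis using r by blast
  qed
  then show "z \<notin> L - {0} \<Longrightarrow> (\<lambda>w. wp_term w z) summable_on (L - {0})" by blast
  have "wp_reg analytic_on - (L - {0})"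
    unfolding analytic_on_def using local by auto
  then show "wp_reg holomorphic_on - (L - {0})" by (rule analytic_imp_holomorphic)
qed

end

text \<open>An even function has derivative 0 at 0, so a zero there has order at least two. The
  lemma is used to lower pole orders by two at a time.\<close>

lemma even_quotient_limit:
  fixes k :: "complex \<Rightarrow> complex"
  assumes "k holomorphic_on S" "open S" "0 \<in> S" "\<And>z. k (- z) = k z" "k 0 = 0"
  shows "\<exists>c. ((\<lambda>z. k z / z\<^sup>2) \<longlongrightarrow> c) (at 0)"
proof -
  have D: "(k has_field_derivative deriv k 0) (at 0)"
    using holomorphic_derivI[OF assms(1-3)] .
  then have "(k has_field_derivative deriv k 0) (at (- 0))" by simp
  from DERIV_chain2[OF this DERIV_minus[OF DERIV_ident]]
  have "((\<lambda>z. k (- z)) has_field_derivative - deriv k 0) (at 0)" by simp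
  then have "deriv k 0 = - deriv k 0"
    using D DERIV_unique by (fastforce simp: assms(4))
  then have "deriv k 0 = 0" by simp
  with D have "(\<lambda>z. k z / z) \<midarrow>0\<rightarrow> 0"
    by (simp add: has_field_derivative_iff assms(5))
  then have "(\<lambda>z. if z = 0 then 0 else k z / z) holomorphic_on S"
    by (intro removable_singularity holomorphic_intros assms(2) holomorphic_on_subset[OF assms(1)]) auto
  then obtain c where "((\<lambda>z. if z = 0 then 0 else k z / z) has_field_derivative c) (at 0)"
    using holomorphic_derivI[OF _ assms(2,3)] by blast
  then have "(\<lambda>z. (if z = 0 then 0 else k z / z) / z) \<midarrow>0\<rightarrow> c"
    by (simp add: has_field_derivative_iff)
  then have "(\<lambda>z. k z / z\<^sup>2) \<midarrow>0\<rightarrow> c"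
    by (rule Lim_transform_eventually)
       (auto simp: eventually_at_filter power2_eq_square)
  then show ?thesis by blast
qed

section \<open>Parity, periodicity and the second-order differential equation\<close>

context period_ratio
begin

lemma bij_betw_uminus_lattice: "bij_betw uminus (L - {0}) (L - {0})"
  by (rule bij_betwI[where g = uminus]) (auto simp: uminus_in_lattice_iff)

lemma wp_reg_even: "wp_reg (- z) = wp_reg z"
proof -
  have "wp_reg (- z) = (\<Sum>\<^sub>\<infinity>w\<in>L - {0}. wp_term (- w) (- z))"
    unfolding wp_reg_def by (rule infsum_reindex_bij_betw[OF bij_betw_uminus_lattice, symmetric])
  also have "\<dots> = wp_reg z"
    unfolding wp_reg_def wp_term_def by (simp add: power2_eq_square algebra_simps)
  finally show ?thesis .
qed

lemma wp_even: "wp (- z) = wp z"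
  by (simp add: wp_eq wp_reg_even)

lemma wp_reg_zero: "wp_reg 0 = 0"
  by (simp add: wp_reg_def wp_term_def)

text \<open>Because \<open>1 / 0 = 0\<close>, the term at \<open>w = 0\<close> is the principal part
  \<open>1 / z\<^sup>2\<close>. A single sum over the whole lattice can be reindexed by
  translations.\<close>

lemma wp_as_lattice_sum:
  assumes "z \<notin> L"
  shows "((\<lambda>w. 1 / (z - w)\<^sup>2 - 1 / w\<^sup>2) has_sum wp z) L"
proof -
  have "((\<lambda>w. wp_term w z) has_sum wp_reg z) (L - {0})"
    unfolding wp_reg_def using assms by (intro has_sum_infsum wp_term_summable) auto
  then have "((\<lambda>w. wp_term w z) has_sum (wp_term 0 z + wp_reg z)) (insert 0 (L - {0}))"
    by (intro has_sum_insert) auto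
  moreover have "wp_term 0 z + wp_reg z = wp z" by (simp add: wp_eq wp_term_def)
  ultimately show ?thesis using zero_in_lattice by (simp add: wp_term_def insert_absorb)
qed

text \<open>Shifting the summation index shows that \<open>wp (z + l) - wp z\<close> does not depend on \<open>z\<close>;
  at \<open>z = - l / 2\<close> it vanishes because \<open>wp\<close> is even.\<close>

lemma wp_add_half_period:
  assumes l: "l \<in> L" and half: "l / 2 \<notin> L" and z: "z \<notin> L"
  shows "wp (z + l) = wp z"
proof -
  have shift: "wp (z + l) - wp z = (\<Sum>\<^sub>\<infinity>w\<in>L. 1 / w\<^sup>2 - 1 / (w + l)\<^sup>2)" if z: "z \<notin> L" for z
  proof -
    have bij: "bij_betw (\<lambda>w. w + l) L L"
      by (rule bij_betwI[where g = "\<lambda>w. w - l"]) (auto intro: add_in_lattice diff_in_lattice l)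
    have "z + l \<notin> L" using z l add_in_lattice_iff by blast
    from wp_as_lattice_sum[OF this]
    have "((\<lambda>w. 1 / (z + l - (w + l))\<^sup>2 - 1 / (w + l)\<^sup>2) has_sum wp (z + l)) L"
      by (subst has_sum_reindex_bij_betw[OF bij, where f = "\<lambda>w. 1 / (z + l - w)\<^sup>2 - 1 / w\<^sup>2"])
    then have "((\<lambda>w. 1 / (z - w)\<^sup>2 - 1 / (w + l)\<^sup>2) has_sum wp (z + l)) L"
      by simp
    from has_sum_add[OF this has_sum_uminusI[OF wp_as_lattice_sum[OF z]]]
    show ?thesis by (simp add: infsumI)
  qed
  have "- (l / 2) \<notin> L" using half uminus_in_lattice_iff by blast
  from shift[OF this] have "(\<Sum>\<^sub>\<infinity>w\<in>L. 1 / w\<^sup>2 - 1 / (w + l)\<^sup>2) = 0"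
    by (simp add: wp_even)
  with shift[OF z] show ?thesis by simp
qed

text \<open>The half-period argument needs \<open>l / 2\<close> outside the lattice. This holds for
  the basis periods 1 and \<open>\<tau>\<close>, whose multiples give all periods.\<close>

lemma wp_periodic:
  assumes "z \<notin> L" "l \<in> L"
  shows "wp (z + l) = wp z"
proof -
  have "(1 / 2 :: real) \<notin> \<int>"
  proof
    assume "(1 / 2 :: real) \<in> \<int>"
    then obtain n where "1 / 2 = real_of_int n" by (elim Ints_cases)
    then have "2 * n = 1" by linarith
    then show False by presburger
  qed
  then have half: "1 / 2 \<notin> L" "\<tau> / 2 \<notin> L"
    using in_lattice_iff[of "1/2" 0] in_lattice_iff[of 0 "1/2"] by simp_all
  have step: "wp (z + of_nat n * l) = wp z"
    if "l \<in> L" "l / 2 \<notin> L" "z \<notin> L" for z l n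
  proof (induction n)
    case (Suc n)
    have "z + of_nat n * l \<notin> L"
      using that of_int_mult_in_lattice[of l "int n"] add_in_lattice_iff by auto
    from wp_add_half_period[OF that(1,2) this] Suc show ?case by (simp add: algebra_simps)
  qed simp
  have int_step: "wp (z + of_int n * l) = wp z"
    if "l \<in> L" "l / 2 \<notin> L" "z \<notin> L" for z l n
  proof (cases "n \<ge> 0")
    case True
    then show ?thesis using step[OF that, of "nat n"] by simp
  next
    case False
    have "z + of_int n * l \<notin> L"
      using that of_int_mult_in_lattice[of l n] add_in_lattice_iff by auto
    from step[OF that(1,2) this, of "nat (- n)"] False show ?thesis by simp
  qed
  obtain m n where l: "l = of_int m + of_int n * \<tau>" using latticeE assms(2) by blast
  have "z + of_int m \<notin> L" using assms(1) lattice_intro[of m 0] add_in_lattice_iff by simp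
  then have "wp (z + of_int m + of_int n * \<tau>) = wp (z + of_int m)"
    using int_step tau_in_lattice half by blast
  also have "\<dots> = wp z" using int_step[OF one_in_lattice half(1) assms(1), of m] by simp
  finally show ?thesis by (simp add: l add.assoc)
qed

lemma open_Compl_lattice: "open (- L)"
  by (intro open_Compl closed_lattice_subset) auto

lemma open_Compl_punctured: "open (- (L - {0}))"
  by (rule open_Compl, rule closed_lattice_subset) blast

lemma connected_Compl_lattice: "connected (- L)"
  using connected_open_diff_countable[of UNIV L] countable_lattice connected_UNIV by (simp add: Compl_eq_Diff_UNIV)

lemma wp_holomorphic: "wp holomorphic_on - L"
proof -
  have "(\<lambda>z. 1 / z\<^sup>2 + wp_reg z) holomorphic_on - L"
    using zero_in_lattice
    by (intro holomorphic_intros holomorphic_on_subset[OF wp_reg_holomorphic]) auto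
  then show ?thesis by (simp add: wp_eq[abs_def])
qed

text \<open>Liouville's theorem for elliptic functions, where local boundedness takes the place of the
  absence of poles.\<close>

lemma elliptic_bounded_constant:
  assumes "open (- D)" "f holomorphic_on - D"
    and "\<And>p. p \<in> D \<Longrightarrow> \<exists>B. \<forall>\<^sub>F z in at p. z \<notin> D \<and> norm (f z) \<le> B"
    and "\<And>z l. z \<notin> D \<Longrightarrow> l \<in> L \<Longrightarrow> z + l \<notin> D \<and> f (z + l) = f z"
  obtains c where "\<And>z. z \<notin> D \<Longrightarrow> f z = c"
proof -
  \<comment> \<open>Local boundedness makes the singularities in \<open>D\<close> removable; with
    the limits as values there, \<open>F\<close> is entire.\<close>
  define F where "F = (\<lambda>z. if z \<in> D then Lim (at z) f else f z)"
  have local: "\<exists>r>0. F holomorphic_on ball p r" for p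
  proof (cases "p \<in> D")
    case False
    then obtain r where r: "r > 0" "ball p r \<subseteq> - D" using assms(1) open_contains_ball by (metis ComplI)
    have "F holomorphic_on ball p r"
      by (rule holomorphic_transform[OF holomorphic_on_subset[OF assms(2) r(2)]])
         (use r(2) in \<open>auto simp: F_def\<close>)
    with r(1) show ?thesis by blast
  next
    case True
    then obtain B where "\<forall>\<^sub>F z in at p. z \<notin> D \<and> norm (f z) \<le> B" using assms(3) by blast
    then obtain r where r: "r > 0" "\<And>z. z \<in> ball p r - {p} \<Longrightarrow> z \<notin> D \<and> norm (f z) \<le> B"
      unfolding eventually_at by (auto simp: dist_commute)
    have ev: "\<forall>\<^sub>F z in at p. z \<in> ball p r - {p}"
      using r(1) by (intro eventually_at_in_open) auto
    have sub: "ball p r - {p} \<subseteq> - D" using r(2) by auto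
    have bd: "\<exists>B. \<forall>\<^sub>F z in at p. norm (f z) \<le> B"
      by (rule exI[of _ B], rule eventually_mono[OF ev]) (use r(2) in auto)
    have int: "p \<in> interior (ball p r)" using r(1) by simp
    obtain g where g: "g holomorphic_on ball p r" "\<And>z. z \<in> ball p r - {p} \<Longrightarrow> g z = f z"
      using holomorphic_on_extend_bounded[OF holomorphic_on_subset[OF assms(2) sub] int, THEN iffD2, OF bd]
      by auto
    have "isCont g p"
      using continuous_on_interior[OF holomorphic_on_imp_continuous_on[OF g(1)] int] .
    then have "g \<midarrow>p\<rightarrow> g p" by (simp add: isCont_def)
    then have "f \<midarrow>p\<rightarrow> g p"
      by (rule Lim_transform_eventually) (use eventually_mono[OF ev] g(2) in auto)
    then have "Lim (at p) f = g p" by (simp add: tendsto_Lim)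
    have "F holomorphic_on ball p r"
    proof (rule holomorphic_transform[OF g(1)])
      fix z assume "z \<in> ball p r"
      then show "g z = F z"
        using True \<open>Lim (at p) f = g p\<close> g(2)[of z] r(2)[of z] by (cases "z = p") (auto simp: F_def)
    qed
    then show ?thesis using r(1) by blast
  qed
  then have "F analytic_on UNIV" unfolding analytic_on_def by simp
  then have holo: "F holomorphic_on UNIV" by (rule analytic_imp_holomorphic)
  have cont: "isCont F z" for z
    using holomorphic_on_imp_continuous_on[OF holo] by (simp add: continuous_on_eq_continuous_at)
  have "bounded (F ` fundamental_domain)"
    using holo compact_fundamental_domain
    by (intro compact_imp_bounded compact_continuous_image)
       (auto intro: holomorphic_on_imp_continuous_on holomorphic_on_subset)
  then obtain B where B: "\<And>z. z \<in> fundamental_domain \<Longrightarrow> norm (F z) \<le> B"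
    unfolding bounded_iff by auto
  have B': "norm (F z) \<le> B" if "z \<notin> D" for z
  proof -
    obtain w where w: "w \<in> L" "z + w \<in> fundamental_domain" by (rule fundamental_domain_cover)
    have "F (z + w) = F z" using assms(4)[OF that w(1)] that by (simp add: F_def)
    then show ?thesis using B[OF w(2)] by simp
  qed
  have "norm (F z) \<le> B" for z
  proof (cases "z \<in> D")
    case True
    then obtain C where "\<forall>\<^sub>F y in at z. y \<notin> D \<and> norm (f y) \<le> C" using assms(3) by blast
    then have "\<forall>\<^sub>F y in at z. norm (F y) \<le> B" by (rule eventually_mono) (use B' in auto)
    moreover have "F \<midarrow>z\<rightarrow> F z" using cont by (simp add: isCont_def)
    ultimately show ?thesis by (intro Lim_norm_ubound[of "at z"]) auto
  qed (rule B')
  then have "bounded (range F)" unfolding bounded_iff by auto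
  then have "F constant_on UNIV" by (rule Liouville_theorem[OF holo])
  then obtain c where "\<And>z. F z = c" unfolding constant_on_def by auto
  then show ?thesis using that[of c] unfolding F_def by metis
qed

definition wp' :: "complex \<Rightarrow> complex" where "wp' = deriv wp"

lemma wp'_holomorphic: "wp' holomorphic_on - L"
  unfolding wp'_def using wp_holomorphic open_Compl_lattice by (rule holomorphic_deriv)

lemma wp_has_derivative: "z \<notin> L \<Longrightarrow> (wp has_field_derivative wp' z) (at z)"
  unfolding wp'_def using wp_holomorphic open_Compl_lattice
  by (auto intro: holomorphic_derivI)

lemma wp'_has_derivative: "z \<notin> L \<Longrightarrow> (wp' has_field_derivative deriv wp' z) (at z)"
  using wp'_holomorphic open_Compl_lattice by (auto intro: holomorphic_derivI)

lemma deriv_periodic: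
  assumes "f holomorphic_on - L" "\<And>z. z \<notin> L \<Longrightarrow> f (z + l) = f z" "l \<in> L" "z \<notin> L"
  shows "deriv f (z + l) = deriv f z"
proof -
  have zl: "z + l \<notin> L" using assms add_in_lattice_iff by blast
  have "(f has_field_derivative deriv f (z + l)) (at (z + l))"
    using assms(1) open_Compl_lattice zl by (auto intro: holomorphic_derivI)
  then have "((\<lambda>z. f (z + l)) has_field_derivative deriv f (z + l)) (at z)"
    by (simp add: DERIV_shift)
  then have "(f has_field_derivative deriv f (z + l)) (at z)"
    by (rule has_field_derivative_transform_within_open[OF _ open_Compl_lattice]) (use assms in auto)
  then show ?thesis by (metis DERIV_imp_deriv)
qed

lemma wp'_periodic: "z \<notin> L \<Longrightarrow> l \<in> L \<Longrightarrow> wp' (z + l) = wp' z"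
  unfolding wp'_def by (rule deriv_periodic[OF wp_holomorphic wp_periodic])

lemma wp'_odd:
  assumes "z \<notin> L"
  shows "wp' (- z) = - wp' z"
proof -
  have "- z \<notin> L" using assms uminus_in_lattice_iff by blast
  from DERIV_chain2[OF wp_has_derivative[OF this] DERIV_minus[OF DERIV_ident]]
  have "((\<lambda>z. wp (- z)) has_field_derivative - wp' (- z)) (at z)" by simp
  then have "(wp has_field_derivative - wp' (- z)) (at z)" by (simp add: wp_even)
  then show ?thesis using wp_has_derivative[OF assms] DERIV_unique by fastforce
qed

lemma eventually_at_0_notin_lattice: "\<forall>\<^sub>F z in at 0. z \<notin> L"
proof -
  have "\<forall>\<^sub>F z in at 0. z \<in> - (L - {0}) - {0}"
    using open_Compl_punctured by (intro eventually_at_in_open) auto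
  then show ?thesis by (rule eventually_mono) auto
qed

lemma wp_reg_quadratic_limit: "\<exists>c. ((\<lambda>z. wp_reg z / z\<^sup>2) \<longlongrightarrow> c) (at 0)"
  using wp_reg_holomorphic open_Compl_punctured
  by (rule even_quotient_limit) (auto simp: wp_reg_even wp_reg_zero)

lemma wp_derivs_near_0:
  assumes "z \<noteq> 0" "z \<notin> L - {0}"
  shows "wp' z = - 2 / z ^ 3 + deriv wp_reg z" "deriv wp' z = 6 / z ^ 4 + deriv (deriv wp_reg) z"
proof -
  let ?S = "- (L - {0})"
  have S: "open ?S" using open_Compl_punctured by auto
  have h': "deriv wp_reg holomorphic_on ?S" using wp_reg_holomorphic S by (rule holomorphic_deriv)
  have 1: "wp' z = - 2 / z ^ 3 + deriv wp_reg z" if "z \<noteq> 0" "z \<in> ?S" for z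
  proof -
    have "((\<lambda>z. 1 / z\<^sup>2) has_field_derivative - 2 / z ^ 3) (at z)"
      using that(1) by (auto intro!: derivative_eq_intros simp: divide_simps power2_eq_square power3_eq_cube)
    from DERIV_add[OF this holomorphic_derivI[OF wp_reg_holomorphic S that(2)]]
    have "((\<lambda>z. 1 / z\<^sup>2 + wp_reg z) has_field_derivative - 2 / z ^ 3 + deriv wp_reg z) (at z)" .
    then have "(wp has_field_derivative - 2 / z ^ 3 + deriv wp_reg z) (at z)"
      by (simp add: wp_eq[abs_def])
    then show ?thesis unfolding wp'_def by (rule DERIV_imp_deriv)
  qed
  then show "wp' z = - 2 / z ^ 3 + deriv wp_reg z" using assms by simp
  have ne: "x \<noteq> 0" if "x \<notin> L" for x using that zero_in_lattice by auto
  have "((\<lambda>z. - 2 / z ^ 3) has_field_derivative 6 / z ^ 4) (at z)"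
    using assms(1) by (auto intro!: derivative_eq_intros simp: divide_simps power2_eq_square power3_eq_cube power4_eq_xxxx)
  moreover have "z \<in> ?S" using assms(2) by auto
  ultimately have "((\<lambda>z. - 2 / z ^ 3 + deriv wp_reg z) has_field_derivative 6 / z ^ 4 + deriv (deriv wp_reg) z) (at z)"
    by (intro DERIV_add holomorphic_derivI[OF h' S])
  then have "(wp' has_field_derivative 6 / z ^ 4 + deriv (deriv wp_reg) z) (at z)"
    by (rule has_field_derivative_transform_within_open[OF _ open_Compl_lattice]) (use 1 assms in \<open>auto simp: ne\<close>)
  then show "deriv wp' z = 6 / z ^ 4 + deriv (deriv wp_reg) z" by (rule DERIV_imp_deriv)
qed

text \<open>In \<open>deriv wp' z - 6 * (wp z)\<^sup>2\<close> the poles of order four cancel. The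
  cross term \<open>12 * wp_reg z / z\<^sup>2\<close> stays bounded since \<open>wp_reg\<close> is
  even and vanishes at 0, so the difference is a bounded elliptic function.\<close>

lemma wp''_eq: "\<exists>g2. \<forall>z. z \<notin> L \<longrightarrow> deriv wp' z = 6 * (wp z)\<^sup>2 - g2 / 2"
proof -
  let ?S = "- (L - {0})"
  define f where "f = (\<lambda>z. deriv wp' z - 6 * (wp z)\<^sup>2)"
  have S: "open ?S" "0 \<in> ?S" using open_Compl_punctured by auto
  have h2: "deriv (deriv wp_reg) holomorphic_on ?S"
    using wp_reg_holomorphic S(1) by (intro holomorphic_deriv)
  have contAt: "isCont (deriv (deriv wp_reg)) 0" "isCont wp_reg 0"
    using h2 wp_reg_holomorphic S
    by (metis continuous_on_interior holomorphic_on_imp_continuous_on interior_open)+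
  obtain c where c: "((\<lambda>z. wp_reg z / z\<^sup>2) \<longlongrightarrow> c) (at 0)" using wp_reg_quadratic_limit by blast
  have "((\<lambda>z. deriv (deriv wp_reg) z - 12 * (wp_reg z / z\<^sup>2) - 6 * (wp_reg z)\<^sup>2) \<longlongrightarrow>
      deriv (deriv wp_reg) 0 - 12 * c - 6 * (wp_reg 0)\<^sup>2) (at 0)"
    using contAt c by (intro tendsto_intros) (auto simp: isCont_def)
  then have lim0: "(f \<longlongrightarrow> deriv (deriv wp_reg) 0 - 12 * c - 6 * (wp_reg 0)\<^sup>2) (at 0)"
  proof (rule Lim_transform_eventually)
    have "\<forall>\<^sub>F z in at 0. z \<in> ?S - {0}" by (rule eventually_at_in_open[OF S])
    then show "\<forall>\<^sub>F z in at 0. deriv (deriv wp_reg) z - 12 * (wp_reg z / z\<^sup>2) - 6 * (wp_reg z)\<^sup>2 = f z"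
    proof (rule eventually_mono)
      fix z assume z: "z \<in> ?S - {0}"
      then have "z \<noteq> 0" by auto
      then show "deriv (deriv wp_reg) z - 12 * (wp_reg z / z\<^sup>2) - 6 * (wp_reg z)\<^sup>2 = f z"
      proof -
        have "(1 / z\<^sup>2 + wp_reg z)\<^sup>2 = 1 / z ^ 4 + 2 * (wp_reg z / z\<^sup>2) + (wp_reg z)\<^sup>2"
          by (simp add: power2_sum power_divide flip: power_mult)
        then show ?thesis
          unfolding f_def using z wp_derivs_near_0(2)[of z] \<open>z \<noteq> 0\<close> by (simp add: wp_eq algebra_simps)
      qed
    qed
  qed
  have per: "f (z + l) = f z" if "z \<notin> L" "l \<in> L" for z l
    unfolding f_def using deriv_periodic[OF wp'_holomorphic wp'_periodic] wp_periodic that by simp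
  have "\<forall>\<^sub>F z in at 0. norm (f z) < norm (deriv (deriv wp_reg) 0 - 12 * c - 6 * (wp_reg 0)\<^sup>2) + 1"
    by (rule order_tendstoD[OF tendsto_norm[OF lim0]]) auto
  with eventually_at_0_notin_lattice
  have ev0: "\<forall>\<^sub>F z in at 0. z \<notin> L \<and> norm (f z) \<le> norm (deriv (deriv wp_reg) 0 - 12 * c - 6 * (wp_reg 0)\<^sup>2) + 1"
    by eventually_elim auto
  have bd: "\<exists>B. \<forall>\<^sub>F z in at p. z \<notin> L \<and> norm (f z) \<le> B" if p: "p \<in> L" for p
  proof -
    from ev0 have "\<forall>\<^sub>F z in at p. z - p \<notin> L \<and> norm (f (z - p)) \<le> norm (deriv (deriv wp_reg) 0 - 12 * c - 6 * (wp_reg 0)\<^sup>2) + 1"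
      by (subst at_to_0) (simp add: eventually_filtermap)
    then have "\<forall>\<^sub>F z in at p. z \<notin> L \<and> norm (f z) \<le> norm (deriv (deriv wp_reg) 0 - 12 * c - 6 * (wp_reg 0)\<^sup>2) + 1"
    proof (rule eventually_mono)
      fix z assume *: "z - p \<notin> L \<and> norm (f (z - p)) \<le> norm (deriv (deriv wp_reg) 0 - 12 * c - 6 * (wp_reg 0)\<^sup>2) + 1"
      have "f z = f (z - p)" using per[of "z - p" p] * p by simp
      moreover have "z \<notin> L" using * p diff_in_lattice by blast
      ultimately show "z \<notin> L \<and> norm (f z) \<le> norm (deriv (deriv wp_reg) 0 - 12 * c - 6 * (wp_reg 0)\<^sup>2) + 1"
        using * by simp
    qed
    then show ?thesis by blast
  qed
  have hol: "f holomorphic_on - L"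
    unfolding f_def using wp_holomorphic wp'_holomorphic open_Compl_lattice
    by (intro holomorphic_intros holomorphic_deriv)
  have shift: "z + l \<notin> L \<and> f (z + l) = f z" if "z \<notin> L" "l \<in> L" for z l
    using per[OF that] add_in_lattice_iff that by simp
  obtain k where k: "\<And>z. z \<notin> L \<Longrightarrow> f z = k"
    using elliptic_bounded_constant[OF open_Compl_lattice hol bd shift] by blast
  have "deriv wp' z = 6 * (wp z)\<^sup>2 - (- 2 * k) / 2" if "z \<notin> L" for z
    using k[OF that] by (simp add: f_def algebra_simps)
  then show ?thesis by blast
qed

end

lemma holomorphic_on_imp_isCont:
  assumes "f holomorphic_on S" "open S" "x \<in> S"
  shows "isCont f x"
  using holomorphic_on_imp_continuous_on[OF assms(1)] assms(2,3)
  by (simp add: continuous_on_eq_continuous_at)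

section \<open>The Weierstrass cubic, addition and duplication, and multiplication maps\<close>

context period_ratio
begin

text \<open>The usual invariant, introduced through the differential equation instead of as an
  Eisenstein series: only the algebraic relations are used later.\<close>

definition g2 :: complex where
  "g2 = (SOME g. \<forall>z. z \<notin> L \<longrightarrow> deriv wp' z = 6 * (wp z)\<^sup>2 - g / 2)"

lemma deriv_wp': "z \<notin> L \<Longrightarrow> deriv wp' z = 6 * (wp z)\<^sup>2 - g2 / 2"
  using someI_ex[OF wp''_eq] unfolding g2_def by blast

text \<open>By the second-order equation the difference of the two sides has derivative 0, and the
  complement of the lattice is connected.\<close>

lemma wp'_square_ex: "\<exists>g3. \<forall>z. z \<notin> L \<longrightarrow> (wp' z)\<^sup>2 = 4 * wp z ^ 3 - g2 * wp z - g3"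
proof -
  let ?f = "\<lambda>z. (wp' z)\<^sup>2 - 4 * wp z ^ 3 + g2 * wp z"
  have "?f constant_on - L"
  proof (rule has_field_derivative_0_imp_constant_on[OF _ connected_Compl_lattice open_Compl_lattice])
    fix z assume "z \<in> - L"
    then have z: "z \<notin> L" by simp
    have d: "(wp' has_field_derivative 6 * (wp z)\<^sup>2 - g2 / 2) (at z)"
      using wp'_has_derivative[OF z] deriv_wp'[OF z] by simp
    show "(?f has_field_derivative 0) (at z)"
      by (rule derivative_eq_intros d wp_has_derivative[OF z] refl)+
         (simp add: power2_eq_square algebra_simps)
  qed
  then obtain k where k: "\<And>z. z \<notin> L \<Longrightarrow> ?f z = k" unfolding constant_on_def by auto
  have "(wp' z)\<^sup>2 = 4 * wp z ^ 3 - g2 * wp z - (- k)" if "z \<notin> L" for z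
    using k[OF that] by (simp add: algebra_simps)
  then show ?thesis by blast
qed

definition g3 :: complex where
  "g3 = (SOME g. \<forall>z. z \<notin> L \<longrightarrow> (wp' z)\<^sup>2 = 4 * wp z ^ 3 - g2 * wp z - g)"

lemma wp'_square: "z \<notin> L \<Longrightarrow> (wp' z)\<^sup>2 = 4 * wp z ^ 3 - g2 * wp z - g3"
  using someI_ex[OF wp'_square_ex] unfolding g3_def by blast

lemma eventually_at_lattice_point:
  fixes p :: complex
  assumes "\<forall>\<^sub>F z in at 0. Q z" "\<And>z. Q z \<Longrightarrow> Q (z + p)"
  shows "\<forall>\<^sub>F z in at p. Q z"
proof -
  from assms(1) have "\<forall>\<^sub>F z in at p. Q (z - p)"
    by (subst at_to_0) (simp add: eventually_filtermap)
  then show ?thesis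
    by (rule eventually_mono) (use assms(2) in force)
qed

lemma isCont_wp_reg_0: "isCont wp_reg 0"
  by (rule holomorphic_on_imp_isCont[OF wp_reg_holomorphic open_Compl_punctured]) simp

lemma square_times_wp_limit: "((\<lambda>z. z\<^sup>2 * wp z) \<longlongrightarrow> 1) (at 0)"
proof (rule Lim_transform_eventually)
  have "((\<lambda>z. 1 + z\<^sup>2 * wp_reg z) \<longlongrightarrow> 1 + 0\<^sup>2 * wp_reg 0) (at 0)"
    using isCont_wp_reg_0 by (intro tendsto_intros) (auto simp: isCont_def)
  then show "((\<lambda>z. 1 + z\<^sup>2 * wp_reg z) \<longlongrightarrow> 1) (at 0)" by simp
  show "\<forall>\<^sub>F z in at 0. 1 + z\<^sup>2 * wp_reg z = z\<^sup>2 * wp z"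
    by (auto simp: eventually_at_filter wp_eq algebra_simps)
qed

lemma wp_pole: "filterlim wp at_infinity (at 0)"
proof -
  have "((\<lambda>z. z\<^sup>2) \<longlongrightarrow> (0::complex)) (at 0)"
    by (auto intro!: tendsto_eq_intros)
  then have "filterlim (\<lambda>z. z\<^sup>2) (at (0::complex)) (at 0)"
    by (auto simp: filterlim_at eventually_at_filter)
  then have "filterlim (\<lambda>z. (z\<^sup>2 * wp z) / z\<^sup>2) at_infinity (at 0)"
    by (intro filterlim_divide_at_infinity[OF square_times_wp_limit]) auto
  then show ?thesis
    by (rule filterlim_cong[OF refl refl, THEN iffD1, rotated]) (auto simp: eventually_at_filter)
qed

text \<open>If \<open>c\<close> were omitted, \<open>1 / (wp z - c)\<close> would be elliptic
  without poles, hence constant; as it tends to 0 at the origin, the constant would be 0.\<close>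

lemma wp_surj:
  obtains z where "z \<notin> L" "wp z = c"
proof (rule ccontr)
  assume "\<not> thesis"
  then have ne: "wp z \<noteq> c" if "z \<notin> L" for z using that \<open>\<And>z. z \<notin> L \<Longrightarrow> wp z = c \<Longrightarrow> thesis\<close> by blast
  define f where "f = (\<lambda>z. 1 / (wp z - c))"
  have hol: "f holomorphic_on - L"
    unfolding f_def using wp_holomorphic ne by (intro holomorphic_intros) auto
  have lim: "(f \<longlongrightarrow> 0) (at 0)"
  proof -
    have "filterlim (\<lambda>z. wp z - c) at_infinity (at 0)"
      using tendsto_add_filterlim_at_infinity'[OF wp_pole tendsto_const[of "- c"]] by simp
    then show ?thesis unfolding f_def by (intro tendsto_divide_0[OF tendsto_const])
  qed
  have shift: "z + l \<notin> L \<and> f (z + l) = f z" if "z \<notin> L" "l \<in> L" for z l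
    using that wp_periodic add_in_lattice_iff by (simp add: f_def)
  have "\<forall>\<^sub>F z in at 0. norm (f z) < 1"
    using order_tendstoD(2)[OF tendsto_norm[OF lim], of 1] by simp
  with eventually_at_0_notin_lattice have ev: "\<forall>\<^sub>F z in at 0. z \<notin> L \<and> norm (f z) \<le> 1"
    by eventually_elim auto
  have bd: "\<exists>B. \<forall>\<^sub>F z in at p. z \<notin> L \<and> norm (f z) \<le> B" if "p \<in> L" for p
    by (rule exI, rule eventually_at_lattice_point[OF ev]) (use shift that in auto)
  obtain k where k: "\<And>z. z \<notin> L \<Longrightarrow> f z = k"
    using elliptic_bounded_constant[OF open_Compl_lattice hol bd shift] by blast
  have "\<forall>\<^sub>F z in at 0. f z = k"
    using eventually_at_0_notin_lattice by (rule eventually_mono) (rule k)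
  then have "(f \<longlongrightarrow> k) (at 0)" by (rule tendsto_eventually)
  with lim have "k = 0" using LIM_unique by blast
  obtain z where "z \<notin> L"
    using eventually_happens[OF eventually_at_0_notin_lattice] by auto
  then show False using k[of z] ne[of z] \<open>k = 0\<close> by (simp add: f_def)
qed

lemma wp_not_constant: "\<not> (\<lambda>z. wp z - c) constant_on - L"
proof
  assume "(\<lambda>z. wp z - c) constant_on - L"
  then obtain k where k: "\<And>z. z \<notin> L \<Longrightarrow> wp z - c = k" unfolding constant_on_def by auto
  obtain z1 where "z1 \<notin> L" "wp z1 = c + k + 1" by (rule wp_surj)
  then show False using k[of z1] by simp
qed

text \<open>If the cubic had a double root \<open>e\<close>, then \<open>f = wp - e\<close> would satisfy
  \<open>f'\<^sup>2 = 4 f\<^sup>2 (f + 3 e)\<close>, so that \<open>f'/f\<close> would be bounded near a zero of \<open>f\<close>.\<close>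

lemma discriminant_nonzero: "g2 ^ 3 - 27 * g3\<^sup>2 \<noteq> 0"
proof
  assume disc: "g2 ^ 3 - 27 * g3\<^sup>2 = 0"
  \<comment> \<open>These are the coefficients of \<open>4 * (X - e)\<^sup>2 * (X + 2 * e)\<close>,
    the shape of a cubic without quadratic term that has a double root.\<close>
  obtain e where e: "g2 = 12 * e\<^sup>2" "g3 = - 8 * e ^ 3"
  proof (cases "g2 = 0")
    case True
    then show ?thesis using disc that[of 0] by simp
  next
    case False
    define e where "e = - 3 * g3 / (2 * g2)"
    have 1: "e * (2 * g2) = - 3 * g3" using False by (simp add: e_def)
    have "g2\<^sup>2 * (12 * e\<^sup>2) = 3 * (e * (2 * g2))\<^sup>2" by (simp add: power_mult_distrib)
    also have "\<dots> = g2\<^sup>2 * g2" unfolding 1 using disc by (simp add: power2_eq_square power3_eq_cube)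
    finally have 2: "g2 = 12 * e\<^sup>2" using False by simp
    have "3 * (- 8 * e ^ 3) = - 2 * e * (12 * e\<^sup>2)" by (simp add: power2_eq_square power3_eq_cube)
    also have "\<dots> = 3 * g3" using 1 unfolding 2[symmetric] by (simp add: algebra_simps)
    finally show ?thesis using that[OF 2] by simp
  qed
  obtain z0 where z0: "z0 \<notin> L" "wp z0 = e" by (rule wp_surj)
  have hol: "(\<lambda>z. wp z - e) holomorphic_on - L" using wp_holomorphic by (intro holomorphic_intros)
  obtain g r n where g: "0 < n" "0 < r" "ball z0 r \<subseteq> - L" "g holomorphic_on ball z0 r"
    "\<And>w. w \<in> ball z0 r \<Longrightarrow> wp w - e = (w - z0) ^ n * g w" "\<And>w. w \<in> ball z0 r \<Longrightarrow> g w \<noteq> 0"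
    by (rule holomorphic_factor_zero_nonconstant[OF hol open_Compl_lattice connected_Compl_lattice _ _ wp_not_constant, of z0])
       (use z0 in auto)
  have z0r: "z0 \<in> ball z0 r" using g(2) by simp
  have cont: "isCont g z0" "isCont (deriv g) z0" "isCont wp z0"
    using g(4) holomorphic_deriv[OF g(4)] wp_holomorphic open_Compl_lattice z0(1) z0r
    by (auto simp: continuous_on_eq_continuous_at dest!: holomorphic_on_imp_continuous_on)
  \<comment> \<open>The two sides of the cubic relation at a zero of order \<open>n\<close>, divided
    by \<open>(w - z0) ^ (2 * n - 2)\<close>. At \<open>z0\<close> the right side still vanishes,
    whereas the left side becomes the nonzero square of \<open>of_nat n * g z0\<close>.\<close>
  let ?l = "\<lambda>w. (of_nat n * g w + (w - z0) * deriv g w)\<^sup>2"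
  let ?r = "\<lambda>w. 4 * (w - z0)\<^sup>2 * (g w)\<^sup>2 * (wp w + 2 * e)"
  have "\<forall>\<^sub>F w in at z0. w \<in> ball z0 r - {z0}"
    using g(2) by (intro eventually_at_in_open) auto
  then have ev: "\<forall>\<^sub>F w in at z0. ?l w = ?r w"
  proof (rule eventually_mono)
    fix w assume w: "w \<in> ball z0 r - {z0}"
    then have wL: "w \<notin> L" and wr: "w \<in> ball z0 r" using g(3) by auto
    define u where "u = w - z0"
    have u0: "u \<noteq> 0" using w by (simp add: u_def)
    obtain m where m: "n = Suc m" using g(1) by (cases n) auto
    have "((\<lambda>w. (w - z0) ^ n * g w) has_field_derivative of_nat n * u ^ m * g w + u ^ n * deriv g w) (at w)"
      unfolding u_def m
      by (rule derivative_eq_intros holomorphic_derivI[OF g(4) open_ball wr] refl)+ simp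
    then have "((\<lambda>w. wp w - e) has_field_derivative of_nat n * u ^ m * g w + u ^ n * deriv g w) (at w)"
      by (rule has_field_derivative_transform_within_open[OF _ open_ball wr]) (use g(5) in auto)
    moreover have "((\<lambda>w. wp w - e) has_field_derivative wp' w - 0) (at w)"
      by (intro DERIV_diff wp_has_derivative[OF wL] DERIV_const)
    ultimately have "wp' w = of_nat n * u ^ m * g w + u ^ n * deriv g w"
      using DERIV_unique by fastforce
    also have "\<dots> = u ^ m * (of_nat n * g w + u * deriv g w)"
      by (simp add: m algebra_simps)
    finally have w': "(wp' w)\<^sup>2 = u ^ (2 * m) * (of_nat n * g w + u * deriv g w)\<^sup>2"
      by (simp add: power_mult_distrib power_mult[symmetric] mult.commute)
    have "(wp' w)\<^sup>2 = 4 * (wp w - e)\<^sup>2 * (wp w + 2 * e)"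
      unfolding wp'_square[OF wL] e by (simp add: power2_eq_square power3_eq_cube algebra_simps)
    also have "\<dots> = u ^ (2 * m) * (4 * u\<^sup>2 * (g w)\<^sup>2 * (wp w + 2 * e))"
    proof -
      have u2: "u ^ (2 * m) = u ^ m * u ^ m" by (simp add: mult_2 power_add)
      show ?thesis unfolding g(5)[OF wr] u_def[symmetric] u2
        by (simp add: m power2_eq_square algebra_simps)
    qed
    finally have "u ^ (2 * m) * (of_nat n * g w + u * deriv g w)\<^sup>2 = u ^ (2 * m) * (4 * u\<^sup>2 * (g w)\<^sup>2 * (wp w + 2 * e))"
      unfolding w' .
    then show "?l w = ?r w" using u0 by (simp add: u_def)
  qed
  have "(?l \<longlongrightarrow> (of_nat n * g z0 + (z0 - z0) * deriv g z0)\<^sup>2) (at z0)"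
    using cont by (intro tendsto_intros) (auto simp: isCont_def)
  moreover have "(?r \<longlongrightarrow> 4 * (z0 - z0)\<^sup>2 * (g z0)\<^sup>2 * (wp z0 + 2 * e)) (at z0)"
    using cont by (intro tendsto_intros) (auto simp: isCont_def)
  then have "(?l \<longlongrightarrow> 4 * (z0 - z0)\<^sup>2 * (g z0)\<^sup>2 * (wp z0 + 2 * e)) (at z0)"
    by (rule Lim_transform_eventually) (use ev in \<open>auto elim: eventually_mono\<close>)
  ultimately have "(of_nat n * g z0 + (z0 - z0) * deriv g z0)\<^sup>2 = 4 * (z0 - z0)\<^sup>2 * (g z0)\<^sup>2 * (wp z0 + 2 * e)"
    using LIM_unique by blast
  then show False using g(1) g(6)[OF z0r] by simp
qed

text \<open>With \<open>s = z + w\<close> fixed, the right-hand side is a function of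
  \<open>w\<close> alone whose derivative vanishes by the differential equations. Its domain stays
  connected because only countably many points are removed, and the limit at \<open>w = 0\<close>
  identifies the constant as \<open>wp s\<close>.\<close>

lemma wp_addition:
  assumes "z \<notin> L" "w \<notin> L" "z + w \<notin> L" "wp z \<noteq> wp w"
  shows "wp (z + w) = ((wp' z - wp' w) / (wp z - wp w))\<^sup>2 / 4 - wp z - wp w"
proof -
  define s where "s = z + w"
  have s: "s \<notin> L" using assms by (simp add: s_def)
  define A where "A = {w. w \<notin> L \<and> s - w \<notin> L}"
  have A_eq: "A = - L \<inter> (\<lambda>w. s - w) -` (- L)" by (auto simp: A_def)
  have openA: "open A"
    unfolding A_eq by (intro open_Int open_Compl_lattice open_vimage continuous_intros)
  have "s - w \<in> L \<longleftrightarrow> w \<in> (\<lambda>l. s - l) ` L" for w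
    by (auto intro!: image_eqI[of _ _ "s - w"])
  then have "A = UNIV - (L \<union> (\<lambda>l. s - l) ` L)"
    unfolding A_def by auto
  then have connA: "connected A"
    using countable_lattice by (auto intro!: connected_open_diff_countable)
  define q where "q = (\<lambda>w. wp (s - w) - wp w)"
  have hol_s: "(\<lambda>w. wp (s - w)) holomorphic_on A"
    by (rule holomorphic_on_compose_gen[OF _ wp_holomorphic, unfolded o_def])
       (auto simp: A_def intro!: holomorphic_intros)
  have hol_q: "q holomorphic_on A"
    unfolding q_def by (intro holomorphic_intros hol_s holomorphic_on_subset[OF wp_holomorphic]) (auto simp: A_def)
  have ds: "((\<lambda>w. wp (s - w)) has_field_derivative - wp' (s - w)) (at w)"
    "((\<lambda>w. wp' (s - w)) has_field_derivative - (6 * (wp (s - w))\<^sup>2 - g2 / 2)) (at w)" if "s - w \<notin> L" for w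
  proof -
    have sub: "((\<lambda>w. s - w) has_field_derivative - 1) (at w)" by (auto intro!: derivative_eq_intros)
    show "((\<lambda>w. wp (s - w)) has_field_derivative - wp' (s - w)) (at w)"
      using DERIV_chain2[where f = wp and g = "\<lambda>w. s - w", OF wp_has_derivative[OF that] sub] by simp
    show "((\<lambda>w. wp' (s - w)) has_field_derivative - (6 * (wp (s - w))\<^sup>2 - g2 / 2)) (at w)"
      using DERIV_chain2[where f = wp' and g = "\<lambda>w. s - w", OF wp'_has_derivative[OF that] sub] deriv_wp'[OF that]
      by simp
  qed
  have "isCont (\<lambda>w. wp (s - w)) 0" "isCont (\<lambda>w. wp' (s - w)) 0"
    using ds[of 0] s by (auto intro: DERIV_isCont)
  then have lims: "((\<lambda>w. wp (s - w)) \<longlongrightarrow> wp s) (at 0)" "((\<lambda>w. wp' (s - w)) \<longlongrightarrow> wp' s) (at 0)"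
    by (simp_all add: isCont_def)
  have "isCont (deriv wp_reg) 0"
    by (rule holomorphic_on_imp_isCont[OF holomorphic_deriv[OF wp_reg_holomorphic] open_Compl_punctured])
       (simp_all add: open_Compl_punctured del: Compl_Diff_eq)
  then have limr: "(wp_reg \<longlongrightarrow> 0) (at 0)" "(deriv wp_reg \<longlongrightarrow> deriv wp_reg 0) (at 0)"
    using isCont_wp_reg_0 by (simp_all add: isCont_def wp_reg_zero)
  \<comment> \<open>With these functions, regular at 0, \<open>wp' (s - w) - wp' w\<close> is
    \<open>2 * e w + 2 / w ^ 3\<close> and \<open>wp (s - w) - wp w\<close> is
    \<open>d w - 1 / w\<^sup>2\<close>.\<close>
  define e where "e = (\<lambda>w. (wp' (s - w) - deriv wp_reg w) / 2)"
  define d where "d = (\<lambda>w. wp (s - w) - wp_reg w)"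
  have lim_e: "(e \<longlongrightarrow> (wp' s - deriv wp_reg 0) / 2) (at 0)"
    unfolding e_def by (intro tendsto_intros lims limr) auto
  have lim_d: "(d \<longlongrightarrow> wp s - 0) (at 0)"
    unfolding d_def by (intro tendsto_intros lims limr)
  have evA: "\<forall>\<^sub>F w in at 0. w \<in> A"
  proof -
    have "\<forall>\<^sub>F w in at 0. w \<in> (\<lambda>w. s - w) -` (- L) - {0}"
      using s by (intro eventually_at_in_open open_vimage open_Compl_lattice continuous_intros) auto
    with eventually_at_0_notin_lattice show ?thesis
      by eventually_elim (auto simp: A_def)
  qed
  have "((\<lambda>w. 1 - w\<^sup>2 * d w) \<longlongrightarrow> 1 - 0\<^sup>2 * (wp s - 0)) (at 0)"
    by (intro tendsto_intros lim_d)
  then have lim_1: "((\<lambda>w. 1 - w\<^sup>2 * d w) \<longlongrightarrow> 1) (at 0)" by simp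
  then have ev1: "\<forall>\<^sub>F w in at 0. 1 - w\<^sup>2 * d w \<noteq> 0"
    by (rule tendsto_imp_eventually_ne) simp
  have qd: "q w = - (1 - w\<^sup>2 * d w) / w\<^sup>2" if "w \<noteq> 0" for w
  proof -
    have "q w = d w - 1 / w\<^sup>2" by (simp add: q_def d_def wp_eq[of w])
    also have "\<dots> = - (1 - w\<^sup>2 * d w) / w\<^sup>2" using that by (simp add: diff_divide_distrib)
    finally show ?thesis .
  qed
  have "\<not> q constant_on A"
  proof
    assume "q constant_on A"
    then obtain k where k: "\<And>w. w \<in> A \<Longrightarrow> q w = k" unfolding constant_on_def by auto
    have "\<forall>\<^sub>F w in at 0. - k * w\<^sup>2 = 1 - w\<^sup>2 * d w"
      using evA eventually_neq_at_within[of 0 0 UNIV]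
    proof eventually_elim
      case (elim w)
      then show ?case using k[of w] qd[of w] by (simp add: field_simps)
    qed
    moreover have "((\<lambda>w. - k * w\<^sup>2) \<longlongrightarrow> - k * 0\<^sup>2) (at 0)" by (intro tendsto_intros)
    ultimately have "((\<lambda>w. 1 - w\<^sup>2 * d w) \<longlongrightarrow> - k * 0\<^sup>2) (at 0)"
      by (rule Lim_transform_eventually[rotated])
    from LIM_unique[OF this lim_1] show False by simp
  qed
  moreover have "fsigma A"
  proof -
    obtain C :: "nat \<Rightarrow> complex set" where C: "\<And>n. compact (C n)" "(\<Union>n. C n) = A"
      using open_Union_compact_subsets[OF openA] by metis
    have "fsigma (\<Union>n. C n)" by (rule fsigma.intros) (rule compact_imp_closed[OF C(1)])
    then show ?thesis unfolding C(2) .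
  qed
  ultimately have countable: "countable {w \<in> A. q w = 0}"
    using holomorphic_countable_zeros[OF hol_q openA connA] by blast
  define U where "U = A - {w \<in> A. q w = 0}"
  have connU: "connected U"
    unfolding U_def using connected_open_diff_countable[OF _ openA connA countable] by simp
  have U_eq: "U = A \<inter> q -` (- {0})" by (auto simp: U_def)
  have openU: "open U"
    unfolding U_eq by (rule continuous_open_preimage[OF holomorphic_on_imp_continuous_on[OF hol_q] openA]) auto
  define \<phi> where "\<phi> = (\<lambda>w. ((wp' (s - w) - wp' w) / (wp (s - w) - wp w))\<^sup>2 / 4 - wp (s - w) - wp w)"
  have "\<phi> constant_on U"
  proof (rule has_field_derivative_0_imp_constant_on[OF _ connU openU])
    fix w assume "w \<in> U"
    then have w: "w \<notin> L" "s - w \<notin> L" and ne: "wp (s - w) - wp w \<noteq> 0" by (auto simp: U_def A_def q_def)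
    have dw: "(wp has_field_derivative wp' w) (at w)"
      "(wp' has_field_derivative 6 * (wp w)\<^sup>2 - g2 / 2) (at w)"
      using wp_has_derivative[OF w(1)] wp'_has_derivative[OF w(1)] deriv_wp'[OF w(1)] by simp_all
    define a b p q where "a = wp (s - w)" and "b = wp w" and "p = wp' (s - w)" and "q = wp' w"
    define m where "m = (p - q) / (a - b)"
    have ab: "a - b \<noteq> 0" using ne by (simp add: a_def b_def)
    have pq: "p\<^sup>2 = 4 * a ^ 3 - g2 * a - g3" "q\<^sup>2 = 4 * b ^ 3 - g2 * b - g3"
      using wp'_square[OF w(2)] wp'_square[OF w(1)] by (simp_all add: a_def b_def p_def q_def)
    have dm: "((\<lambda>w. (wp' (s - w) - wp' w) / (wp (s - w) - wp w)) has_field_derivative - 2 * (a - b)) (at w)"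
    proof -
      have "((\<lambda>w. (wp' (s - w) - wp' w) / (wp (s - w) - wp w)) has_field_derivative
          ((- (6 * a\<^sup>2 - g2 / 2) - (6 * b\<^sup>2 - g2 / 2)) * (a - b) - (p - q) * (- p - q)) / ((a - b) * (a - b))) (at w)"
        unfolding a_def b_def p_def q_def using ne
        by (intro DERIV_divide DERIV_diff ds dw w)
      moreover have "(- (6 * a\<^sup>2 - g2 / 2) - (6 * b\<^sup>2 - g2 / 2)) * (a - b) - (p - q) * (- p - q) = - 2 * (a - b) * ((a - b) * (a - b))"
      proof -
        have "(p - q) * (- p - q) = q\<^sup>2 - p\<^sup>2" by (simp add: power2_eq_square algebra_simps)
        then show ?thesis unfolding pq by (simp add: power2_eq_square power3_eq_cube algebra_simps)
      qed
      ultimately show ?thesis using ab by simp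
    qed
    have "(\<phi> has_field_derivative of_nat 2 * (- 2 * (a - b) * ((wp' (s - w) - wp' w) / (wp (s - w) - wp w)) ^ (2 - Suc 0)) / 4
        - - wp' (s - w) - wp' w) (at w)"
      unfolding \<phi>_def
      by (rule DERIV_diff[OF DERIV_diff[OF DERIV_cdivide[OF DERIV_power[OF dm, of 2], of 4] ds(1)[OF w(2)]] dw(1)])
    moreover have "of_nat 2 * (- 2 * (a - b) * ((wp' (s - w) - wp' w) / (wp (s - w) - wp w)) ^ (2 - Suc 0)) / 4
        - - wp' (s - w) - wp' w = 0"
    proof -
      have "(wp' (s - w) - wp' w) / (wp (s - w) - wp w) = m"
        by (simp add: m_def p_def q_def a_def b_def)
      moreover have "(a - b) * m = p - q" using ab by (simp add: m_def)
      moreover have "of_nat 2 * (- 2 * (a - b) * m ^ (2 - Suc 0)) / 4 - - p - q = p - q - (a - b) * m"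
        by (simp add: algebra_simps)
      ultimately show ?thesis by (simp only: p_def q_def diff_self)
    qed
    ultimately show "(\<phi> has_field_derivative 0) (at w)" by simp
  qed
  then obtain k where k: "\<And>w. w \<in> U \<Longrightarrow> \<phi> w = k" unfolding constant_on_def by auto
  \<comment> \<open>The expression is \<open>\<phi>\<close> after the double poles at 0 of the
    squared slope and of \<open>wp w\<close> have been cancelled, so its limit can be taken term by
    term.\<close>
  have "((\<lambda>w. (w * e w + d w) * (2 + w ^ 3 * e w - w\<^sup>2 * d w) / (1 - w\<^sup>2 * d w)\<^sup>2 - wp_reg w - wp (s - w)) \<longlongrightarrow>
      (0 * ((wp' s - deriv wp_reg 0) / 2) + (wp s - 0)) *
      (2 + 0 ^ 3 * ((wp' s - deriv wp_reg 0) / 2) - 0\<^sup>2 * (wp s - 0)) / 1\<^sup>2 - 0 - wp s) (at 0)"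
    by (intro tendsto_intros lim_e lim_d lim_1 lims limr) auto
  then have "((\<lambda>w. (w * e w + d w) * (2 + w ^ 3 * e w - w\<^sup>2 * d w) / (1 - w\<^sup>2 * d w)\<^sup>2 - wp_reg w - wp (s - w)) \<longlongrightarrow> wp s) (at 0)"
    by simp
  moreover have "\<forall>\<^sub>F w in at 0. (w * e w + d w) * (2 + w ^ 3 * e w - w\<^sup>2 * d w) / (1 - w\<^sup>2 * d w)\<^sup>2 - wp_reg w - wp (s - w) = k"
    using evA ev1 eventually_neq_at_within[of 0 0 UNIV]
  proof eventually_elim
    case (elim w)
    define E D h where "E = e w" and "D = d w" and "h = wp_reg w"
    have "q w \<noteq> 0" using qd elim by simp
    then have "k = \<phi> w" using k[of w] elim by (simp add: U_def)
    also have "\<phi> w = ((2 * E + 2 / w ^ 3) / (D - 1 / w\<^sup>2))\<^sup>2 / 4 - (D + h) - (1 / w\<^sup>2 + h)"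
    proof -
      have "wp' w = - 2 / w ^ 3 + deriv wp_reg w"
        using wp_derivs_near_0(1)[of w] elim by (auto simp: A_def)
      then have "wp' (s - w) - wp' w = 2 * E + 2 / w ^ 3"
        by (simp add: E_def e_def)
      moreover have "wp (s - w) - wp w = D - 1 / w\<^sup>2"
        by (simp add: D_def d_def wp_eq[of w])
      moreover have "wp (s - w) = D + h" "wp w = 1 / w\<^sup>2 + h"
        by (simp_all add: D_def d_def h_def wp_eq[of w])
      ultimately show ?thesis unfolding \<phi>_def by (simp only:)
    qed
    also have "(2 * E + 2 / w ^ 3) / (D - 1 / w\<^sup>2) = - 2 * (1 + w ^ 3 * E) / (w * (1 - w\<^sup>2 * D))"
    proof -
      have "2 * E + 2 / w ^ 3 = 2 * (1 + w ^ 3 * E) / w ^ 3" "D - 1 / w\<^sup>2 = - (1 - w\<^sup>2 * D) / w\<^sup>2"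
        using elim by (simp_all add: field_simps)
      moreover have "(2 * a / w ^ 3) / (- v / w\<^sup>2) = - 2 * a / (w * v)" for a v
        using elim by (simp add: power2_eq_square power3_eq_cube)
      ultimately show ?thesis by (simp only:)
    qed
    also have "(- 2 * (1 + w ^ 3 * E) / (w * (1 - w\<^sup>2 * D)))\<^sup>2 / 4 - (D + h) - (1 / w\<^sup>2 + h) =
        (w * E + D) * (2 + w ^ 3 * E - w\<^sup>2 * D) / (1 - w\<^sup>2 * D)\<^sup>2 - h - (D + h)"
    proof -
      define v where "v = 1 - w\<^sup>2 * D"
      have v: "v \<noteq> 0" using elim by (simp add: v_def D_def)
      have "(- 2 * a / (w * v))\<^sup>2 / 4 - 1 / w\<^sup>2 = (a\<^sup>2 - v\<^sup>2) / (w\<^sup>2 * v\<^sup>2)" for a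
        using elim v by (simp add: power_mult_distrib power_divide field_simps)
      then have "(- 2 * (1 + w ^ 3 * E) / (w * v))\<^sup>2 / 4 - 1 / w\<^sup>2 = ((1 + w ^ 3 * E)\<^sup>2 - v\<^sup>2) / (w\<^sup>2 * v\<^sup>2)" .
      also have "(1 + w ^ 3 * E)\<^sup>2 - v\<^sup>2 = w\<^sup>2 * ((w * E + D) * (2 + w ^ 3 * E - w\<^sup>2 * D))"
        by (simp add: v_def power2_eq_square power3_eq_cube algebra_simps)
      also have "w\<^sup>2 * ((w * E + D) * (2 + w ^ 3 * E - w\<^sup>2 * D)) / (w\<^sup>2 * v\<^sup>2) = (w * E + D) * (2 + w ^ 3 * E - w\<^sup>2 * D) / v\<^sup>2"
        using elim by simp
      finally show ?thesis unfolding v_def by (simp add: algebra_simps)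
    qed
    finally show ?case by (simp add: E_def D_def h_def d_def)
  qed
  ultimately have "((\<lambda>w::complex. k) \<longlongrightarrow> wp s) (at 0)"
    by (rule Lim_transform_eventually)
  then have "wp s = k" using LIM_const_eq by metis
  moreover have "w \<in> U" using assms by (simp add: U_def A_def q_def s_def)
  ultimately show ?thesis using k[of w] by (simp add: \<phi>_def s_def)
qed


text \<open>The addition formula for \<open>w\<close> and for \<open>- w\<close> differs only in the
  sign of \<open>wp' w\<close>. Sum and product are symmetric in this sign, so the derivatives occur
  only as squares and are eliminated by the cubic.\<close>

lemma wp_sum_prod_aux:
  assumes "z \<notin> L" "w \<notin> L" "z + w \<notin> L" "z - w \<notin> L" "wp z \<noteq> wp w"
  shows "(wp z - wp w)\<^sup>2 * (wp (z + w) + wp (z - w)) =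
      2 * wp z * wp w * (wp z + wp w) - g2 / 2 * (wp z + wp w) - g3" (is ?sum)
    and "(wp z - wp w)\<^sup>2 * (wp (z + w) * wp (z - w)) = (wp z * wp w + g2 / 4)\<^sup>2 + g3 * (wp z + wp w)" (is ?prod)
proof -
  define x y p q where "x = wp z" and "y = wp w" and "p = wp' z" and "q = wp' w"
  define d where "d = x - y"
  have d: "d \<noteq> 0" using assms by (simp add: d_def x_def y_def)
  have pq: "p\<^sup>2 = 4 * x ^ 3 - g2 * x - g3" "q\<^sup>2 = 4 * y ^ 3 - g2 * y - g3"
    using wp'_square assms by (simp_all add: x_def y_def p_def q_def)
  have "- w \<notin> L" using assms uminus_in_lattice_iff by simp
  then have plus: "wp (z + w) = ((p - q) / d)\<^sup>2 / 4 - x - y"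
    and minus: "wp (z - w) = ((p + q) / d)\<^sup>2 / 4 - x - y"
    using wp_addition[of z w] wp_addition[of z "- w"] assms
    by (simp_all add: wp_even wp'_odd x_def y_def p_def q_def d_def)
  have x: "x = y + d" by (simp add: d_def)
  have plus': "d\<^sup>2 * wp (z + w) = (p - q)\<^sup>2 / 4 - (x + y) * d\<^sup>2"
    and minus': "d\<^sup>2 * wp (z - w) = (p + q)\<^sup>2 / 4 - (x + y) * d\<^sup>2"
    using d unfolding plus minus by (simp_all add: power_divide algebra_simps)
  have "d\<^sup>2 * (wp (z + w) + wp (z - w)) = (p\<^sup>2 + q\<^sup>2) / 2 - 2 * (x + y) * d\<^sup>2"
    unfolding distrib_left plus' minus' by (simp add: power2_eq_square field_simps)
  also have "\<dots> = 2 * x * y * (x + y) - g2 / 2 * (x + y) - g3"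
    unfolding pq by (simp add: d_def power2_eq_square power3_eq_cube field_simps)
  finally show ?sum by (simp add: x_def y_def d_def)
  have "d\<^sup>2 * (16 * (d\<^sup>2 * (wp (z + w) * wp (z - w)))) = 16 * ((d\<^sup>2 * wp (z + w)) * (d\<^sup>2 * wp (z - w)))"
    by (simp add: mult_ac)
  also have "\<dots> = (p\<^sup>2 - q\<^sup>2)\<^sup>2 - 8 * (x + y) * d\<^sup>2 * (p\<^sup>2 + q\<^sup>2) + 16 * (x + y)\<^sup>2 * (d\<^sup>2)\<^sup>2"
    unfolding plus' minus' by (simp add: power2_eq_square field_simps)
  also have "p\<^sup>2 - q\<^sup>2 = d * (4 * (x\<^sup>2 + x * y + y\<^sup>2) - g2)"
    unfolding pq by (simp add: d_def power2_eq_square power3_eq_cube algebra_simps)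
  also have "(d * (4 * (x\<^sup>2 + x * y + y\<^sup>2) - g2))\<^sup>2 - 8 * (x + y) * d\<^sup>2 * (p\<^sup>2 + q\<^sup>2) + 16 * (x + y)\<^sup>2 * (d\<^sup>2)\<^sup>2
      = d\<^sup>2 * ((4 * (x\<^sup>2 + x * y + y\<^sup>2) - g2)\<^sup>2 - 8 * (x + y) * (p\<^sup>2 + q\<^sup>2) + 16 * (x + y)\<^sup>2 * d\<^sup>2)"
    by (simp add: power2_eq_square algebra_simps)
  also have "(4 * (x\<^sup>2 + x * y + y\<^sup>2) - g2)\<^sup>2 - 8 * (x + y) * (p\<^sup>2 + q\<^sup>2) + 16 * (x + y)\<^sup>2 * d\<^sup>2
      = 16 * ((x * y + g2 / 4)\<^sup>2 + g3 * (x + y))"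
    unfolding pq by (simp add: d_def power2_eq_square power3_eq_cube field_simps)
  finally have "16 * (d\<^sup>2 * (wp (z + w) * wp (z - w))) = 16 * ((x * y + g2 / 4)\<^sup>2 + g3 * (x + y))"
    by (subst (asm) mult_left_cancel) (use d in auto)
  then have "d\<^sup>2 * (wp (z + w) * wp (z - w)) = (x * y + g2 / 4)\<^sup>2 + g3 * (x + y)"
    by (subst (asm) mult_left_cancel) auto
  then show ?prod by (simp add: x_def y_def d_def)
qed

lemma isCont_wp: "z \<notin> L \<Longrightarrow> isCont wp z"
  using holomorphic_on_imp_isCont[OF wp_holomorphic open_Compl_lattice] by simp

text \<open>By continuity, the formulas would otherwise force the duplication polynomials to have the
  common root \<open>wp z\<close>, contradicting the nonvanishing of the discriminant.\<close>

lemma wp_inj: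
  assumes "z \<notin> L" "w \<notin> L" "z + w \<notin> L" "z - w \<notin> L"
  shows "wp z \<noteq> wp w"
proof
  assume eq: "wp z = wp w"
  define x where "x = wp w"
  have hol: "(\<lambda>u. wp u - x) holomorphic_on - L" using wp_holomorphic by (intro holomorphic_intros)
  obtain \<beta> where \<beta>: "\<beta> \<notin> L" "wp \<beta> = x + 1" by (rule wp_surj)
  have pts: "z \<in> - L" "wp z - x = 0" "\<beta> \<in> - L" "wp \<beta> - x \<noteq> 0"
    using assms(1) \<beta> eq by (simp_all add: x_def)
  obtain r where r: "r > 0" "ball z r \<subseteq> - L" "\<And>u. u \<in> ball z r - {z} \<Longrightarrow> wp u - x \<noteq> 0"
    using isolated_zeros[OF hol open_Compl_lattice connected_Compl_lattice pts] by blast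
  have "\<forall>\<^sub>F u in at z. u \<in> ball z r - {z}" using r(1) by (intro eventually_at_in_open) auto
  then have ne: "\<forall>\<^sub>F u in at z. wp u \<noteq> x" by (rule eventually_mono) (use r(3) in auto)
  define G where "G = - L \<inter> (\<lambda>u. u + w) -` (- L) \<inter> (\<lambda>u. u - w) -` (- L)"
  have "open G" unfolding G_def
    by (intro open_Int open_vimage open_Compl_lattice continuous_intros)
  then have evO: "\<forall>\<^sub>F u in at z. u \<in> G"
    using assms by (intro eventually_at_topological[THEN iffD2]) (auto simp: G_def)
  have ev: "\<forall>\<^sub>F u in at z. (wp u - x)\<^sup>2 * (wp (u + w) + wp (u - w)) =
      2 * wp u * x * (wp u + x) - g2 / 2 * (wp u + x) - g3 \<and>
      (wp u - x)\<^sup>2 * (wp (u + w) * wp (u - w)) = (wp u * x + g2 / 4)\<^sup>2 + g3 * (wp u + x)"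
    using ne evO
  proof eventually_elim
    case (elim u)
    then show ?case using wp_sum_prod_aux[of u w] assms(2) by (auto simp: G_def x_def)
  qed
  have c0: "(wp \<longlongrightarrow> x) (at z)" using isCont_wp[OF assms(1)] eq by (simp add: isCont_def x_def)
  have cp: "((\<lambda>u. wp (u + w)) \<longlongrightarrow> wp (z + w)) (at z)" and cm: "((\<lambda>u. wp (u - w)) \<longlongrightarrow> wp (z - w)) (at z)"
  proof -
    have "isCont (\<lambda>u. wp (u + w)) z" "isCont (\<lambda>u. wp (u - w)) z"
      using isCont_wp[OF assms(3)] isCont_wp[OF assms(4)]
      by (intro isCont_o2[where g = wp and a = z]; simp)+
    then show "((\<lambda>u. wp (u + w)) \<longlongrightarrow> wp (z + w)) (at z)" "((\<lambda>u. wp (u - w)) \<longlongrightarrow> wp (z - w)) (at z)"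
      by (simp_all add: isCont_def)
  qed
  have "((\<lambda>u. (wp u - x)\<^sup>2 * (wp (u + w) + wp (u - w))) \<longlongrightarrow> (x - x)\<^sup>2 * (wp (z + w) + wp (z - w))) (at z)"
    by (intro tendsto_intros c0 cp cm)
  moreover have "((\<lambda>u. 2 * wp u * x * (wp u + x) - g2 / 2 * (wp u + x) - g3) \<longlongrightarrow>
      2 * x * x * (x + x) - g2 / 2 * (x + x) - g3) (at z)"
    by (intro tendsto_intros c0)
  then have "((\<lambda>u. (wp u - x)\<^sup>2 * (wp (u + w) + wp (u - w))) \<longlongrightarrow>
      2 * x * x * (x + x) - g2 / 2 * (x + x) - g3) (at z)"
    by (rule Lim_transform_eventually) (use ev in \<open>auto elim: eventually_mono\<close>)
  ultimately have s: "(x - x)\<^sup>2 * (wp (z + w) + wp (z - w)) = 2 * x * x * (x + x) - g2 / 2 * (x + x) - g3"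
    by (rule LIM_unique)
  have "((\<lambda>u. (wp u - x)\<^sup>2 * (wp (u + w) * wp (u - w))) \<longlongrightarrow> (x - x)\<^sup>2 * (wp (z + w) * wp (z - w))) (at z)"
    by (intro tendsto_intros c0 cp cm)
  moreover have "((\<lambda>u. (wp u * x + g2 / 4)\<^sup>2 + g3 * (wp u + x)) \<longlongrightarrow> (x * x + g2 / 4)\<^sup>2 + g3 * (x + x)) (at z)"
    by (intro tendsto_intros c0)
  then have "((\<lambda>u. (wp u - x)\<^sup>2 * (wp (u + w) * wp (u - w))) \<longlongrightarrow> (x * x + g2 / 4)\<^sup>2 + g3 * (x + x)) (at z)"
    by (rule Lim_transform_eventually) (use ev in \<open>auto elim: eventually_mono\<close>)
  ultimately have p: "(x - x)\<^sup>2 * (wp (z + w) * wp (z - w)) = (x * x + g2 / 4)\<^sup>2 + g3 * (x + x)"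
    by (rule LIM_unique)
  \<comment> \<open>Explicit Bezout identity between the denominator and the numerator of the
    duplication formula.\<close>
  have "g2 ^ 3 - 27 * g3\<^sup>2 = (12 * x ^ 3 + 5 * g2 * x + 27 * g3) * (4 * x ^ 3 - g2 * x - g3)
      - (48 * x\<^sup>2 - 16 * g2) * ((x\<^sup>2 + g2 / 4)\<^sup>2 + 2 * g3 * x)"
    by (simp add: power2_eq_square power3_eq_cube field_simps)
  also have "4 * x ^ 3 - g2 * x - g3 = 0" using s by (simp add: power3_eq_cube mult.assoc)
  also have "(x\<^sup>2 + g2 / 4)\<^sup>2 + 2 * g3 * x = 0" using p by (simp add: power2_eq_square mult_ac)
  finally show False using discriminant_nonzero by simp
qed

lemma wp_sum:
  assumes "z \<notin> L" "w \<notin> L" "z + w \<notin> L" "z - w \<notin> L"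
  shows "(wp z - wp w)\<^sup>2 * (wp (z + w) + wp (z - w)) =
      2 * wp z * wp w * (wp z + wp w) - g2 / 2 * (wp z + wp w) - g3"
  using wp_sum_prod_aux(1)[OF assms wp_inj[OF assms]] .

lemma wp_prod:
  assumes "z \<notin> L" "w \<notin> L" "z + w \<notin> L" "z - w \<notin> L"
  shows "(wp z - wp w)\<^sup>2 * (wp (z + w) * wp (z - w)) = (wp z * wp w + g2 / 4)\<^sup>2 + g3 * (wp z + wp w)"
  using wp_sum_prod_aux(2)[OF assms wp_inj[OF assms]] .

text \<open>Limit of the product formula as \<open>w\<close> tends to \<open>z\<close>: the double
  pole of \<open>wp (z - w)\<close> cancels the double zero of \<open>(wp z - wp w)\<^sup>2\<close>,
  leaving \<open>(wp' z)\<^sup>2\<close>, which the cubic expresses through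
  \<open>wp z\<close>.\<close>

lemma wp_double:
  assumes "z \<notin> L" "2 * z \<notin> L"
  shows "wp (2 * z) * (4 * wp z ^ 3 - g2 * wp z - g3) = ((wp z)\<^sup>2 + g2 / 4)\<^sup>2 + 2 * g3 * wp z"
proof -
  define G where "G = - L \<inter> (\<lambda>u. z + u) -` (- L)"
  have "open G" unfolding G_def
    by (intro open_Int open_vimage open_Compl_lattice continuous_intros)
  then have evO: "\<forall>\<^sub>F w in at z. w \<in> G"
    using assms by (intro eventually_at_topological[THEN iffD2]) (auto simp: G_def)
  have lim_w: "((\<lambda>w. z - w) \<longlongrightarrow> 0) (at z)" by (auto intro!: tendsto_eq_intros)
  then have filt: "filterlim (\<lambda>w. z - w) (at 0) (at z)"
    by (auto simp: filterlim_at eventually_at_filter)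
  have evL: "\<forall>\<^sub>F w in at z. z - w \<notin> L"
    using filterlim_iff[THEN iffD1, OF filt] eventually_at_0_notin_lattice by blast
  have ev: "\<forall>\<^sub>F w in at z. ((wp w - wp z) / (w - z))\<^sup>2 * ((z - w)\<^sup>2 * wp (z - w)) * wp (z + w) =
      (wp z * wp w + g2 / 4)\<^sup>2 + g3 * (wp z + wp w)"
    using evO evL eventually_neq_at_within[of z z UNIV]
  proof eventually_elim
    case (elim w)
    then have "(wp z - wp w)\<^sup>2 * (wp (z + w) * wp (z - w)) = (wp z * wp w + g2 / 4)\<^sup>2 + g3 * (wp z + wp w)"
      using assms(1) by (intro wp_prod) (auto simp: G_def)
    moreover have "((wp w - wp z) / (w - z))\<^sup>2 * (z - w)\<^sup>2 = (wp z - wp w)\<^sup>2"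
      using elim by (simp add: power_divide power2_commute)
    ultimately show ?case by (simp add: mult_ac)
  qed
  have d: "((\<lambda>w. (wp w - wp z) / (w - z)) \<longlongrightarrow> wp' z) (at z)"
    using wp_has_derivative[OF assms(1)] by (simp add: has_field_derivative_iff)
  have p: "((\<lambda>w. (z - w)\<^sup>2 * wp (z - w)) \<longlongrightarrow> 1) (at z)"
    using filterlim_compose[OF square_times_wp_limit filt] by simp
  have c: "(wp \<longlongrightarrow> wp z) (at z)" using isCont_wp[OF assms(1)] by (simp add: isCont_def)
  have c2: "((\<lambda>w. wp (z + w)) \<longlongrightarrow> wp (2 * z)) (at z)"
  proof -
    have "isCont (\<lambda>w. wp (z + w)) z"
      using isCont_wp[OF assms(2)] by (intro isCont_o2[where g = wp and a = z]) simp_all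
    then show ?thesis by (simp add: isCont_def)
  qed
  have "((\<lambda>w. ((wp w - wp z) / (w - z))\<^sup>2 * ((z - w)\<^sup>2 * wp (z - w)) * wp (z + w)) \<longlongrightarrow> (wp' z)\<^sup>2 * 1 * wp (2 * z)) (at z)"
    by (intro tendsto_intros d p c2)
  then have "((\<lambda>w. (wp z * wp w + g2 / 4)\<^sup>2 + g3 * (wp z + wp w)) \<longlongrightarrow> (wp' z)\<^sup>2 * 1 * wp (2 * z)) (at z)"
    by (rule Lim_transform_eventually) (rule ev)
  moreover have "((\<lambda>w. (wp z * wp w + g2 / 4)\<^sup>2 + g3 * (wp z + wp w)) \<longlongrightarrow> (wp z * wp z + g2 / 4)\<^sup>2 + g3 * (wp z + wp z)) (at z)"
    by (intro tendsto_intros c)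
  ultimately have "(wp' z)\<^sup>2 * 1 * wp (2 * z) = (wp z * wp z + g2 / 4)\<^sup>2 + g3 * (wp z + wp z)"
    by (rule LIM_unique)
  then show ?thesis
    unfolding wp'_square[OF assms(1)] by (simp add: power2_eq_square mult_ac)
qed

lemma wp_half_period:
  assumes "z \<notin> L" "2 * z \<in> L"
  shows "4 * wp z ^ 3 - g2 * wp z - g3 = 0"
proof -
  have "wp' z = wp' (- z + 2 * z)" by simp
  also have "\<dots> = wp' (- z)"
    using assms uminus_in_lattice_iff by (intro wp'_periodic) auto
  also have "\<dots> = - wp' z" by (rule wp'_odd[OF assms(1)])
  finally have "wp' z = 0" by simp
  then show ?thesis using wp'_square[OF assms(1)] by simp
qed

text \<open>Subtracting a multiple of a power of \<open>wp\<close> removes the leading term at 0; by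
  evenness the pole order drops by two, until the function is bounded and hence constant. The set
  \<open>D\<close> allows isolated points outside the lattice where \<open>f\<close> has no
  meaningful value.\<close>

lemma even_elliptic_eq_poly:
  assumes D: "open (- D)" "L \<subseteq> D" "\<And>z. - z \<in> D \<longleftrightarrow> z \<in> D" "\<forall>\<^sub>F z in at 0. z \<notin> D"
    and "f holomorphic_on - D"
    and bd: "\<And>p. p \<in> D - L \<Longrightarrow> \<exists>B. \<forall>\<^sub>F z in at p. z \<notin> D \<and> norm (f z) \<le> B"
    and "\<And>z l. z \<notin> D \<Longrightarrow> l \<in> L \<Longrightarrow> z + l \<notin> D \<and> f (z + l) = f z"
    and "\<And>z. z \<notin> D \<Longrightarrow> f (- z) = f z"
    and "\<exists>B. \<forall>\<^sub>F z in at 0. norm (z ^ (2 * m) * f z) \<le> B"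
  shows "\<exists>p. \<forall>z. z \<notin> D \<longrightarrow> f z = poly p (wp z)"
  using assms(5-)
proof (induction m arbitrary: f)
  case 0
  from "0.prems"(5) obtain B where "\<forall>\<^sub>F z in at 0. norm (f z) \<le> B" by auto
  with D(4) have ev: "\<forall>\<^sub>F z in at 0. z \<notin> D \<and> norm (f z) \<le> B" by eventually_elim auto
  have bd': "\<exists>B. \<forall>\<^sub>F z in at p. z \<notin> D \<and> norm (f z) \<le> B" if "p \<in> D" for p
  proof (cases "p \<in> L")
    case True
    show ?thesis
      by (rule exI, rule eventually_at_lattice_point[OF ev]) (use "0.prems"(3) True in auto)
  qed (use "0.prems"(2) that in auto)
  obtain c where "\<And>z. z \<notin> D \<Longrightarrow> f z = c"
    using elliptic_bounded_constant[OF D(1) "0.prems"(1) bd' "0.prems"(3)] by blast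
  then show ?case by (intro exI[of _ "[:c:]"]) auto
next
  case (Suc m)
  note f = Suc.prems
  obtain r where r: "r > 0" "\<And>z. z \<in> ball 0 r - {0} \<Longrightarrow> z \<notin> D"
    using D(4) unfolding eventually_at by (auto simp: dist_commute)
  define h where "h = (\<lambda>z. z ^ (2 * Suc m) * f z)"
  have sub: "ball 0 r - {0} \<subseteq> - D" using r(2) by auto
  have hol: "h holomorphic_on ball 0 r - {0}"
    unfolding h_def using holomorphic_on_subset[OF f(1) sub] by (intro holomorphic_intros)
  have int: "0 \<in> interior (ball 0 r :: complex set)" using r(1) by simp
  obtain g where g: "g holomorphic_on ball 0 r" "\<And>z. z \<in> ball 0 r - {0} \<Longrightarrow> g z = h z"
    using holomorphic_on_extend_bounded[OF hol int] f(5) unfolding h_def by auto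
  define c where "c = g 0"
  define f1 where "f1 = (\<lambda>z. f z - c * wp z ^ Suc m)"
  define k where "k = (\<lambda>z. if norm z < r then g z - c * (1 + z\<^sup>2 * wp_reg z) ^ Suc m else 0)"
  have ballL: "ball 0 r \<subseteq> - (L - {0})" using sub D(2) by auto
  have "(\<lambda>z. g z - c * (1 + z\<^sup>2 * wp_reg z) ^ Suc m) holomorphic_on ball 0 r"
    by (intro holomorphic_intros g holomorphic_on_subset[OF wp_reg_holomorphic ballL])
  then have hol_k: "k holomorphic_on ball 0 r"
    by (rule holomorphic_transform) (simp add: k_def)
  have even_k: "k (- z) = k z" for z
  proof (cases "z \<in> ball 0 r - {0}")
    case True
    then have "- z \<in> ball 0 r - {0}" by simp
    then show ?thesis
      using True g(2) f(4)[of z] r(2)[of z] by (simp add: k_def h_def wp_reg_even)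
  qed (auto simp: k_def)
  have "\<exists>c. ((\<lambda>z. k z / z\<^sup>2) \<longlongrightarrow> c) (at 0)"
    by (rule even_quotient_limit[OF hol_k open_ball _ even_k]) (use r(1) in \<open>auto simp: k_def c_def\<close>)
  then obtain c' where c': "((\<lambda>z. k z / z\<^sup>2) \<longlongrightarrow> c') (at 0)" by blast
  have "\<forall>\<^sub>F z in at 0. norm (k z / z\<^sup>2) < norm c' + 1"
    using order_tendstoD(2)[OF tendsto_norm[OF c']] by simp
  moreover have "\<forall>\<^sub>F z in at 0. z \<in> ball 0 r - {0 :: complex}"
    using r(1) by (intro eventually_at_in_open) auto
  ultimately have bd1: "\<forall>\<^sub>F z in at 0. norm (z ^ (2 * m) * f1 z) \<le> norm c' + 1"
  proof eventually_elim
    case (elim z)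
    have "k z = z ^ (2 * Suc m) * f z - c * (z\<^sup>2 * wp z) ^ Suc m"
      using elim g(2)[of z] by (simp add: k_def h_def wp_eq[of z] distrib_left)
    also have "\<dots> = z\<^sup>2 * (z ^ (2 * m) * f1 z)"
      by (simp add: f1_def power_mult_distrib power_mult power2_eq_square algebra_simps)
    finally have "k z / z\<^sup>2 = z ^ (2 * m) * f1 z" using elim by simp
    then show ?case using elim by simp
  qed
  have wpD: "wp holomorphic_on - D" using D(2) by (intro holomorphic_on_subset[OF wp_holomorphic]) auto
  have "\<exists>p. \<forall>z. z \<notin> D \<longrightarrow> f1 z = poly p (wp z)"
  proof (rule Suc.IH)
    show "f1 holomorphic_on - D" unfolding f1_def by (intro holomorphic_intros f(1) wpD)
    show "\<exists>B. \<forall>\<^sub>F z in at p. z \<notin> D \<and> norm (f1 z) \<le> B" if p: "p \<in> D - L" for p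
    proof -
      obtain B where B: "\<forall>\<^sub>F z in at p. z \<notin> D \<and> norm (f z) \<le> B" using f(2)[OF p] by blast
      have "((\<lambda>z. c * wp z ^ Suc m) \<longlongrightarrow> c * wp p ^ Suc m) (at p)"
        using isCont_wp[of p] p by (intro tendsto_intros) (auto simp: isCont_def)
      from order_tendstoD(2)[OF tendsto_norm[OF this], of "norm (c * wp p ^ Suc m) + 1"]
      have "\<forall>\<^sub>F z in at p. norm (c * wp z ^ Suc m) < norm (c * wp p ^ Suc m) + 1" by simp
      with B have "\<forall>\<^sub>F z in at p. z \<notin> D \<and> norm (f1 z) \<le> B + (norm (c * wp p ^ Suc m) + 1)"
      proof eventually_elim
        case (elim z)
        then show ?case unfolding f1_def
          using norm_triangle_ineq4[of "f z" "c * wp z ^ Suc m"] by linarith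
      qed
      then show ?thesis by blast
    qed
    show "z + l \<notin> D \<and> f1 (z + l) = f1 z" if "z \<notin> D" "l \<in> L" for z l
    proof -
      have "z \<notin> L" using that(1) D(2) by auto
      from wp_periodic[OF this that(2)] show ?thesis using f(3)[OF that] by (simp add: f1_def)
    qed
    show "f1 (- z) = f1 z" if "z \<notin> D" for z
      using f(4)[OF that] by (simp add: f1_def wp_even)
    show "\<exists>B. \<forall>\<^sub>F z in at 0. norm (z ^ (2 * m) * f1 z) \<le> B" using bd1 by blast
  qed
  then obtain p where p: "\<And>z. z \<notin> D \<Longrightarrow> f1 z = poly p (wp z)" by blast
  have "f z = poly (p + monom c (Suc m)) (wp z)" if "z \<notin> D" for z
    using p[OF that] by (simp add: f1_def poly_monom algebra_simps)
  then show ?case by blast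
qed

text \<open>The factors \<open>(wp z - wp \<kappa>)\<^sup>2\<close> cancel the double poles of \<open>wp (\<mu> z)\<close> outside the lattice.\<close>

lemma wp_mult_rational:
  assumes \<mu>: "\<And>l. l \<in> L \<Longrightarrow> \<mu> * l \<in> L" and \<nu>: "\<And>l. l \<in> L \<Longrightarrow> \<nu> * l \<in> L"
    and n: "\<nu> * \<mu> = of_int n" "n \<noteq> 0"
  obtains f g where "g \<noteq> 0"
    "\<And>z. z \<notin> L \<Longrightarrow> poly g (wp z) \<noteq> 0 \<Longrightarrow> \<mu> * z \<notin> L \<and> wp (\<mu> * z) * poly g (wp z) = poly f (wp z)"
proof -
  have \<mu>0: "\<mu> \<noteq> 0" using n by auto
  define D where "D = {z. \<mu> * z \<in> L}"
  have D_eq: "- D = (\<lambda>z. \<mu> * z) -` (- L)" by (auto simp: D_def)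
  have openD: "open (- D)" unfolding D_eq by (intro open_vimage open_Compl_lattice continuous_intros)
  have LD: "L \<subseteq> D" using \<mu> by (auto simp: D_def)
  have filt: "filterlim (\<lambda>z. \<mu> * (z - p)) (at 0) (at p)" for p
  proof -
    have "((\<lambda>z. \<mu> * (z - p)) \<longlongrightarrow> 0) (at p)" by (auto intro!: tendsto_eq_intros)
    then show ?thesis using \<mu>0 by (auto simp: filterlim_at eventually_at_filter)
  qed
  have evD: "\<forall>\<^sub>F z in at p. z \<notin> D" if "p \<in> D" for p
  proof -
    have "\<forall>\<^sub>F z in at p. \<mu> * (z - p) \<notin> L"
      using filterlim_iff[THEN iffD1, OF filt] eventually_at_0_notin_lattice by blast
    then show ?thesis
      by (rule eventually_mono) (use that diff_in_lattice in \<open>auto simp: D_def right_diff_distrib\<close>)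
  qed
  \<comment> \<open>Since \<open>\<nu> * \<mu> = of_int n\<close>, every point of \<open>D\<close>
    becomes a lattice point when multiplied by \<open>n\<close>. Modulo \<open>L\<close> there
    remain at most the points with both numerators reduced modulo
    \<open>\<bar>n\<bar>\<close>.\<close>
  define pt where "pt = (\<lambda>(i, j). (of_int i + of_int j * \<tau>) / of_int n :: complex)"
  define K where "K = pt ` ({0..<\<bar>n\<bar>} \<times> {0..<\<bar>n\<bar>}) \<inter> D - L"
  have finK: "finite K" unfolding K_def by auto
  have cover: "\<exists>\<kappa>\<in>K. p - \<kappa> \<in> L" if p: "p \<in> D - L" for p
  proof -
    have "of_int n * p \<in> L"
      using \<nu>[of "\<mu> * p"] p n by (simp add: D_def flip: mult.assoc)
    then obtain i j where ij: "of_int n * p = of_int i + of_int j * \<tau>" by (rule latticeE)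
    define \<kappa> where "\<kappa> = pt (i mod \<bar>n\<bar>, j mod \<bar>n\<bar>)"
    have i: "of_int i = of_int (i mod \<bar>n\<bar>) + (of_int (sgn n) * of_int n) * (of_int (i div \<bar>n\<bar>) :: complex)" for i
    proof -
      have "i = i mod \<bar>n\<bar> + (sgn n * n) * (i div \<bar>n\<bar>)"
        by (metis abs_sgn mod_mult_div_eq mult.commute)
      then show ?thesis by (metis of_int_add of_int_mult)
    qed
    have "p = (of_int i + of_int j * \<tau>) / of_int n" using ij n by (simp add: field_simps)
    also have "\<dots> = \<kappa> + of_int (sgn n) * (of_int (i div \<bar>n\<bar>) + of_int (j div \<bar>n\<bar>) * \<tau>)"
      unfolding i[of i] i[of j] \<kappa>_def pt_def using n(2) by (simp add: field_simps)
    finally have pk: "p - \<kappa> \<in> L" using of_int_mult_in_lattice lattice_intro by simp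
    moreover have "\<kappa> \<in> D"
      using p \<mu>[OF pk] diff_in_lattice[of "\<mu> * p" "\<mu> * (p - \<kappa>)"] by (simp add: D_def right_diff_distrib)
    moreover have "\<kappa> \<notin> L" using p add_in_lattice[OF pk, of \<kappa>] by auto
    ultimately show ?thesis using n(2) by (auto simp: K_def \<kappa>_def)
  qed
  define g where "g = (\<Prod>\<kappa>\<in>K. [:- wp \<kappa>, 1:]\<^sup>2)"
  have g0: "g \<noteq> 0" using finK by (auto simp: g_def)
  have poly_g: "poly g x = (\<Prod>\<kappa>\<in>K. (x - wp \<kappa>)\<^sup>2)" for x
    by (simp add: g_def poly_prod)
  define f where "f = (\<lambda>z. wp (\<mu> * z) * poly g (wp z))"
  have lim1: "((\<lambda>z. (\<mu> * (z - p))\<^sup>2 * wp (\<mu> * (z - p))) \<longlongrightarrow> 1) (at p)" for p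
    using filterlim_compose[OF square_times_wp_limit filt] .
  have per: "z + l \<notin> D \<and> f (z + l) = f z" if "z \<notin> D" "l \<in> L" for z l
  proof -
    have "\<mu> * z + \<mu> * l \<notin> L" using that \<mu> add_in_lattice_iff by (simp add: D_def)
    moreover have "wp (\<mu> * z + \<mu> * l) = wp (\<mu> * z)" using that \<mu> by (intro wp_periodic) (auto simp: D_def)
    moreover have "wp (z + l) = wp z" using that LD by (intro wp_periodic) auto
    ultimately show ?thesis by (simp add: f_def D_def distrib_left)
  qed
  have bd: "\<exists>B. \<forall>\<^sub>F z in at p. z \<notin> D \<and> norm (f z) \<le> B" if p: "p \<in> D - L" for p
  proof -
    obtain \<kappa> where \<kappa>: "\<kappa> \<in> K" "p - \<kappa> \<in> L" using cover[OF p] by blast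
    have wpk: "wp \<kappa> = wp p" using wp_periodic[of \<kappa> "p - \<kappa>"] \<kappa> by (simp add: K_def)
    let ?F = "\<lambda>z. ((\<mu> * (z - p))\<^sup>2 * wp (\<mu> * (z - p))) / \<mu>\<^sup>2 * ((wp z - wp p) / (z - p))\<^sup>2 * (\<Prod>\<kappa>\<in>K - {\<kappa>}. (wp z - wp \<kappa>)\<^sup>2)"
    have "(wp \<longlongrightarrow> wp p) (at p)" using isCont_wp[of p] p by (simp add: isCont_def)
    moreover have "((\<lambda>z. (wp z - wp p) / (z - p)) \<longlongrightarrow> wp' p) (at p)"
      using wp_has_derivative[of p] p by (simp add: has_field_derivative_iff)
    ultimately have "(?F \<longlongrightarrow> 1 / \<mu>\<^sup>2 * (wp' p)\<^sup>2 * (\<Prod>\<kappa>\<in>K - {\<kappa>}. (wp p - wp \<kappa>)\<^sup>2)) (at p)"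
      using \<mu>0 by (intro tendsto_intros lim1) auto
    from order_tendstoD(2)[OF tendsto_norm[OF this] less_add_one]
    have "\<forall>\<^sub>F z in at p. norm (?F z) < norm (1 / \<mu>\<^sup>2 * (wp' p)\<^sup>2 * (\<Prod>\<kappa>\<in>K - {\<kappa>}. (wp p - wp \<kappa>)\<^sup>2)) + 1" .
    moreover have "\<forall>\<^sub>F z in at p. z \<notin> D" using evD p by blast
    ultimately have "\<forall>\<^sub>F z in at p. z \<notin> D \<and> norm (f z) \<le> norm (1 / \<mu>\<^sup>2 * (wp' p)\<^sup>2 * (\<Prod>\<kappa>\<in>K - {\<kappa>}. (wp p - wp \<kappa>)\<^sup>2)) + 1"
      using eventually_neq_at_within[of p p UNIV]
    proof eventually_elim
      case (elim z)
      have "wp (\<mu> * z) = wp (\<mu> * (z - p))"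
        using wp_periodic[of "\<mu> * (z - p)" "\<mu> * p"] elim p diff_in_lattice add_in_lattice_iff[of "\<mu> * p" "\<mu> * (z - p)"]
        by (simp add: D_def right_diff_distrib)
      moreover have "poly g (wp z) = (wp z - wp p)\<^sup>2 * (\<Prod>\<kappa>\<in>K - {\<kappa>}. (wp z - wp \<kappa>)\<^sup>2)"
        unfolding poly_g by (subst prod.remove[OF finK \<kappa>(1)]) (simp add: wpk)
      moreover have "(\<mu> * (z - p))\<^sup>2 * w / \<mu>\<^sup>2 * ((wp z - wp p) / (z - p))\<^sup>2 = w * (wp z - wp p)\<^sup>2" for w
        using \<mu>0 elim by (simp add: power_mult_distrib power_divide)
      ultimately have "f z = ?F z" by (simp only: f_def mult.assoc)
      then show ?case using elim by simp
    qed
    then show ?thesis by blast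
  qed
  have hol: "f holomorphic_on - D"
  proof -
    have "(\<lambda>z. wp (\<mu> * z)) holomorphic_on - D"
      by (rule holomorphic_on_compose_gen[OF _ wp_holomorphic, unfolded o_def])
         (auto simp: D_def intro!: holomorphic_intros)
    moreover have "wp holomorphic_on - D" using LD by (intro holomorphic_on_subset[OF wp_holomorphic]) auto
    ultimately show ?thesis unfolding f_def poly_g by (intro holomorphic_intros)
  qed
  \<comment> \<open>At 0 each factor \<open>(wp z - wp \<kappa>)\<^sup>2\<close> has a pole of order
    4 and \<open>wp (\<mu> * z)\<close> one of order 2, in total \<open>2 * m\<close>.\<close>
  define m where "m = 2 * card K + 1"
  have bd0: "\<exists>B. \<forall>\<^sub>F z in at 0. norm (z ^ (2 * m) * f z) \<le> B"
  proof -
    let ?F = "\<lambda>z. ((\<mu> * (z - 0))\<^sup>2 * wp (\<mu> * (z - 0))) / \<mu>\<^sup>2 * (\<Prod>\<kappa>\<in>K. (z\<^sup>2 * wp z - z\<^sup>2 * wp \<kappa>)\<^sup>2)"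
    have "(?F \<longlongrightarrow> 1 / \<mu>\<^sup>2 * (\<Prod>\<kappa>\<in>K. (1 - 0\<^sup>2 * wp \<kappa>)\<^sup>2)) (at 0)"
      using \<mu>0 by (intro tendsto_intros lim1 square_times_wp_limit) auto
    from order_tendstoD(2)[OF tendsto_norm[OF this] less_add_one]
    have "\<forall>\<^sub>F z in at 0. norm (?F z) < norm (1 / \<mu>\<^sup>2 * (\<Prod>\<kappa>\<in>K. (1 - 0\<^sup>2 * wp \<kappa>)\<^sup>2)) + 1" .
    moreover have "?F z = z ^ (2 * m) * f z" for z
    proof -
      have "(\<Prod>\<kappa>\<in>K. (z\<^sup>2 * wp z - z\<^sup>2 * wp \<kappa>)\<^sup>2) = (\<Prod>\<kappa>\<in>K. (z\<^sup>2)\<^sup>2 * (wp z - wp \<kappa>)\<^sup>2)"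
        by (intro prod.cong refl) (simp flip: right_diff_distrib add: power_mult_distrib)
      also have "\<dots> = z ^ (4 * card K) * poly g (wp z)"
        by (simp add: prod.distrib poly_g flip: power_mult)
      finally have p: "(\<Prod>\<kappa>\<in>K. (z\<^sup>2 * wp z - z\<^sup>2 * wp \<kappa>)\<^sup>2) = z ^ (4 * card K) * poly g (wp z)" .
      have "z ^ (2 * m) = z\<^sup>2 * z ^ (4 * card K)" by (simp add: m_def flip: power_add)
      then show ?thesis unfolding p f_def using \<mu>0 by (simp add: power_mult_distrib)
    qed
    ultimately have ev: "\<forall>\<^sub>F z in at 0. norm (z ^ (2 * m) * f z) < norm (1 / \<mu>\<^sup>2 * (\<Prod>\<kappa>\<in>K. (1 - 0\<^sup>2 * wp \<kappa>)\<^sup>2)) + 1"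
      by (simp only:)
    show ?thesis by (rule exI, rule eventually_mono[OF ev], rule less_imp_le)
  qed
  have "\<exists>p. \<forall>z. z \<notin> D \<longrightarrow> f z = poly p (wp z)"
  proof (rule even_elliptic_eq_poly[OF openD LD _ _ hol bd per _ bd0])
    show "- z \<in> D \<longleftrightarrow> z \<in> D" for z by (simp add: D_def uminus_in_lattice_iff)
    show "\<forall>\<^sub>F z in at 0. z \<notin> D" using evD zero_in_lattice by (auto simp: D_def)
    show "f (- z) = f z" for z by (simp add: f_def wp_even)
  qed
  then obtain p where p: "\<And>z. z \<notin> D \<Longrightarrow> f z = poly p (wp z)" by blast
  show ?thesis
  proof (rule that[OF g0])
    fix z assume z: "z \<notin> L" "poly g (wp z) \<noteq> 0"
    have "z \<notin> D"
    proof
      assume "z \<in> D"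
      then obtain \<kappa> where \<kappa>: "\<kappa> \<in> K" "z - \<kappa> \<in> L" using cover[of z] z(1) by blast
      then have "wp \<kappa> = wp z" using wp_periodic[of \<kappa> "z - \<kappa>"] by (simp add: K_def)
      then show False using z(2) \<kappa>(1) finK by (auto simp: poly_g)
    qed
    then show "\<mu> * z \<notin> L \<and> wp (\<mu> * z) * poly g (wp z) = poly p (wp z)"
      using p[of z] by (simp add: D_def f_def)
  qed
qed

end

section \<open>Weierstrass equations over a valuation ring\<close>

context valuation_ring
begin

definition unit :: "'a \<Rightarrow> bool" where
  "unit u \<longleftrightarrow> u \<in> V \<and> u \<notin> M"

lemma unit_one_minus_M: "m \<in> M \<Longrightarrow> unit (1 - m)"
  using M_add[of "1 - m" m] M_one M_imp_V[of m] one_mem diff_mem by (auto simp: unit_def)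

lemma unit_imp_nonzero: "unit u \<Longrightarrow> u \<noteq> 0"
  using unit_nonzero by (auto simp: unit_def)

lemma unit_divide_unit: "unit u \<Longrightarrow> unit v \<Longrightarrow> unit (u / v)"
proof -
  assume u: "unit u" and v: "unit v"
  have "u / v \<notin> M"
    using M_mult[of "u / v" v] u v unit_imp_nonzero[OF v] by (auto simp: unit_def)
  then show ?thesis using u v unit_divide by (auto simp: unit_def)
qed

lemma unit_divide_mem: "x \<in> V \<Longrightarrow> unit u \<Longrightarrow> x / u \<in> V"
  using unit_divide by (auto simp: unit_def)

lemma unit_mult_unit: "unit u \<Longrightarrow> unit v \<Longrightarrow> unit (u * v)"
  using unit_mult mult_mem by (auto simp: unit_def)

text \<open>Up to a unit, the content of the linear polynomial \<open>X - x\<close>: whichever of 1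
  and \<open>x\<close> is larger in absolute value.\<close>

definition big :: "'a \<Rightarrow> 'a" where
  "big x = (if x \<in> V then 1 else x)"

lemma big_nonzero: "big x \<noteq> 0"
  using zero_mem by (auto simp: big_def)

lemma inverse_big_mem: "1 / big x \<in> V"
  using inverse_mem[of x] one_mem by (auto simp: big_def divide_inverse)

lemma divide_big_mem: "x / big x \<in> V"
  using one_mem zero_mem by (auto simp: big_def)

text \<open>Gauss's lemma for the quadratic polynomial with roots \<open>s\<close> and \<open>t\<close>.\<close>

lemma unit_big_times_big:
  assumes "d / a \<in> V" "d * (s + t) / a \<in> V" "d * (s * t) / a \<in> V"
    and "\<not> (d / a \<in> M \<and> d * (s + t) / a \<in> M \<and> d * (s * t) / a \<in> M)"
  shows "unit (d * (big s * big t) / a)"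
proof -
  have main: "unit (d * (big s * big t) / a)"
    if a: "d / a \<in> V" "d * (s + t) / a \<in> V" "d * (s * t) / a \<in> V"
      "\<not> (d / a \<in> M \<and> d * (s + t) / a \<in> M \<and> d * (s * t) / a \<in> M)" and st: "t \<notin> V \<longrightarrow> s \<notin> V" for s t
  proof -
    consider "s \<in> V" "t \<in> V" | "s \<notin> V" "t \<in> V" | "s \<notin> V" "t \<notin> V" using st by blast
    then show ?thesis
    proof cases
      case 1
      have "d * (s + t) / a = d / a * (s + t)" "d * (s * t) / a = d / a * (s * t)" by simp_all
      then have "d / a \<notin> M" using a(4) M_mult 1 add_mem mult_mem by metis
      then show ?thesis using a(1) 1 by (simp add: big_def unit_def)
    next
      case 2
      have s: "s \<noteq> 0" "1 / s \<in> M" using 2 zero_mem inverse_in_M' by auto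
      have u: "unit (1 - - (t * (1 / s)))"
        using M_mult'[OF 2(2) s(2)] by (intro unit_one_minus_M M_uminus)
      have st_eq: "s + t = s * (1 - - (t * (1 / s)))" using s(1) by (simp add: field_simps)
      then have "d * s / a = d * (s + t) / a / (1 - - (t * (1 / s)))"
        using unit_imp_nonzero[OF u] by simp
      then have V: "d * s / a \<in> V" using unit_divide_mem[OF a(2) u] by simp
      have "d * s / a \<notin> M"
      proof
        assume *: "d * s / a \<in> M"
        have "d / a = d * s / a * (1 / s)" "d * (s * t) / a = d * s / a * t"
          using s(1) by (simp_all add: field_simps)
        moreover have "d * (s + t) / a = d * s / a * (1 - - (t * (1 / s)))"
          by (subst st_eq) (simp only: times_divide_eq_left mult.assoc)
        ultimately show False using a(4) M_mult[OF *] M_imp_V[OF s(2)] 2(2) u unfolding unit_def by metis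
      qed
      with V show ?thesis using 2 by (simp add: big_def unit_def)
    next
      case 3
      have s: "s \<noteq> 0" "1 / s \<in> M" and t: "t \<noteq> 0" "1 / t \<in> M" using 3 zero_mem inverse_in_M' by auto
      have "d * (s * t) / a \<notin> M"
      proof
        assume *: "d * (s * t) / a \<in> M"
        have st_eq: "s + t = s * t * (1 / s + 1 / t)" using s(1) t(1) by (simp add: field_simps)
        have "d * (s + t) / a = d * (s * t) / a * (1 / s + 1 / t)"
          by (subst st_eq) (simp only: times_divide_eq_left mult.assoc)
        moreover have "d / a = d * (s * t) / a * (1 / s * (1 / t))"
          using s(1) t(1) by simp
        moreover have "1 / s * (1 / t) \<in> V" "1 / s + 1 / t \<in> V"
          by (intro V_intros M_imp_V s(2) t(2))+
        ultimately show False using a(4) M_mult[OF *] * by metis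
      qed
      then show ?thesis using 3 a(3) by (simp add: big_def unit_def)
    qed
  qed
  show ?thesis
  proof (cases "t \<notin> V \<longrightarrow> s \<notin> V")
    case True
    then show ?thesis using main[OF assms] by blast
  next
    case False
    then show ?thesis using main[of t s] assms by (auto simp: add.commute mult.commute)
  qed
qed

end

text \<open>The \<open>x\<close>-coordinate of a Weierstrass equation
  \<open>y\<^sup>2 + a1 x y + a3 y = x\<^sup>3 + a2 x\<^sup>2 + a4 x + a6\<close> with the usual quantities \<open>b2, b4, b6, b8\<close>,
  as a function on the complex plane.\<close>

locale elliptic_model =
  fixes \<Lambda> :: "complex set" and x :: "complex \<Rightarrow> complex" and b2 b4 b6 b8 :: complex
  assumes zero_lattice: "0 \<in> \<Lambda>"
    and add_lattice: "v \<in> \<Lambda> \<Longrightarrow> w \<in> \<Lambda> \<Longrightarrow> v + w \<in> \<Lambda>"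
    and uminus_lattice: "v \<in> \<Lambda> \<Longrightarrow> - v \<in> \<Lambda>"
    and x_even: "x (- z) = x z"
    and x_periodic: "z \<notin> \<Lambda> \<Longrightarrow> v \<in> \<Lambda> \<Longrightarrow> x (z + v) = x z"
    and x_surj: "\<exists>z. z \<notin> \<Lambda> \<and> x z = c"
    and x_inj: "z \<notin> \<Lambda> \<Longrightarrow> w \<notin> \<Lambda> \<Longrightarrow> z + w \<notin> \<Lambda> \<Longrightarrow> z - w \<notin> \<Lambda> \<Longrightarrow> x z \<noteq> x w"
    and x_sum: "z \<notin> \<Lambda> \<Longrightarrow> w \<notin> \<Lambda> \<Longrightarrow> z + w \<notin> \<Lambda> \<Longrightarrow> z - w \<notin> \<Lambda> \<Longrightarrow>
      (x z - x w)\<^sup>2 * (x (z + w) + x (z - w)) =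
      2 * x z * x w * (x z + x w) + b2 * x z * x w + b4 * (x z + x w) + b6"
    and x_prod: "z \<notin> \<Lambda> \<Longrightarrow> w \<notin> \<Lambda> \<Longrightarrow> z + w \<notin> \<Lambda> \<Longrightarrow> z - w \<notin> \<Lambda> \<Longrightarrow>
      (x z - x w)\<^sup>2 * (x (z + w) * x (z - w)) =
      (x z * x w)\<^sup>2 - b4 * x z * x w - b6 * (x z + x w) - b8"
    and x_double: "z \<notin> \<Lambda> \<Longrightarrow> 2 * z \<notin> \<Lambda> \<Longrightarrow>
      x (2 * z) * (4 * x z ^ 3 + b2 * (x z)\<^sup>2 + 2 * b4 * x z + b6) =
      x z ^ 4 - b4 * (x z)\<^sup>2 - 2 * b6 * x z - b8"
    and x_half_period: "z \<notin> \<Lambda> \<Longrightarrow> 2 * z \<in> \<Lambda> \<Longrightarrow> 4 * x z ^ 3 + b2 * (x z)\<^sup>2 + 2 * b4 * x z + b6 = 0"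
begin

lemma diff_lattice: "v \<in> \<Lambda> \<Longrightarrow> w \<in> \<Lambda> \<Longrightarrow> v - w \<in> \<Lambda>"
  using add_lattice[of v "- w"] uminus_lattice by simp

lemma add_lattice_iff: "v \<in> \<Lambda> \<Longrightarrow> z + v \<in> \<Lambda> \<longleftrightarrow> z \<in> \<Lambda>"
  using add_lattice[of z v] diff_lattice[of "z + v" v] by auto

lemma uminus_lattice_iff: "- v \<in> \<Lambda> \<longleftrightarrow> v \<in> \<Lambda>"
  using uminus_lattice[of v] uminus_lattice[of "- v"] by auto

text \<open>\<open>r\<close> is a coordinate of the \<open>x\<close>-line around the origin of the curve; it is meaningless at the
  zeros of \<open>x\<close>, which \<open>proper\<close> excludes.\<close>

definition proper :: "complex \<Rightarrow> bool" where
  "proper z \<longleftrightarrow> z \<in> \<Lambda> \<or> x z \<noteq> 0"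

definition r :: "complex \<Rightarrow> complex" where
  "r z = (if z \<in> \<Lambda> then 0 else 1 / x z)"

lemma r_even: "r (- z) = r z" and proper_uminus: "proper (- z) = proper z"
  by (simp_all add: r_def proper_def x_even uminus_lattice_iff)

lemma r_periodic: "v \<in> \<Lambda> \<Longrightarrow> r (z + v) = r z" and proper_periodic: "v \<in> \<Lambda> \<Longrightarrow> proper (z + v) = proper z"
  by (auto simp: r_def proper_def x_periodic add_lattice_iff)

lemma r_diff_commute: "r (z - w) = r (w - z)" and proper_diff_commute: "proper (z - w) = proper (w - z)"
  using r_even[of "z - w"] proper_uminus[of "z - w"] by simp_all

text \<open>\<open>Q\<close> and \<open>S\<close> are the right-hand sides of \<open>x_prod\<close>
  and \<open>x_sum\<close> divided by \<open>(x z * x w)\<^sup>2\<close> and written in the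
  reciprocals of \<open>x z\<close> and \<open>x w\<close>. In these coordinates \<open>Q\<close>
  becomes the common denominator.\<close>

definition Q :: "complex \<Rightarrow> complex \<Rightarrow> complex" where
  "Q s t = 1 - b4 * (s * t) - b6 * (s * t * (s + t)) - b8 * (s * t)\<^sup>2"

definition S :: "complex \<Rightarrow> complex \<Rightarrow> complex" where
  "S s t = 2 * (s + t) + b2 * (s * t) + b4 * (s * t * (s + t)) + b6 * (s * t)\<^sup>2"

text \<open>In the coordinate \<open>r\<close> the formulas extend to the origin, and to
  \<open>z\<close> equal to \<open>w\<close> or \<open>- w\<close> modulo the lattice, where the
  duplication formula takes over. A nonzero \<open>Q\<close> keeps \<open>z + w\<close> and
  \<open>z - w\<close> away from the zeros of \<open>x\<close>.\<close>

lemma r_add: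
  assumes "proper z" "proper w" "Q (r z) (r w) \<noteq> 0"
  shows "proper (z + w) \<and> proper (z - w) \<and>
    Q (r z) (r w) * (r (z + w) + r (z - w)) = S (r z) (r w) \<and>
    Q (r z) (r w) * (r (z + w) * r (z - w)) = (r z - r w)\<^sup>2"
proof -
  have double: "proper (z + w) \<and> proper (z - w) \<and>
      Q (r z) (r w) * (r (z + w) + r (z - w)) = S (r z) (r w) \<and>
      Q (r z) (r w) * (r (z + w) * r (z - w)) = (r z - r w)\<^sup>2"
    if zw: "z - w \<in> \<Lambda>" "z \<notin> \<Lambda>" and "proper z" "Q (r z) (r w) \<noteq> 0" for z w
  proof -
    have rw: "r w = r z" using r_periodic[of "z - w" w] zw by simp
    have "z + w + (z - w) \<in> \<Lambda> \<longleftrightarrow> z + w \<in> \<Lambda>" by (rule add_lattice_iff[OF zw(1)])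
    then have m: "2 * z \<in> \<Lambda> \<longleftrightarrow> z + w \<in> \<Lambda>" by simp
    have rp: "r (z + w) = r (2 * z)" "proper (z + w) = proper (2 * z)"
      using r_periodic[OF zw(1), of "z + w"] proper_periodic[OF zw(1), of "z + w"] by simp_all
    define c where "c = x z"
    have c0: "c \<noteq> 0" using that by (simp add: c_def proper_def)
    have rz: "r z = 1 / c" using zw by (simp add: r_def c_def)
    have ring: "Q i i * c ^ 4 = c ^ 4 - b4 * c\<^sup>2 * (c * i)\<^sup>2 - 2 * b6 * c * (c * i) ^ 3 - b8 * (c * i) ^ 4"
      "S i i * c ^ 4 = 4 * c ^ 3 * (c * i) + b2 * c\<^sup>2 * (c * i)\<^sup>2 + 2 * b4 * c * (c * i) ^ 3 + b6 * (c * i) ^ 4" for i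
      by (simp_all add: Q_def S_def power2_eq_square power3_eq_cube power4_eq_xxxx algebra_simps)
    have Q: "Q (1 / c) (1 / c) * c ^ 4 = c ^ 4 - b4 * c\<^sup>2 - 2 * b6 * c - b8"
      and S: "S (1 / c) (1 / c) * c ^ 4 = 4 * c ^ 3 + b2 * c\<^sup>2 + 2 * b4 * c + b6"
      using c0 unfolding ring by simp_all
    have "proper (2 * z) \<and> Q (1 / c) (1 / c) * r (2 * z) = S (1 / c) (1 / c)"
    proof (cases "2 * z \<in> \<Lambda>")
      case True
      then have "S (1 / c) (1 / c) * c ^ 4 = 0" using x_half_period[OF zw(2)] S by (simp add: c_def)
      then show ?thesis using True c0 by (simp add: proper_def r_def)
    next
      case False
      have *: "x (2 * z) * (S (1 / c) (1 / c) * c ^ 4) = Q (1 / c) (1 / c) * c ^ 4"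
        unfolding Q S using x_double[OF zw(2) False] by (simp add: c_def)
      then have "x (2 * z) \<noteq> 0" using that(4) c0 rw rz by auto
      then show ?thesis using * c0 False by (simp add: proper_def r_def field_simps)
    qed
    then show ?thesis
      using rp zw(1) rw rz by (simp add: r_def[of "z - w"] proper_def[of "z - w"])
  qed
  consider "z \<in> \<Lambda>" | "w \<in> \<Lambda>" | "z \<notin> \<Lambda>" "z - w \<in> \<Lambda>" | "z \<notin> \<Lambda>" "z + w \<in> \<Lambda>"
    | "z \<notin> \<Lambda>" "w \<notin> \<Lambda>" "z + w \<notin> \<Lambda>" "z - w \<notin> \<Lambda>" by blast
  then show ?thesis
  proof cases
    case 1
    have "r (w - z) = r w" "proper (w - z) = proper w" "r (w + z) = r w" "proper (w + z) = proper w"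
      using r_periodic[of "- z" w] proper_periodic[of "- z" w] r_periodic[of z w] proper_periodic[of z w] 1 uminus_lattice
      by simp_all
    then show ?thesis using 1 assms(2) r_diff_commute[of z w] proper_diff_commute[of z w]
      by (simp add: r_def[of z] Q_def S_def power2_eq_square add.commute)
  next
    case 2
    have "r (z - w) = r z" "proper (z - w) = proper z" "r (z + w) = r z" "proper (z + w) = proper z"
      using r_periodic[of "- w" z] proper_periodic[of "- w" z] r_periodic[of w z] proper_periodic[of w z] 2 uminus_lattice
      by simp_all
    then show ?thesis using 2 assms(1)
      by (simp add: r_def[of w] Q_def S_def power2_eq_square)
  next
    case 3
    then show ?thesis using double assms by blast
  next
    case 4
    then show ?thesis using double[of z "- w"] assms(1,3)
      by (simp add: r_even add.commute[of "r (z - w)"] mult.commute[of "r (z - w)"] conj_commute)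
  next
    case 5
    define c d u v where "c = x z" and "d = x w" and "u = x (z + w)" and "v = x (z - w)"
    have cd: "c \<noteq> 0" "d \<noteq> 0" using assms 5 by (simp_all add: proper_def c_def d_def)
    have ne: "c \<noteq> d" using x_inj 5 by (simp add: c_def d_def)
    have rr: "r z = 1 / c" "r w = 1 / d" "r (z + w) = 1 / u" "r (z - w) = 1 / v"
      using 5 by (simp_all add: r_def c_def d_def u_def v_def)
    have ring: "Q i j * (c * d)\<^sup>2 = (c * d)\<^sup>2 - b4 * (c * i) * (d * j) * c * d
        - b6 * (c * i) * (d * j) * (d * (c * i) + c * (d * j)) - b8 * (c * i)\<^sup>2 * (d * j)\<^sup>2"
      "S i j * (c * d)\<^sup>2 = 2 * c * d * (d * (c * i) + c * (d * j)) + b2 * (c * i) * (d * j) * c * d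
        + b4 * (c * i) * (d * j) * (d * (c * i) + c * (d * j)) + b6 * (c * i)\<^sup>2 * (d * j)\<^sup>2" for i j
      by (simp_all add: Q_def S_def power2_eq_square algebra_simps)
    have Q: "Q (1 / c) (1 / d) * (c * d)\<^sup>2 = (c - d)\<^sup>2 * (u * v)"
      and S: "S (1 / c) (1 / d) * (c * d)\<^sup>2 = (c - d)\<^sup>2 * (u + v)"
      using cd x_prod[OF 5] x_sum[OF 5] unfolding ring c_def[symmetric] d_def[symmetric] u_def[symmetric] v_def[symmetric]
      by (simp_all add: algebra_simps)
    have uv: "u \<noteq> 0" "v \<noteq> 0"
      using Q assms(3) cd unfolding rr by auto
    have 1: "(Q (1 / c) (1 / d) * (1 / u + 1 / v)) * (c * d)\<^sup>2 = S (1 / c) (1 / d) * (c * d)\<^sup>2"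
    proof -
      have "(Q (1 / c) (1 / d) * (1 / u + 1 / v)) * (c * d)\<^sup>2 = (Q (1 / c) (1 / d) * (c * d)\<^sup>2) * (1 / u + 1 / v)"
        by simp
      also have "\<dots> = (c - d)\<^sup>2 * (u + v)" unfolding Q using uv by (simp add: field_simps)
      finally show ?thesis using S by simp
    qed
    have 2: "(Q (1 / c) (1 / d) * (1 / u * (1 / v))) * (c * d)\<^sup>2 = (1 / c - 1 / d)\<^sup>2 * (c * d)\<^sup>2"
    proof -
      have "(Q (1 / c) (1 / d) * (1 / u * (1 / v))) * (c * d)\<^sup>2 = (Q (1 / c) (1 / d) * (c * d)\<^sup>2) * (1 / u * (1 / v))"
        by simp
      also have "\<dots> = (c - d)\<^sup>2" unfolding Q using uv by simp
      also have "\<dots> = (1 / c - 1 / d)\<^sup>2 * (c * d)\<^sup>2"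
        using cd by (simp add: power_mult_distrib[symmetric] left_diff_distrib power2_commute)
      finally show ?thesis .
    qed
    have "proper (z + w)" "proper (z - w)" using uv by (auto simp: proper_def u_def v_def)
    moreover have "(c * d)\<^sup>2 \<noteq> 0" using cd by simp
    note mult_right_cancel[OF this, THEN iffD1, OF 1] mult_right_cancel[OF this, THEN iffD1, OF 2]
    ultimately show ?thesis unfolding rr by blast
  qed
qed

end

section \<open>The kernel of reduction of an integral equation\<close>

locale integral_model = alg_closed_valuation_ring V + elliptic_model \<Lambda> x b2 b4 b6 b8
  for V :: "complex set" and \<Lambda> x b2 b4 b6 b8 +
  assumes b_mem: "b2 \<in> V" "b4 \<in> V" "b6 \<in> V" "b8 \<in> V"
begin

lemma proper_notin_V: "x z \<notin> V \<Longrightarrow> proper z \<and> r z \<in> M"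
  using zero_mem inverse_in_M' M_zero by (auto simp: proper_def r_def)

lemma Q_minus_1_in_M: "s \<in> M \<Longrightarrow> t \<in> V \<Longrightarrow> 1 - Q s t \<in> M"
proof -
  assume s: "s \<in> M" and t: "t \<in> V"
  have "1 - Q s t = s * (b4 * t + b6 * (t * (s + t)) + b8 * (s * t * t))"
    by (simp add: Q_def power2_eq_square algebra_simps)
  moreover have "b4 * t + b6 * (t * (s + t)) + b8 * (s * t * t) \<in> V"
    using b_mem t M_imp_V[OF s] by (intro V_intros)
  ultimately show ?thesis using M_mult[OF s] by simp
qed

lemma Q_unit: "s \<in> M \<Longrightarrow> t \<in> V \<Longrightarrow> unit (Q s t)"
  using unit_one_minus_M[OF Q_minus_1_in_M] by simp

text \<open>The kernel of reduction is filtered by the valuation of the reciprocal coordinate, and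
  addition is additive to first order.\<close>

lemma r_add_kernel:
  assumes "proper z" "proper w" "r z \<in> M" "r z \<noteq> 0" "r w / r z \<in> V"
  shows "proper (z + w)" "proper (z - w)" "r (z + w) / r z \<in> V" "r (z - w) / r z \<in> V"
    "r (z + w) / r z + r (z - w) / r z - 2 * (1 + r w / r z) \<in> M"
proof -
  define s t c where "s = r z" and "t = r w" and "c = r w / r z"
  have s: "s \<in> M" "s \<noteq> 0" "s \<in> V" using assms M_imp_V by (simp_all add: s_def)
  have t: "t = c * s" using assms by (simp add: t_def c_def s_def)
  have c: "c \<in> V" using assms by (simp add: c_def)
  have tV: "t \<in> V" unfolding t using c s by (intro mult_mem)
  have q: "unit (Q s t)" by (rule Q_unit[OF s(1) tV])
  then have q0: "Q s t \<noteq> 0" by (rule unit_imp_nonzero)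
  note add = r_add[OF assms(1,2), folded s_def t_def, OF q0]
  show "proper (z + w)" "proper (z - w)" using add by auto
  define a b where "a = r (z + w) / s" and "b = r (z - w) / s"
  define m where "m = s * (b2 * c + b4 * (c * (s + t)) + b6 * (c * (s * t)))"
  have m: "m \<in> M" unfolding m_def
    using s c tV b_mem by (intro M_mult V_intros) 
  have "Q s t * (a + b) = Q s t * (r (z + w) + r (z - w)) / s"
    by (simp add: a_def b_def add_divide_distrib distrib_left)
  also have "\<dots> = S s t / s" using add by simp
  also have "\<dots> = 2 * (1 + c) + m"
    using s(2) by (simp add: S_def m_def t power2_eq_square field_simps)
  finally have sum: "Q s t * (a + b) = 2 * (1 + c) + m" .
  have "Q s t * (a * b) = Q s t * (r (z + w) * r (z - w)) / s\<^sup>2"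
    by (simp add: a_def b_def power2_eq_square)
  also have "\<dots> = (s - t)\<^sup>2 / s\<^sup>2" using add by simp
  also have "\<dots> = (1 - c)\<^sup>2" using s(2) by (simp add: t power_divide[symmetric] diff_divide_distrib)
  finally have prod: "Q s t * (a * b) = (1 - c)\<^sup>2" .
  have ab: "a + b \<in> V"
  proof -
    have "a + b = (2 * (1 + c) + m) / Q s t" using sum q0 by (simp add: field_simps)
    also have "\<dots> \<in> V" by (intro unit_divide_mem q V_intros c M_imp_V[OF m])
    finally show ?thesis .
  qed
  have ab': "a * b \<in> V"
  proof -
    have "a * b = (1 - c)\<^sup>2 / Q s t" using prod q0 by (simp add: field_simps)
    also have "\<dots> \<in> V" by (intro unit_divide_mem q V_intros c)
    finally show ?thesis .
  qed
  show "r (z + w) / r z \<in> V" "r (z - w) / r z \<in> V"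
    using sum_prod_mem[OF ab ab'] by (simp_all add: a_def b_def s_def)
  have "a + b - 2 * (1 + c) = (1 - Q s t) * (a + b) + m"
    using sum by (simp add: left_diff_distrib)
  then have "a + b - 2 * (1 + c) \<in> M"
    using M_add[OF M_mult[OF Q_minus_1_in_M[OF s(1) tV] ab] m] by simp
  then show "r (z + w) / r z + r (z - w) / r z - 2 * (1 + r w / r z) \<in> M"
    by (simp add: a_def b_def s_def c_def)
qed

text \<open>To first order \<open>r\<close> is the square of a formal parameter. The squares satisfy
  the recurrence given by \<open>r_add_kernel\<close>; as it has order two, the induction carries
  two consecutive multiples.\<close>

lemma r_multiple_kernel:
  assumes "x z \<notin> V" "z \<notin> \<Lambda>"
  shows "proper (of_nat n * z) \<and> r (of_nat n * z) / r z \<in> V \<and> r (of_nat n * z) / r z - (of_nat n)\<^sup>2 \<in> M"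
proof -
  have z: "proper z" "r z \<in> M" "r z \<noteq> 0"
    using proper_notin_V[OF assms(1)] assms(2) by (auto simp: r_def proper_def)
  let ?P = "\<lambda>n. proper (of_nat n * z) \<and> r (of_nat n * z) / r z \<in> V \<and> r (of_nat n * z) / r z - (of_nat n)\<^sup>2 \<in> M"
  have "?P n \<and> ?P (Suc n)"
  proof (induction n)
    case 0
    show ?case using z zero_lattice zero_mem one_mem M_zero by (simp add: proper_def r_def)
  next
    case (Suc n)
    define c where "c = r (of_nat (Suc n) * z) / r z"
    have e: "z + of_nat (Suc n) * z = of_nat (Suc (Suc n)) * z" "z - of_nat (Suc n) * z = - (of_nat n * z)"
      by (simp_all add: algebra_simps)
    have 1: "proper (of_nat (Suc n) * z)" "r (of_nat (Suc n) * z) / r z \<in> V" using Suc by blast+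
    note add = r_add_kernel[OF z(1) 1(1) z(2,3) 1(2), unfolded e r_even]
    define a b where "a = r (of_nat (Suc (Suc n)) * z) / r z" and "b = r (of_nat n * z) / r z"
    have h: "a + b - 2 * (1 + c) \<in> M" "b - (of_nat n)\<^sup>2 \<in> M" "c - (of_nat (Suc n))\<^sup>2 \<in> M"
      using add(5) Suc unfolding a_def b_def c_def by blast+
    have "a - (of_nat (Suc (Suc n)))\<^sup>2 = (a + b - 2 * (1 + c)) - (b - (of_nat n)\<^sup>2) + 2 * (c - (of_nat (Suc n))\<^sup>2)"
      by (simp add: power2_eq_square algebra_simps)
    also have "\<dots> \<in> M" using M_add[OF M_diff[OF h(1,2)] M_mult'[OF numeral_mem h(3)]] .
    finally show ?case using add(1,3) Suc unfolding a_def by blast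
  qed
  then show ?thesis by blast
qed

text \<open>The multiple has \<open>r\<close>-value 0, so \<open>n\<^sup>2\<close> must lie in
  \<open>M\<close>: the kernel of reduction has no torsion of order prime to the residue
  characteristic.\<close>

lemma order_in_M:
  assumes "x z \<notin> V" "z \<notin> \<Lambda>" "of_nat n * z \<in> \<Lambda>"
  shows "of_nat n \<in> M"
proof -
  have "r (of_nat n * z) / r z - (of_nat n)\<^sup>2 \<in> M" using r_multiple_kernel[OF assms(1,2)] by blast
  then have "(of_nat n)\<^sup>2 \<in> M" using assms(3) M_uminus by (force simp: r_def)
  then show ?thesis using M_prime_power of_nat_mem by blast
qed

text \<open>The local contribution of a point: 1 outside the kernel of reduction, and inside it an
  element that grows with the depth.\<close>

definition e :: "complex \<Rightarrow> complex" where
  "e z = big (x z)"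

lemma e_even: "e (- z) = e z"
  by (simp add: e_def x_even)

lemma e_periodic: "z \<notin> \<Lambda> \<Longrightarrow> v \<in> \<Lambda> \<Longrightarrow> e (z + v) = e z"
  by (simp add: e_def x_periodic)

lemma e_nonzero: "e z \<noteq> 0"
  by (simp add: e_def big_nonzero)

text \<open>A multiple of a point of the kernel of reduction lies at least as deep, and a point
  outside the kernel has the smallest contribution.\<close>

lemma e_multiple_nat:
  assumes "z \<notin> \<Lambda>" "of_nat n * z \<notin> \<Lambda>"
  shows "e z / e (of_nat n * z) \<in> V"
proof (cases "x z \<in> V")
  case True
  then show ?thesis using inverse_big_mem by (simp add: e_def big_def[of "x z"])
next
  case False
  have "proper (of_nat n * z) \<and> r (of_nat n * z) / r z \<in> V"
    using r_multiple_kernel[OF False assms(1)] by blast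
  moreover have "x z \<noteq> 0" using False zero_mem by auto
  ultimately have xx: "x z / x (of_nat n * z) \<in> V" and nz: "x (of_nat n * z) \<noteq> 0"
    using assms by (auto simp: r_def proper_def)
  show ?thesis
  proof (cases "x (of_nat n * z) \<in> V")
    case True
    then have "x z / x (of_nat n * z) * x (of_nat n * z) \<in> V" using xx mult_mem by blast
    then show ?thesis using False nz by simp
  qed (use xx False in \<open>simp add: e_def big_def\<close>)
qed

lemma e_multiple:
  assumes "z \<notin> \<Lambda>" "of_int n * z \<notin> \<Lambda>"
  shows "e z / e (of_int n * z) \<in> V"
proof (cases "n \<ge> 0")
  case True
  then show ?thesis using e_multiple_nat[of z "nat n"] assms by simp
next
  case False
  then have "of_nat (nat (- n)) * z = - (of_int n * z)" by simp
  then show ?thesis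
    using e_multiple_nat[of z "nat (- n)"] assms by (simp add: e_even uminus_lattice_iff)
qed

end

section \<open>Good reduction and the valuation of differences of coordinates\<close>

locale good_model = integral_model +
  assumes b8_eq: "4 * b8 = b2 * b6 - b4\<^sup>2"
    and discriminant_unit: "- b2\<^sup>2 * b8 - 8 * b4 ^ 3 - 27 * b6\<^sup>2 + 9 * b2 * b4 * b6 \<notin> M"
begin

text \<open>A Bezout identity between numerator and denominator of the duplication formula, with the
  discriminant as its value. It holds up to a multiple of the relation \<open>b8_eq\<close>.\<close>

lemma duplication_coprime:
  assumes "c \<in> V" "4 * c ^ 3 + b2 * c\<^sup>2 + 2 * b4 * c + b6 \<in> M" "c ^ 4 - b4 * c\<^sup>2 - 2 * b6 * c - b8 \<in> M"
  shows False
proof -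
  have "(12 * c ^ 3 - b2 * c\<^sup>2 - 10 * b4 * c + b2 * b4 - 27 * b6) * (4 * c ^ 3 + b2 * c\<^sup>2 + 2 * b4 * c + b6)
      - (48 * c\<^sup>2 + 8 * b2 * c + 32 * b4 - b2\<^sup>2) * (c ^ 4 - b4 * c\<^sup>2 - 2 * b6 * c - b8)
    = - b2\<^sup>2 * b8 - 8 * b4 ^ 3 - 27 * b6\<^sup>2 + 9 * b2 * b4 * b6
      + (12 * c\<^sup>2 + 2 * b2 * c + 8 * b4) * (4 * b8 - (b2 * b6 - b4\<^sup>2))"
    by (simp add: power2_eq_square power3_eq_cube power4_eq_xxxx algebra_simps)
  then have "(12 * c ^ 3 - b2 * c\<^sup>2 - 10 * b4 * c + b2 * b4 - 27 * b6) * (4 * c ^ 3 + b2 * c\<^sup>2 + 2 * b4 * c + b6)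
      - (48 * c\<^sup>2 + 8 * b2 * c + 32 * b4 - b2\<^sup>2) * (c ^ 4 - b4 * c\<^sup>2 - 2 * b6 * c - b8)
    = - b2\<^sup>2 * b8 - 8 * b4 ^ 3 - 27 * b6\<^sup>2 + 9 * b2 * b4 * b6"
    using b8_eq by simp
  moreover have "(12 * c ^ 3 - b2 * c\<^sup>2 - 10 * b4 * c + b2 * b4 - 27 * b6) * (4 * c ^ 3 + b2 * c\<^sup>2 + 2 * b4 * c + b6)
      - (48 * c\<^sup>2 + 8 * b2 * c + 32 * b4 - b2\<^sup>2) * (c ^ 4 - b4 * c\<^sup>2 - 2 * b6 * c - b8) \<in> M"
    by (rule M_diff[OF M_mult'[OF _ assms(2)] M_mult'[OF _ assms(3)]]) (intro V_intros assms b_mem)+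
  ultimately show False using discriminant_unit by simp
qed

text \<open>At a place of good reduction, the valuation of \<open>x z - x w\<close> only depends on the local
  contributions of \<open>z\<close>, \<open>w\<close>, \<open>z + w\<close> and \<open>z - w\<close>.\<close>

lemma difference_formula:
  assumes zw: "z \<notin> \<Lambda>" "w \<notin> \<Lambda>" "z + w \<notin> \<Lambda>" "z - w \<notin> \<Lambda>"
  shows "unit ((x z - x w)\<^sup>2 * (e (z + w) * e (z - w)) / ((e z)\<^sup>2 * (e w)\<^sup>2))"
proof -
  define c d where "c = x z" and "d = x w"
  define A where "A = (big c)\<^sup>2 * (big d)\<^sup>2"
  \<comment> \<open>Primitive homogeneous coordinates of the points \<open>c\<close> and
    \<open>d\<close> of the projective line; in each pair one entry is 1.\<close>
  define c' c'' d' d'' where "c' = c / big c" and "c'' = 1 / big c" and "d' = d / big d" and "d'' = 1 / big d"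
  have V: "c' \<in> V" "c'' \<in> V" "d' \<in> V" "d'' \<in> V"
    by (simp_all add: c'_def c''_def d'_def d''_def divide_big_mem inverse_big_mem)
  have bc: "c = c' * big c" "1 = c'' * big c" "d = d' * big d" "1 = d'' * big d"
    using big_nonzero by (simp_all add: c'_def c''_def d'_def d''_def)
  have D: "(c - d)\<^sup>2 / A = (c' * d'' - c'' * d')\<^sup>2"
    using big_nonzero by (simp add: A_def c'_def c''_def d'_def d''_def power2_eq_square field_simps)
  have Sm: "(c - d)\<^sup>2 * (x (z + w) + x (z - w)) / A =
      2 * c' * d' * (c' * d'' + c'' * d') + b2 * c' * c'' * d' * d'' + b4 * (c' * d'' + c'' * d') * (c'' * d'') + b6 * (c'' * d'')\<^sup>2"
    using x_sum[OF zw] big_nonzero unfolding c_def[symmetric] d_def[symmetric]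
    by (simp add: A_def c'_def c''_def d'_def d''_def power2_eq_square field_simps)
  have Pr: "(c - d)\<^sup>2 * (x (z + w) * x (z - w)) / A =
      (c' * d')\<^sup>2 - b4 * c' * c'' * d' * d'' - b6 * (c' * d'' + c'' * d') * (c'' * d'') - b8 * (c'' * d'')\<^sup>2"
    using x_prod[OF zw] big_nonzero unfolding c_def[symmetric] d_def[symmetric]
    by (simp add: A_def c'_def c''_def d'_def d''_def power2_eq_square field_simps)
  have "unit ((c - d)\<^sup>2 * (big (x (z + w)) * big (x (z - w))) / A)"
  proof (rule unit_big_times_big)
    show "(c - d)\<^sup>2 / A \<in> V" "(c - d)\<^sup>2 * (x (z + w) + x (z - w)) / A \<in> V"
      "(c - d)\<^sup>2 * (x (z + w) * x (z - w)) / A \<in> V"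
      unfolding D Sm Pr by (intro V_intros V b_mem)+
    show "\<not> ((c - d)\<^sup>2 / A \<in> M \<and> (c - d)\<^sup>2 * (x (z + w) + x (z - w)) / A \<in> M \<and>
        (c - d)\<^sup>2 * (x (z + w) * x (z - w)) / A \<in> M)"
    proof
      assume asm: "(c - d)\<^sup>2 / A \<in> M \<and> (c - d)\<^sup>2 * (x (z + w) + x (z - w)) / A \<in> M \<and>
        (c - d)\<^sup>2 * (x (z + w) * x (z - w)) / A \<in> M"
      have D': "c' * d'' - c'' * d' \<in> M"
        using asm M_prime_power[of "c' * d'' - c'' * d'" 2] V unfolding D by (auto intro: V_intros)
      consider "c \<notin> V" "d \<notin> V" | "c \<notin> V" "d \<in> V" | "c \<in> V" "d \<notin> V" | "c \<in> V" "d \<in> V" by blast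
      then show False
      proof cases
        case 1
        then have c: "c' = 1" "d' = 1" "c'' \<in> M" "d'' \<in> M"
          using zero_mem inverse_in_M' by (auto simp: c'_def d'_def c''_def d''_def big_def)
        have "(c' * d')\<^sup>2 - b4 * c' * c'' * d' * d'' - b6 * (c' * d'' + c'' * d') * (c'' * d'') - b8 * (c'' * d'')\<^sup>2 =
           1 - c'' * (b4 * d'' + b6 * (d'' + c'') * d'' + b8 * (c'' * (d'' * d'')))"
          by (simp add: c power2_eq_square algebra_simps)
        moreover have "c'' * (b4 * d'' + b6 * (d'' + c'') * d'' + b8 * (c'' * (d'' * d''))) \<in> M"
          using c(3) V b_mem by (intro M_mult V_intros)
        ultimately have "unit ((c - d)\<^sup>2 * (x (z + w) * x (z - w)) / A)"
          unfolding Pr using unit_one_minus_M by simp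
        then show False using asm by (simp add: unit_def)
      next
        case 2
        then have "c' = 1" "d'' = 1" "c'' \<in> M"
          using zero_mem inverse_in_M' by (auto simp: c'_def d''_def c''_def big_def)
        then have "unit (c' * d'' - c'' * d')" using unit_one_minus_M[OF M_mult] V by simp
        then show False using D' by (simp add: unit_def)
      next
        case 3
        then have "d' = 1" "c'' = 1" "d'' \<in> M"
          using zero_mem inverse_in_M' by (auto simp: d'_def d''_def c''_def big_def)
        then have "unit (1 - c' * d'')" using unit_one_minus_M[OF M_mult'] V by simp
        moreover have "1 - c' * d'' \<in> M" using M_uminus[OF D'] \<open>d' = 1\<close> \<open>c'' = 1\<close> by simp
        ultimately show False by (simp add: unit_def)
      next
        case 4
        then have eqs: "c' = c" "d' = d" "c'' = 1" "d'' = 1" by (simp_all add: c'_def d'_def c''_def d''_def big_def)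
        have cd: "c - d \<in> M" using D' by (simp add: eqs)
        have S': "2 * c * d * (c + d) + b2 * c * d + b4 * (c + d) + b6 \<in> M"
          and P': "(c * d)\<^sup>2 - b4 * c * d - b6 * (c + d) - b8 \<in> M"
          using asm unfolding Sm Pr by (simp_all add: eqs)
        \<comment> \<open>Since \<open>c\<close> and \<open>d\<close> are congruent, replacing
          \<open>d\<close> by \<open>c\<close> turns the sum and product formulas into the two
          duplication polynomials, which cannot both lie in \<open>M\<close>.\<close>
        have eq1: "4 * c ^ 3 + b2 * c\<^sup>2 + 2 * b4 * c + b6 =
            2 * c * d * (c + d) + b2 * c * d + b4 * (c + d) + b6 + (c - d) * (2 * c * (2 * c + d) + b2 * c + b4)"
          by (simp add: power2_eq_square power3_eq_cube algebra_simps)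
        have 1: "4 * c ^ 3 + b2 * c\<^sup>2 + 2 * b4 * c + b6 \<in> M"
          unfolding eq1 by (rule M_add[OF S' M_mult[OF cd]]) (intro V_intros 4 b_mem)
        have eq2: "c ^ 4 - b4 * c\<^sup>2 - 2 * b6 * c - b8 =
            (c * d)\<^sup>2 - b4 * c * d - b6 * (c + d) - b8 + (c - d) * (c\<^sup>2 * (c + d) - b4 * c - b6)"
          by (simp add: power2_eq_square power4_eq_xxxx algebra_simps)
        have 2: "c ^ 4 - b4 * c\<^sup>2 - 2 * b6 * c - b8 \<in> M"
          unfolding eq2 by (rule M_add[OF P' M_mult[OF cd]]) (intro V_intros 4 b_mem)
        show False by (rule duplication_coprime[OF 4(1) 1 2])
      qed
    qed
  qed
  then show ?thesis by (simp add: e_def A_def c_def d_def)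
qed

text \<open>With \<open>e n\<close> the local contribution at \<open>n P\<close>, the square of the ratio is, up to a unit,
  \<open>(e k / e 2)\<^sup>2 * (e 3 * e 1) / (e (k + 1) * e (k - 1))\<close>. Points of order prime to \<open>N / n\<close> have
  equal contributions, and points whose order is not a prime power have contribution 1.\<close>

lemma ratio_mem:
  fixes N k :: int
  assumes N: "N > 6" and k: "3 \<le> k" "2 * k < N"
    and cond: "gcd k N = 1 \<or> (gcd (gcd k N) 3 = 1 \<and> \<not> primepow (N div gcd k N))"
    and P: "\<And>n. of_int n * P \<in> \<Lambda> \<longleftrightarrow> N dvd n"
  shows "(x (of_int k * P) - x P) / (x (2 * P) - x P) \<in> V"
proof -
  define E where "E n = e (of_int n * P)" for n
  have notL: "of_int n * P \<notin> \<Lambda>" if "0 < n" "n < N" for n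
    using that zdvd_imp_le[of N n] P by auto
  have E0: "E n \<noteq> 0" for n by (simp add: E_def e_nonzero)
  have inv_E: "1 / E n \<in> V" for n by (simp add: E_def e_def inverse_big_mem)
  have mult: "E m / E n \<in> V" if "m dvd n" "0 < m" "m < N" "\<not> N dvd n" for m n
  proof -
    from that(1) obtain d where d: "n = m * d" by (elim dvdE)
    have eq: "of_int d * (of_int m * P) = of_int n * P" by (simp add: d)
    show ?thesis
      using e_multiple[OF notL[OF that(2,3)], of d, unfolded eq] that(4) P by (simp add: E_def)
  qed
  have coprime: "E n / E 1 \<in> V" if "coprime n N" "0 < n" "n < N" for n
  proof -
    \<comment> \<open>With \<open>d\<close> inverse to \<open>n\<close> modulo \<open>N\<close>, the
      point \<open>P\<close> is itself a multiple of \<open>n P\<close>, so its contribution is at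
      least that of \<open>n P\<close>.\<close>
    obtain d v where "d * n + v * N = 1"
      using bezout_int[of n N] \<open>coprime n N\<close> by (auto simp: coprime_iff_gcd_eq_1)
    then have l: "n * d = 1 + N * (- v)" by (simp add: algebra_simps)
    have NP: "of_int (N * (- v)) * P \<in> \<Lambda>" using P[of "N * (- v)"] by simp
    have "of_int (n * d) * P = P + of_int (N * (- v)) * P" unfolding l by (simp add: algebra_simps)
    then have "E (n * d) = e (P + of_int (N * (- v)) * P)" by (simp only: E_def)
    also have "\<dots> = E 1" using e_periodic[OF _ NP, of P] notL[of 1] N by (simp add: E_def)
    finally have "E (n * d) = E 1" .
    moreover have "\<not> N dvd n * d"
    proof
      assume "N dvd n * d"
      then have "N dvd 1" unfolding l by (simp add: dvd_diff_left_iff)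
      then show False using N by simp
    qed
    ultimately show ?thesis using mult[of n "n * d"] that by simp
  qed
  have one: "E 1 / E n \<in> V" if "0 < n" "n < N" for n
    using mult[of 1 n] that N zdvd_imp_le[of N n] by auto
  have ndvd: "\<not> N dvd n" if "0 < n" "n < N" for n using that zdvd_imp_le[of N n] by auto
  have "E k / E 2 \<in> V"
  proof (cases "gcd k N = 1")
    case True
    then have "E k / E 1 * (E 1 / E 2) \<in> V"
      using coprime[of k] one[of 2] k N by (intro mult_mem) (auto simp: coprime_iff_gcd_eq_1)
    then show ?thesis using E0 by simp
  next
    case False
    define \<delta> where "\<delta> = gcd k N"
    have \<delta>: "\<delta> > 0" "\<delta> dvd N" "\<delta> dvd k" "\<not> primepow (N div \<delta>)"
      using False cond k by (auto simp: \<delta>_def)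
    have "x (of_int k * P) \<in> V"
    proof (rule ccontr)
      assume notV: "x (of_int k * P) \<notin> V"
      define m where "m = N div \<delta>"
      have m: "N = \<delta> * m" using \<delta>(2) by (simp add: m_def)
      have "\<delta> \<le> k" using \<delta>(3) k by (intro zdvd_imp_le) auto
      then have m1: "m > 1" using m k N \<delta>(1) by (smt (verit, ccfv_SIG) mult_le_cancel_left1 mult_left_le mult_less_cancel_left1)
      obtain c where c: "k = \<delta> * c" using \<delta>(3) by auto
      have "coprime c m"
      proof -
        have "\<bar>\<delta>\<bar> * gcd c m = \<delta>"
          using gcd_mult_distrib_int[of \<delta> c m] unfolding c[symmetric] m[symmetric] \<delta>_def[symmetric] .
        then show ?thesis using \<delta>(1) by (simp add: coprime_iff_gcd_eq_1)
      qed
      have order: "of_int (n * k) * P \<in> \<Lambda> \<longleftrightarrow> m dvd n" for n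
      proof -
        have "N dvd n * k \<longleftrightarrow> \<delta> * m dvd \<delta> * (n * c)" by (simp add: m c mult_ac)
        also have "\<dots> \<longleftrightarrow> m dvd n * c" using \<delta>(1) by simp
        also have "\<dots> \<longleftrightarrow> m dvd n"
          using \<open>coprime c m\<close> by (simp add: coprime_commute coprime_dvd_mult_left_iff)
        finally show ?thesis by (simp only: P)
      qed
      \<comment> \<open>The multiple \<open>m2 * k\<close> of \<open>P\<close> is nonzero, is killed
        by \<open>m1\<close> and stays in the kernel of reduction. Two coprime factors of
        \<open>m\<close> will thus put 1 into \<open>M\<close>.\<close>
      have factor: "of_int m1 \<in> M" if "m = m1 * m2" "m1 > 1" "m2 > 0" for m1 m2
      proof -
        let ?B = "of_int (m2 * k) * P"
        have "\<not> m dvd m2"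
          using that zdvd_imp_le[of m m2] by auto
        then have B: "?B \<notin> \<Lambda>" using order by blast
        have "m dvd m1 * m2" using that by simp
        then have "of_int (m1 * m2 * k) * P \<in> \<Lambda>" using order by blast
        then have B': "of_nat (nat m1) * ?B \<in> \<Lambda>" using that by (simp add: mult_ac)
        have "x ?B \<notin> V"
        proof
          assume "x ?B \<in> V"
          then have "E (m2 * k) = 1" by (simp add: E_def e_def big_def)
          moreover have "E k / E (m2 * k) \<in> V" using mult[of k "m2 * k"] k B[unfolded P] by simp
          moreover have "E k = x (of_int k * P)" using notV by (simp add: E_def e_def big_def)
          ultimately show False using notV by simp
        qed
        from order_in_M[OF this B B'] show ?thesis using that by simp
      qed
      obtain p where p: "Factorial_Ring.prime p" "p dvd m" using m1 prime_factor_int[of m] by auto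
      define a where "a = multiplicity p m"
      obtain m2 where m2: "m = p ^ a * m2" "\<not> p dvd m2"
        using multiplicity_decompose'[of m p] m1 p prime_gt_1_int[OF p(1)] by (auto simp: a_def)
      have a: "a > 0"
        using prime_multiplicity_gt_zero_iff[OF prime_imp_prime_elem[OF p(1)], of m] p(2) m1 by (simp add: a_def)
      have pa: "p ^ a > 1" using p a prime_gt_1_int by (simp add: one_less_power)
      have "m2 > 0" using m2(1) m1 pa by (smt (verit) mult_nonneg_nonpos)
      moreover have "m2 \<noteq> 1"
      proof
        assume "m2 = 1"
        then have "m = p ^ a" using m2(1) by simp
        then have "primepow m" unfolding primepow_def using p(1) a by blast
        then show False using \<delta>(4) by (simp add: m_def)
      qed
      ultimately have m2': "m2 > 1" by simp
      have "of_int (p ^ a) \<in> M" "of_int m2 \<in> M"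
        using factor[of "p ^ a" m2] factor[of m2 "p ^ a"] m2(1) m2' pa by (simp_all add: mult.commute)
      moreover have "coprime (p ^ a) m2"
        using p(1) m2(2) by (simp add: prime_imp_coprime)
      then obtain u v where "u * p ^ a + v * m2 = 1"
        using bezout_int[of "p ^ a" m2] by (auto simp: coprime_iff_gcd_eq_1)
      then have "(1 :: complex) = of_int u * of_int (p ^ a) + of_int v * of_int m2"
        by (metis of_int_1 of_int_add of_int_mult)
      ultimately show False using M_one M_add M_mult' of_int_mem by metis
    qed
    then have "E k = 1" by (simp add: E_def e_def big_def)
    then show ?thesis using inv_E by simp
  qed
  then have k2: "(E k / E 2)\<^sup>2 \<in> V" by (rule power_mem)
  have k31: "E 3 * E 1 / (E (k + 1) * E (k - 1)) \<in> V"
  proof (cases "3 dvd N")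
    case False
    then have "coprime 3 N" by (simp add: prime_imp_coprime)
    then have "E 3 / E 1 * (E 1 / E (k + 1)) * (E 1 / E (k - 1)) \<in> V"
      using coprime[of 3] one[of "k + 1"] one[of "k - 1"] k N by (intro mult_mem) auto
    then show ?thesis using E0 by simp
  next
    case True
    have "\<not> 3 dvd k"
    proof
      assume "3 dvd k"
      then have "3 dvd gcd (gcd k N) 3" using True by (intro gcd_greatest) auto
      moreover have "gcd (gcd k N) 3 = 1" using cond
      proof
        assume "gcd k N = 1"
        then show ?thesis by (simp only:) simp
      qed blast
      ultimately have "3 dvd (1 :: int)" by (simp only:)
      then show False by simp
    qed
    \<comment> \<open>One of the two points in the denominator is therefore a multiple of
      \<open>3 P\<close> and lies at least as deep as \<open>3 P\<close>.\<close>
    then have "3 dvd k + 1 \<or> 3 dvd k - 1" by presburger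
    then show ?thesis
    proof
      assume "3 dvd k + 1"
      then have "E 3 / E (k + 1) * (E 1 / E (k - 1)) \<in> V"
        using mult[of 3 "k + 1"] one[of "k - 1"] k N ndvd[of "k + 1"] by (intro mult_mem) auto
      then show ?thesis by simp
    next
      assume "3 dvd k - 1"
      then have "E 3 / E (k - 1) * (E 1 / E (k + 1)) \<in> V"
        using mult[of 3 "k - 1"] one[of "k + 1"] k N ndvd[of "k - 1"] by (intro mult_mem) auto
      then show ?thesis by (simp add: mult.commute)
    qed
  qed
  define d where "d n = (x (of_int n * P) - x P)\<^sup>2" for n
  have diff: "\<exists>u. unit u \<and> d n * (E (n + 1) * E (n - 1)) = u * ((E n)\<^sup>2 * (E 1)\<^sup>2)" if "2 \<le> n" "n + 1 < N" for n
  proof -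
    have e: "of_int n * P + P = of_int (n + 1) * P" "of_int n * P - P = of_int (n - 1) * P"
      by (simp_all add: algebra_simps)
    have "unit (d n * (E (n + 1) * E (n - 1)) / ((E n)\<^sup>2 * (E 1)\<^sup>2))"
      using difference_formula[of "of_int n * P" P, unfolded e] notL[of n] notL[of 1] notL[of "n + 1"] notL[of "n - 1"] that
      by (simp add: d_def E_def)
    then show ?thesis using E0 by (intro exI[of _ "d n * (E (n + 1) * E (n - 1)) / ((E n)\<^sup>2 * (E 1)\<^sup>2)"]) simp
  qed
  obtain u where u: "unit u" "d k * (E (k + 1) * E (k - 1)) = u * ((E k)\<^sup>2 * (E 1)\<^sup>2)" using diff[of k] k by auto
  obtain v where v: "unit v" "d 2 * (E 3 * E 1) = v * ((E 2)\<^sup>2 * (E 1)\<^sup>2)" using diff[of 2] N by auto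
  have v0: "v \<noteq> 0" using v(1) by (rule unit_imp_nonzero)
  have "d k / d 2 = u / v * ((E k / E 2)\<^sup>2 * (E 3 * E 1 / (E (k + 1) * E (k - 1))))"
  proof -
    have "d k = u * ((E k)\<^sup>2 * (E 1)\<^sup>2) / (E (k + 1) * E (k - 1))" "d 2 = v * ((E 2)\<^sup>2 * (E 1)\<^sup>2) / (E 3 * E 1)"
      using u(2) v(2) E0 by (simp_all add: field_simps)
    then show ?thesis using E0 v0 by (simp add: power_divide)
  qed
  also have "\<dots> \<in> V"
    using unit_divide_unit[OF u(1) v(1)] k2 k31 by (intro mult_mem) (auto simp: unit_def)
  finally have "((x (of_int k * P) - x P) / (x (of_int 2 * P) - x P))\<^sup>2 \<in> V"
    by (simp add: d_def power_divide)
  then show ?thesis using square_mem by simp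
qed

end

section \<open>Complex multiplication and nodal reduction\<close>

text \<open>Such an \<open>m\<close> has a prime factor \<open>p\<close> that is 3 modulo 4. If -1
  were a square modulo \<open>p\<close>, raising it to the odd power \<open>(p - 1) / 2\<close>
  would contradict Fermat's theorem.\<close>

lemma square_plus_one_not_dvd:
  fixes m y :: int
  assumes "m mod 4 = 3" "m > 0"
  shows "\<not> m dvd y\<^sup>2 + 1"
proof
  assume dvd: "m dvd y\<^sup>2 + 1"
  have "\<exists>p. Factorial_Ring.prime p \<and> p dvd m \<and> p mod 4 = 3"
    using assms
  proof (induction "nat m" arbitrary: m rule: less_induct)
    case less
    have "m \<noteq> 1" using less.prems by auto
    then obtain p where p: "Factorial_Ring.prime p" "p dvd m"
      using prime_factor_int[of m] less.prems by auto
    have p1: "p > 1" using p(1) prime_gt_1_int by blast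
    obtain c where c: "m = p * c" using p(2) by auto
    show ?case
    proof (cases "p mod 4 = 3")
      case False
      have odd: "odd m" using less.prems by presburger
      then have "odd p" using c by auto
      then have "p mod 4 = 1" using False by presburger
      then have "m mod 4 = c mod 4" using c by (metis mod_mult_left_eq mult_1)
      then have c3: "c mod 4 = 3" using less.prems by simp
      have c0: "c > 0" using c less.prems p1 by (simp add: zero_less_mult_iff)
      have "c < m" using c p1 c0 by simp
      then have "nat c < nat m" using c0 by simp
      from less.hyps[OF this c3 c0] show ?thesis using c by (metis dvd_mult)
    qed (use p in auto)
  qed
  then obtain p where p: "Factorial_Ring.prime p" "p dvd m" "p mod 4 = 3" by blast
  have py: "p dvd y\<^sup>2 + 1" using p(2) dvd by (rule dvd_trans)
  have p1: "p > 1" using p(1) prime_gt_1_int by blast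
  have ndvd: "\<not> p dvd y"
  proof
    assume "p dvd y"
    then have "p dvd y\<^sup>2" by (simp add: power2_eq_square)
    then have "p dvd 1" using py by (metis dvd_add_right_iff)
    then show False using p1 by simp
  qed
  define q where "q = nat p"
  have q: "Factorial_Ring.prime q" "int q = p" using p(1) p1 by (simp_all add: q_def)
  have "\<not> q dvd nat \<bar>y\<bar>" using ndvd q by (metis dvd_abs_iff int_dvd_int_iff int_nat_eq abs_ge_zero)
  from fermat_theorem[OF q(1) this] have "[int (nat \<bar>y\<bar>) ^ (q - 1) = 1] (mod p)"
    using q(2) by (metis cong_int_iff of_nat_1 of_nat_power)
  then have fer: "[\<bar>y\<bar> ^ (q - 1) = 1] (mod p)" by simp
  define k where "k = (q - 3) div 4"
  have "q mod 4 = 3" using p(3) q(2) by presburger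
  then have k: "q - 1 = 2 * (2 * k + 1)" unfolding k_def by presburger
  have "[y\<^sup>2 = - 1] (mod p)" using py by (simp add: cong_iff_dvd_diff)
  then have "[(y\<^sup>2) ^ (2 * k + 1) = (- 1) ^ (2 * k + 1)] (mod p)" by (rule cong_pow)
  moreover have "\<bar>y\<bar> ^ (q - 1) = (y\<^sup>2) ^ (2 * k + 1)" unfolding k power_mult by simp
  ultimately have "[1 = - 1] (mod p)" using fer by (simp add: cong_def)
  then have "p dvd 2" by (simp add: cong_iff_dvd_diff)
  then have "p \<le> 2" by (rule zdvd_imp_le) simp
  then show False using p1 p(3) by auto
qed

context alg_closed_valuation_ring
begin

text \<open>For \<open>\<eta> \<noteq> 1\<close> the geometric sum of its powers vanishes, although
  each summand is congruent to 1 and the sum therefore to \<open>m\<close>.\<close>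

lemma root_of_unity_cong_1:
  assumes "\<eta> ^ m = 1" "\<eta> - 1 \<in> M" "of_nat m \<notin> M"
  shows "\<eta> = 1"
proof (rule ccontr)
  assume ne: "\<eta> \<noteq> 1"
  have eV: "\<eta> \<in> V" using add_mem[OF M_imp_V[OF assms(2)] one_mem] by simp
  have pow: "\<eta> ^ i - 1 \<in> M" for i
  proof (induction i)
    case (Suc i)
    have eq: "\<eta> ^ Suc i - 1 = \<eta> * (\<eta> ^ i - 1) + (\<eta> - 1)" by (simp add: algebra_simps)
    show ?case unfolding eq by (rule M_add[OF M_mult'[OF eV Suc] assms(2)])
  qed (simp add: M_zero)
  have "(\<Sum>i<m. \<eta> ^ i) * (\<eta> - 1) = \<eta> ^ m - 1" using power_diff_1_eq[of \<eta> m] by (simp add: mult.commute)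
  then have "(\<Sum>i<m. \<eta> ^ i) = 0" using ne assms(1) by simp
  then have "of_nat m = - (\<Sum>i<m. \<eta> ^ i - 1)" by (simp add: sum_subtractf)
  also have "\<dots> \<in> M" by (intro M_uminus M_sum pow)
  finally show False using assms(3) by simp
qed

end

lemma power_minus_1_factorization:
  fixes w :: complex
  assumes "m > 0"
  shows "w ^ m - 1 = (\<Prod>d<m. w - cis (2 * pi / of_nat m) ^ d)"
proof -
  define \<zeta> where "\<zeta> = cis (2 * pi / of_nat m)"
  have inj: "inj_on (\<lambda>d. \<zeta> ^ d) {..<m}"
  proof -
    have "\<zeta> ^ d = cis (2 * pi * real d / real m)" for d
      unfolding \<zeta>_def Complex.DeMoivre by (simp add: mult_ac)
    then show ?thesis
      using bij_betw_imp_inj_on[OF Complex.bij_betw_roots_unity[OF assms]] by simp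
  qed
  have "\<zeta> ^ m = 1" unfolding \<zeta>_def Complex.DeMoivre using assms by simp
  then have one: "(\<zeta> ^ d) ^ m = 1" for d
    by (simp flip: power_mult add: mult.commute[of d]) (simp add: power_mult)
  have "monom 1 m - 1 = (\<Prod>d<m. [:- (\<zeta> ^ d), 1:])"
  proof (rule poly_eqI_degree_lead_coeff[where n = m and A = "(\<lambda>d. \<zeta> ^ d) ` {..<m}"])
    have deg: "degree (\<Prod>d<m. [:- (\<zeta> ^ d), 1:]) = m"
      by (subst degree_prod_eq_sum_degree) auto
    have "lead_coeff (\<Prod>d<m. [:- (\<zeta> ^ d), 1:]) = 1" by (simp add: lead_coeff_prod)
    then show "coeff (monom 1 m - 1) m = coeff (\<Prod>d<m. [:- (\<zeta> ^ d), 1:]) m"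
      using assms deg by simp
    show "m \<le> card ((\<lambda>d. \<zeta> ^ d) ` {..<m})" using inj by (simp add: card_image)
    show "degree (monom (1 :: complex) m - 1) \<le> m"
      by (intro degree_diff_le) (auto simp: degree_monom_le)
    show "degree (\<Prod>d<m. [:- (\<zeta> ^ d), 1:]) \<le> m" using deg by simp
    fix z assume "z \<in> (\<lambda>d. \<zeta> ^ d) ` {..<m}"
    then show "poly (monom 1 m - 1) z = poly (\<Prod>d<m. [:- (\<zeta> ^ d), 1:]) z"
      using one by (auto simp: poly_monom poly_prod intro!: prod_zero[symmetric])
  qed
  from arg_cong[OF this, of "\<lambda>p. poly p w"] show ?thesis
    by (simp add: poly_monom poly_prod \<zeta>_def)
qed

text \<open>An endomorphism of the lattice together with the rational function it induces on the
  \<open>x\<close>-line. The nonzero \<open>g\<close> confines the exceptions to finitely many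
  values of \<open>x\<close>.\<close>

definition (in elliptic_model) rational_endo :: "complex \<Rightarrow> bool" where
  "rational_endo \<nu> \<longleftrightarrow> \<nu> \<noteq> 0 \<and> (\<forall>v\<in>\<Lambda>. \<nu> * v \<in> \<Lambda>) \<and>
    (\<exists>f g. g \<noteq> 0 \<and> (\<forall>z. z \<notin> \<Lambda> \<and> poly g (x z) \<noteq> 0 \<longrightarrow> \<nu> * z \<notin> \<Lambda> \<and> x (\<nu> * z) * poly g (x z) = poly f (x z)))"

text \<open>If \<open>f\<close> were 0, then \<open>x (\<nu> * z)\<close> could be nonzero only
  where \<open>g\<close> vanishes. But it takes every value, and distinct values come from distinct
  \<open>x z\<close>, which would give \<open>g\<close> infinitely many roots.\<close>

lemma (in elliptic_model) rational_endoE: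
  assumes "rational_endo \<nu>"
  obtains f g where "f \<noteq> 0" "g \<noteq> 0"
    "\<And>z. z \<notin> \<Lambda> \<Longrightarrow> poly g (x z) \<noteq> 0 \<Longrightarrow> \<nu> * z \<notin> \<Lambda> \<and> x (\<nu> * z) * poly g (x z) = poly f (x z)"
proof -
  obtain f g where fg: "g \<noteq> 0"
    "\<And>z. z \<notin> \<Lambda> \<Longrightarrow> poly g (x z) \<noteq> 0 \<Longrightarrow> \<nu> * z \<notin> \<Lambda> \<and> x (\<nu> * z) * poly g (x z) = poly f (x z)"
    using assms unfolding rational_endo_def by blast
  have \<nu>: "\<nu> \<noteq> 0" "\<And>v. v \<in> \<Lambda> \<Longrightarrow> \<nu> * v \<in> \<Lambda>" using assms by (auto simp: rational_endo_def)
  have "f \<noteq> 0"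
  proof
    assume f: "f = 0"
    define y where "y c = (SOME z. z \<notin> \<Lambda> \<and> x z = c)" for c
    have y: "y c \<notin> \<Lambda> \<and> x (y c) = c" for c
      unfolding y_def by (rule someI_ex) (rule x_surj)
    define u where "u c = y c / \<nu>" for c
    have u: "\<nu> * u c = y c" "u c \<notin> \<Lambda>" for c
      using \<nu>(1) \<nu>(2)[of "u c"] y[of c] by (auto simp: u_def)
    have root: "x (u c) \<in> {a. poly g a = 0}" if "c \<noteq> 0" for c
      using fg(2)[OF u(2), of c] y[of c] that f u(1)[of c] by auto
    have inj: "inj_on (\<lambda>c. x (u c)) (UNIV - {0})"
    proof (rule inj_onI)
      fix c d assume "x (u c) = x (u d)"
      then have "u c + u d \<in> \<Lambda> \<or> u c - u d \<in> \<Lambda>" using x_inj u(2) by blast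
      then have "y c + y d \<in> \<Lambda> \<or> y c - y d \<in> \<Lambda>"
        using \<nu>(2)[of "u c + u d"] \<nu>(2)[of "u c - u d"] by (auto simp: distrib_left right_diff_distrib u(1))
      then have "x (y c) = x (y d)"
        using x_periodic[of "- y d" "y c + y d"] x_periodic[of "y d" "y c - y d"] y[of d]
        by (auto simp: x_even uminus_lattice_iff)
      then show "c = d" using y by simp
    qed
    have "finite ((\<lambda>c. x (u c)) ` (UNIV - {0}))"
      by (rule finite_subset[OF _ poly_roots_finite[OF fg(1)]]) (use root in auto)
    then have "finite (UNIV - {0 :: complex})" using inj finite_imageD by blast
    then show False using infinite_UNIV_char_0 by (metis finite_Diff_insert finite.emptyI Diff_empty)
  qed
  then show ?thesis using that fg by blast
qed

text \<open>The equation \<open>y\<^sup>2 + x y + b y = x\<^sup>3\<close>, whose reduction \<open>y\<^sup>2 + x y = x\<^sup>3\<close> has a node at the origin.\<close>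

locale bad_model = integral_model V \<Lambda> x 1 b "b\<^sup>2" 0 for V \<Lambda> x b +
  assumes b_in_M: "b \<in> M" and b_nonzero: "b \<noteq> 0"
begin

text \<open>\<open>E0\<close> holds at the points with smooth reduction and \<open>E1\<close> on the kernel of reduction.\<close>

definition E0 :: "complex \<Rightarrow> bool" where "E0 z \<longleftrightarrow> proper z \<and> r z \<in> V"
definition E1 :: "complex \<Rightarrow> bool" where "E1 z \<longleftrightarrow> proper z \<and> r z \<in> M"

lemma E1_imp_E0: "E1 z \<Longrightarrow> E0 z"
  using M_imp_V by (auto simp: E0_def E1_def)

text \<open>With \<open>b\<close> in \<open>M\<close> the denominator \<open>Q\<close> is congruent
  to 1 and \<open>S\<close> to \<open>2 * (s + t) + s * t\<close>; the last two claims are the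
  addition law on the smooth part of the nodal cubic.\<close>

lemma E0_add_aux:
  assumes "E0 z" "E0 w"
  shows "proper (z + w)" "proper (z - w)" "r (z + w) \<in> V" "r (z - w) \<in> V"
    "r (z + w) + r (z - w) - (2 * (r z + r w) + r z * r w) \<in> M"
    "r (z + w) * r (z - w) - (r z - r w)\<^sup>2 \<in> M"
proof -
  define s t q where "s = r z" and "t = r w" and "q = Q (r z) (r w)"
  have st: "s \<in> V" "t \<in> V" using assms by (simp_all add: E0_def s_def t_def)
  have "1 - q = b * (s * t + b * (s * t * (s + t)))"
    unfolding q_def Q_def s_def t_def by (simp add: power2_eq_square algebra_simps)
  moreover have "b * (s * t + b * (s * t * (s + t))) \<in> M"
    by (rule M_mult[OF b_in_M]) (intro V_intros st M_imp_V[OF b_in_M])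
  ultimately have q1: "1 - q \<in> M" by simp
  have qu: "unit q" using unit_one_minus_M[OF q1] by simp
  then have q0: "q \<noteq> 0" by (rule unit_imp_nonzero)
  note add = r_add[OF _ _ q0[unfolded q_def], folded q_def]
  have pz: "proper z" "proper w" using assms by (simp_all add: E0_def)
  show "proper (z + w)" "proper (z - w)" using add[OF pz] by auto
  define a c where "a = r (z + w)" and "c = r (z - w)"
  define m where "m = b * (s * t * (s + t) + b * (s * t)\<^sup>2)"
  have m: "m \<in> M" unfolding m_def
    by (rule M_mult[OF b_in_M]) (intro V_intros st M_imp_V[OF b_in_M])
  have "q * (a + c) = S s t" using add[OF pz] by (simp add: a_def c_def s_def t_def)
  also have "\<dots> = 2 * (s + t) + s * t + m" unfolding S_def m_def by (simp add: power2_eq_square algebra_simps)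
  finally have sum: "q * (a + c) = 2 * (s + t) + s * t + m" .
  have prod: "q * (a * c) = (s - t)\<^sup>2" using add[OF pz] by (simp add: a_def c_def s_def t_def)
  have "a + c = (2 * (s + t) + s * t + m) / q" using sum q0 by (simp add: field_simps)
  also have "\<dots> \<in> V" by (intro unit_divide_mem[OF _ qu] V_intros st M_imp_V[OF m])
  finally have sV: "a + c \<in> V" .
  have "a * c = (s - t)\<^sup>2 / q" using prod q0 by (simp add: field_simps)
  also have "\<dots> \<in> V" by (intro unit_divide_mem[OF _ qu] V_intros st)
  finally have pV: "a * c \<in> V" .
  show "r (z + w) \<in> V" "r (z - w) \<in> V" using sum_prod_mem[OF sV pV] by (simp_all add: a_def c_def)
  have "a + c - (2 * (s + t) + s * t) = (1 - q) * (a + c) + m" using sum by (simp add: left_diff_distrib)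
  then show "r (z + w) + r (z - w) - (2 * (r z + r w) + r z * r w) \<in> M"
    using M_add[OF M_mult[OF q1 sV] m] by (simp add: a_def c_def s_def t_def)
  have "a * c - (s - t)\<^sup>2 = (1 - q) * (a * c)" using prod by (simp add: left_diff_distrib)
  then show "r (z + w) * r (z - w) - (r z - r w)\<^sup>2 \<in> M"
    using M_mult[OF q1 pV] by (simp add: a_def c_def s_def t_def)
qed

lemma E0_add: "E0 z \<Longrightarrow> E0 w \<Longrightarrow> E0 (z + w)" and E0_diff: "E0 z \<Longrightarrow> E0 w \<Longrightarrow> E0 (z - w)"
  using E0_add_aux by (auto simp: E0_def)

lemma E1_uminus: "E1 (- z) = E1 z"
  by (simp add: E1_def r_even proper_uminus)

lemma E0_periodic: "v \<in> \<Lambda> \<Longrightarrow> E0 (z + v) = E0 z" and E1_periodic: "v \<in> \<Lambda> \<Longrightarrow> E1 (z + v) = E1 z"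
  by (simp_all add: E0_def E1_def r_periodic proper_periodic)

lemma E1_zero: "E1 0"
  using zero_lattice M_zero by (simp add: E1_def proper_def r_def)

lemma E0_of_nat_mult: "E0 z \<Longrightarrow> E0 (of_nat n * z)"
  using E1_imp_E0[OF E1_zero] by (induction n) (auto simp: distrib_right intro: E0_add)

text \<open>When \<open>r w\<close> is in \<open>M\<close>, the values at \<open>z + w\<close> and
  \<open>z - w\<close> have sum and product congruent to those of a double root \<open>r z\<close>;
  hence \<open>(a - s)\<^sup>2\<close> lies in \<open>M\<close>.\<close>

lemma r_add_E1:
  assumes "E0 z" "E1 w"
  shows "r (z + w) - r z \<in> M"
proof -
  define s t a c where "s = r z" and "t = r w" and "a = r (z + w)" and "c = r (z - w)"
  have t: "t \<in> M" and s: "s \<in> V" using assms by (simp_all add: E0_def E1_def s_def t_def)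
  note aux = E0_add_aux[OF assms(1) E1_imp_E0[OF assms(2)], folded s_def t_def a_def c_def]
  have eq: "(a - s)\<^sup>2 = a * (a + c - (2 * (s + t) + s * t)) - (a * c - (s - t)\<^sup>2) + t * (2 * a + s * a + 2 * s - t)"
    by (simp add: power2_eq_square algebra_simps)
  have "t * (2 * a + s * a + 2 * s - t) \<in> M"
    by (rule M_mult[OF t]) (intro V_intros s aux M_imp_V[OF t])
  then have "(a - s)\<^sup>2 \<in> M"
    unfolding eq by (rule M_add[OF M_diff[OF M_mult'[OF aux(3) aux(5)] aux(6)]])
  moreover have "a - s \<in> V" by (intro V_intros aux s)
  ultimately show ?thesis using M_prime_power by (simp add: a_def s_def)
qed

lemma E1_add: "E1 z \<Longrightarrow> E1 w \<Longrightarrow> E1 (z + w)"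
  using r_add_E1[of z w] E1_imp_E0 E0_add_aux(1)[of z w] M_add[of "r (z + w) - r z" "r z"]
  by (auto simp: E1_def)

lemma E1_diff: "E1 z \<Longrightarrow> E1 w \<Longrightarrow> E1 (z - w)"
  using E1_add[of z "- w"] by (simp add: E1_uminus)

lemma E1_of_int_mult: "E1 z \<Longrightarrow> E1 (of_int n * z)"
proof -
  assume z: "E1 z"
  have nat: "E1 (of_nat n * z)" for n
    using E1_zero z by (induction n) (auto simp: distrib_right intro: E1_add)
  show ?thesis
  proof (cases "n \<ge> 0")
    case True
    then show ?thesis using nat[of "nat n"] by simp
  next
    case False
    then have "of_int n * z = - (of_nat (nat (- n)) * z)" by simp
    then show ?thesis using nat E1_uminus by metis
  qed
qed

text \<open>The product of the values at \<open>z + w\<close> and \<open>z - w\<close> is congruent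
  to \<open>(r z - r w)\<^sup>2\<close>. The alternative reflects the lost sign.\<close>

lemma same_r_imp_E1:
  assumes "E0 z" "E0 w" "r z - r w \<in> M"
  shows "E1 (z + w) \<or> E1 (z - w)"
proof -
  note aux = E0_add_aux[OF assms(1,2)]
  have "(r z - r w)\<^sup>2 \<in> M" using M_power[OF assms(3), of 2] by simp
  then have "r (z + w) * r (z - w) \<in> M" using M_add[OF aux(6)] by fastforce
  then show ?thesis using M_prime[OF aux(3,4)] aux(1,2) by (auto simp: E1_def)
qed

lemma r_double:
  assumes "E0 z"
  shows "r (2 * z) - ((r z)\<^sup>2 + 4 * r z) \<in> M"
proof -
  have "r (z - z) = 0" using zero_lattice by (simp add: r_def)
  then show ?thesis using E0_add_aux(5)[OF assms assms]
    by (simp add: mult_2[symmetric] power2_eq_square algebra_simps)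
qed

text \<open>On the smooth points of the nodal reduction, \<open>r\<close> is \<open>w + w\<^sup>-\<^sup>1 - 2\<close> for a coordinate \<open>w\<close> of the
  multiplicative group.\<close>

lemma r_multiple:
  assumes "E0 z" "w * v = 1" "w \<in> V" "v \<in> V" "r z - (w + v - 2) \<in> M"
  shows "r (of_nat n * z) - (w ^ n + v ^ n - 2) \<in> M"
proof -
  define f where "f n = w ^ n + v ^ n - 2" for n
  have fV: "f n \<in> V" for n unfolding f_def by (intro V_intros assms)
  have "r (of_nat n * z) - f n \<in> M \<and> r (of_nat (Suc n) * z) - f (Suc n) \<in> M"
  proof (induction n)
    case 0
    then show ?case using assms(5) zero_lattice M_zero by (simp add: f_def r_def)
  next
    case (Suc n)
    define a c s where "a = r (of_nat (Suc (Suc n)) * z)" and "c = r (of_nat n * z)" and "s = r (of_nat (Suc n) * z)"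
    have e: "of_nat (Suc n) * z + z = of_nat (Suc (Suc n)) * z" "of_nat (Suc n) * z - z = of_nat n * z"
      by (simp_all add: algebra_simps)
    have h: "a + c - (2 * (s + r z) + s * r z) \<in> M"
      using E0_add_aux(5)[OF E0_of_nat_mult[OF assms(1), of "Suc n"] assms(1)] unfolding e a_def c_def s_def .
    have IH: "c - f n \<in> M" "s - f (Suc n) \<in> M" using Suc by (simp_all add: c_def s_def)
    have z1: "r z - f 1 \<in> M" using assms(5) by (simp add: f_def)
    have zV: "r z \<in> V" using assms(1) by (simp add: E0_def)
    \<comment> \<open>The Chebyshev recurrence for \<open>w ^ n + v ^ n\<close>, shifted by 2; it
      has the same form as the congruence \<open>h\<close>.\<close>
    have rec: "f (Suc (Suc n)) = 2 * (f (Suc n) + f 1) + f (Suc n) * f 1 - f n"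
    proof -
      have "f (Suc (Suc n)) - (2 * (f (Suc n) + f 1) + f (Suc n) * f 1 - f n) = (w ^ n + v ^ n) * (1 - w * v)"
        by (simp add: f_def algebra_simps)
      then show ?thesis by (simp add: assms(2))
    qed
    have eq: "a - f (Suc (Suc n)) = (a + c - (2 * (s + r z) + s * r z)) - (c - f n)
        + (s - f (Suc n)) * (2 + r z) + (r z - f 1) * (2 + f (Suc n))"
      unfolding rec by (simp add: algebra_simps)
    have "a - f (Suc (Suc n)) \<in> M"
      unfolding eq
      by (rule M_add[OF M_add[OF M_diff[OF h IH(1)] M_mult[OF IH(2)]] M_mult[OF z1]]) (intro V_intros zV fV)+
    then show ?case using Suc by (simp add: a_def)
  qed
  then show ?thesis by (simp add: f_def)
qed

text \<open>Avoiding finitely many residue classes keeps a point away from the zeros and poles of an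
  induced rational function, where its valuation could jump.\<close>

definition generic :: "complex set \<Rightarrow> complex \<Rightarrow> bool" where
  "generic A z \<longleftrightarrow> E0 z \<and> (\<forall>\<sigma>\<in>A. r z - \<sigma> \<notin> M)"

lemma generic_mono: "A \<subseteq> B \<Longrightarrow> generic B z \<Longrightarrow> generic A z"
  by (auto simp: generic_def)

lemma generic_add_E1: "generic A z \<Longrightarrow> E1 w \<Longrightarrow> generic A (z + w)"
proof -
  assume z: "generic A z" and w: "E1 w"
  have "r (z + w) - \<sigma> \<notin> M" if "\<sigma> \<in> A" for \<sigma>
  proof
    assume "r (z + w) - \<sigma> \<in> M"
    from M_diff[OF this r_add_E1[of z w]] have "(r (z + w) - \<sigma>) - (r (z + w) - r z) \<in> M"
      using z w by (simp add: generic_def)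
    then show False using z that by (simp add: generic_def)
  qed
  then show ?thesis using z w E0_add E1_imp_E0 by (auto simp: generic_def)
qed

lemma exists_generic:
  assumes "finite A" "A \<subseteq> V" "0 \<in> A" "E0 z"
  obtains w where "generic A w" "generic A (z + w)"
proof -
  have zV: "r z \<in> V" using assms(4) by (simp add: E0_def)
  define lin where "lin = (\<lambda>\<sigma>. [:- \<sigma>, 1:] :: complex poly)"
  \<comment> \<open>At \<open>\<rho> = r w\<close> its value is congruent to
    \<open>(r (z + w) - \<sigma>) * (r (z - w) - \<sigma>)\<close>, so genericity of
    \<open>z + w\<close> becomes a condition on a monic polynomial in \<open>\<rho>\<close>.\<close>
  define quad where "quad = (\<lambda>\<sigma>. [:\<sigma>\<^sup>2 - 2 * \<sigma> * r z + (r z)\<^sup>2, - (2 * \<sigma> + 2 * r z + \<sigma> * r z), 1:])"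
  have "finite (lin ` A \<union> quad ` A)" using assms(1) by auto
  then obtain \<rho> where \<rho>: "\<rho> \<in> V" "\<And>p. p \<in> lin ` A \<union> quad ` A \<Longrightarrow> poly p \<rho> \<in> V \<and> poly p \<rho> \<notin> M"
  proof (rule exists_unit_values)
    fix p assume "p \<in> lin ` A \<union> quad ` A"
    then obtain \<sigma> where \<sigma>: "\<sigma> \<in> V" "p = lin \<sigma> \<or> p = quad \<sigma>" using assms(2) by auto
    have "\<sigma>\<^sup>2 - 2 * \<sigma> * r z + (r z)\<^sup>2 \<in> V" "- (2 * \<sigma> + 2 * r z + \<sigma> * r z) \<in> V" "- \<sigma> \<in> V"
      by (intro V_intros \<sigma>(1) zV)+
    then show "lead_coeff p = 1 \<and> degree p > 0 \<and> (\<forall>i. coeff p i \<in> V)"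
      using \<sigma>(2) zero_mem one_mem by (auto simp: lin_def quad_def coeff_pCons split: nat.split)
  qed blast
  have lin: "\<rho> - \<sigma> \<notin> M" if "\<sigma> \<in> A" for \<sigma> using \<rho>(2)[of "lin \<sigma>"] that by (simp add: lin_def)
  have \<rho>0: "\<rho> \<noteq> 0" using lin[OF assms(3)] M_zero by auto
  obtain w where w: "w \<notin> \<Lambda>" "x w = 1 / \<rho>" using x_surj by blast
  then have rw: "r w = \<rho>" "proper w" using \<rho>0 by (simp_all add: r_def proper_def)
  then have gw: "generic A w" using lin \<rho>(1) by (simp add: generic_def E0_def)
  note aux = E0_add_aux[OF assms(4), of w]
  have E0w: "E0 w" using gw by (simp add: generic_def)
  have "r (z + w) - \<sigma> \<notin> M" if \<sigma>: "\<sigma> \<in> A" for \<sigma>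
  proof
    define a c where "a = r (z + w)" and "c = r (z - w)"
    assume "r (z + w) - \<sigma> \<in> M"
    then have m: "a - \<sigma> \<in> M" by (simp add: a_def)
    have V: "\<sigma> \<in> V" "c \<in> V" using \<sigma> assms(2) aux[OF E0w] by (auto simp: c_def)
    note aux' = aux(5,6)[OF E0w, folded a_def c_def, unfolded rw(1)]
    have eq: "poly (quad \<sigma>) \<rho> =
        (a - \<sigma>) * (c - \<sigma>) + \<sigma> * (a + c - (2 * (r z + \<rho>) + r z * \<rho>)) - (a * c - (r z - \<rho>)\<^sup>2)"
      by (simp add: quad_def power2_eq_square algebra_simps)
    have "poly (quad \<sigma>) \<rho> \<in> M"
      unfolding eq by (rule M_diff[OF M_add[OF M_mult[OF m diff_mem[OF V(2,1)]] M_mult'[OF V(1) aux'(1)]] aux'(2)])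
    then show False using \<rho>(2)[of "quad \<sigma>"] \<sigma> by blast
  qed
  then have "generic A (z + w)" using E0_add[OF assms(4) E0w] by (simp add: generic_def)
  with gw show ?thesis by (rule that)
qed

lemma generic_double:
  assumes "finite A" "A \<subseteq> V"
  obtains B where "finite B" "B \<subseteq> V" "A \<subseteq> B" "\<And>z. generic B z \<Longrightarrow> generic A (2 * z)"
proof -
  \<comment> \<open>Preimages of \<open>\<sigma>\<close> under
    \<open>\<rho>\<^sup>2 + 4 * \<rho>\<close>, the reduction of doubling in the coordinate
    \<open>r\<close>.\<close>
  define R where "R \<sigma> = {\<rho>. poly [:- \<sigma>, 4, 1:] \<rho> = 0}" for \<sigma> :: complex
  define B where "B = A \<union> (\<Union>\<sigma>\<in>A. R \<sigma>)"
  have finR: "finite (R \<sigma>)" for \<sigma> unfolding R_def by (rule poly_roots_finite) simp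
  have "R \<sigma> \<subseteq> V" if "\<sigma> \<in> A" for \<sigma>
  proof
    fix \<rho> assume "\<rho> \<in> R \<sigma>"
    then have "\<rho>\<^sup>2 - (- 4) * \<rho> + (- \<sigma>) = 0" by (simp add: R_def power2_eq_square algebra_simps)
    then show "\<rho> \<in> V" by (rule quadratic_root_mem) (use that assms(2) in \<open>auto intro: V_intros\<close>)
  qed
  then have "finite B" "B \<subseteq> V" "A \<subseteq> B" using assms finR by (auto simp: B_def)
  moreover have "generic A (2 * z)" if z: "generic B z" for z
  proof -
    have E0: "E0 z" using z by (simp add: generic_def)
    have "r (2 * z) - \<sigma> \<notin> M" if \<sigma>: "\<sigma> \<in> A" for \<sigma>
    proof
      assume m: "r (2 * z) - \<sigma> \<in> M"
      obtain \<rho> where \<rho>: "poly [:- \<sigma>, 4, 1:] \<rho> = 0"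
        using alg_closed_imp_poly_has_root[of "[:- \<sigma>, 4, 1:]"] by auto
      then have "poly [:- \<sigma>, 4, 1:] (- 4 - \<rho>) = 0" by (simp add: algebra_simps)
      with \<rho> have "\<rho> \<in> R \<sigma>" "- 4 - \<rho> \<in> R \<sigma>" by (simp_all only: R_def mem_Collect_eq)
      then have "\<rho> \<in> B" "- 4 - \<rho> \<in> B" using \<sigma> by (auto simp: B_def)
      then have nm: "r z - \<rho> \<notin> M" "r z - (- 4 - \<rho>) \<notin> M" and V: "\<rho> \<in> V"
        using z \<open>B \<subseteq> V\<close> by (auto simp: generic_def)
      have zV: "r z \<in> V" using E0 by (simp add: E0_def)
      have "(r z - \<rho>) * (r z - (- 4 - \<rho>)) = (r (2 * z) - \<sigma>) - (r (2 * z) - ((r z)\<^sup>2 + 4 * r z)) - (\<rho> * (4 + \<rho>) - \<sigma>)"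
        by (simp add: power2_eq_square algebra_simps)
      also have "\<rho> * (4 + \<rho>) - \<sigma> = 0" using \<rho> by simp
      finally have "(r z - \<rho>) * (r z - (- 4 - \<rho>)) \<in> M"
        using M_diff[OF m r_double[OF E0]] by simp
      moreover have "r z - \<rho> \<in> V" "r z - (- 4 - \<rho>) \<in> V" by (intro V_intros zV V)+
      ultimately show False using nm M_prime by blast
    qed
    moreover have "E0 (2 * z)" using E0_of_nat_mult[OF E0, of 2] by simp
    ultimately show ?thesis by (simp add: generic_def)
  qed
  ultimately show ?thesis by (rule that)
qed

end

lemma (in valuation_ring) M_of_cong: "a \<in> M \<Longrightarrow> a - c \<in> M \<Longrightarrow> c \<in> M"
  using M_diff[of a "a - c"] by simp

section \<open>Endomorphisms on the nodal reduction\<close>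

context bad_model
begin

text \<open>\<open>poly_ratio\<close> applies to numerator and denominator at
  \<open>x z = 1 / r z\<close>, so the bad classes are inverted. Including 0 in \<open>A\<close>
  makes \<open>r z\<close> a unit; then classes inside \<open>M\<close> are avoided automatically
  and only units have to be inverted.\<close>

lemma rational_endo_ratio:
  assumes "rational_endo \<nu>"
  obtains A where "finite A" "A \<subseteq> V" "0 \<in> A"
    "\<And>z w. generic A z \<Longrightarrow> generic A w \<Longrightarrow>
      \<nu> * z \<notin> \<Lambda> \<and> x (\<nu> * z) \<noteq> 0 \<and> x (\<nu> * z) / x (\<nu> * w) \<in> V \<and>
      (r z - r w \<in> M \<longrightarrow> x (\<nu> * z) / x (\<nu> * w) - 1 \<in> M)"
proof -
  obtain f g where fg: "f \<noteq> 0" "g \<noteq> 0"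
    "\<And>z. z \<notin> \<Lambda> \<Longrightarrow> poly g (x z) \<noteq> 0 \<Longrightarrow> \<nu> * z \<notin> \<Lambda> \<and> x (\<nu> * z) * poly g (x z) = poly f (x z)"
    using rational_endoE[OF assms] by blast
  obtain F where F: "finite F" "F \<subseteq> V" "\<And>c d. c \<in> V \<Longrightarrow> d \<in> V \<Longrightarrow> \<forall>s\<in>F. c - s \<notin> M \<and> d - s \<notin> M \<Longrightarrow>
      poly f c \<noteq> 0 \<and> poly f c / poly f d \<in> V \<and> (c - d \<in> M \<longrightarrow> poly f c / poly f d - 1 \<in> M)"
    by (rule poly_ratio[OF fg(1)]) blast
  obtain G where G: "finite G" "G \<subseteq> V" "\<And>c d. c \<in> V \<Longrightarrow> d \<in> V \<Longrightarrow> \<forall>s\<in>G. c - s \<notin> M \<and> d - s \<notin> M \<Longrightarrow>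
      poly g c \<noteq> 0 \<and> poly g c / poly g d \<in> V \<and> (c - d \<in> M \<longrightarrow> poly g c / poly g d - 1 \<in> M)"
    by (rule poly_ratio[OF fg(2)]) blast
  define A where "A = insert 0 ((\<lambda>s. 1 / s) ` {s \<in> F \<union> G. s \<notin> M})"
  have A: "finite A" "0 \<in> A" using F(1) G(1) by (auto simp: A_def)
  moreover have "A \<subseteq> V"
  proof
    fix \<sigma> assume "\<sigma> \<in> A"
    then consider "\<sigma> = 0" | s where "s \<in> V" "s \<notin> M" "\<sigma> = 1 / s" using F(2) G(2) by (auto simp: A_def)
    then show "\<sigma> \<in> V"
      by cases (auto simp: zero_mem divide_inverse intro: unit_inverse)
  qed
  moreover have "\<nu> * z \<notin> \<Lambda> \<and> x (\<nu> * z) \<noteq> 0 \<and> x (\<nu> * z) / x (\<nu> * w) \<in> V \<and>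
      (r z - r w \<in> M \<longrightarrow> x (\<nu> * z) / x (\<nu> * w) - 1 \<in> M)" if gz: "generic A z" and gw: "generic A w" for z w
  proof -
    have x_mem: "z \<notin> \<Lambda> \<and> unit (r z) \<and> x z = 1 / r z \<and> x z \<in> V \<and> (\<forall>s\<in>F \<union> G. x z - s \<notin> M)" if g: "generic A z" for z
    proof -
      have rz: "r z \<in> V" "r z \<notin> M" using g A(2) by (auto simp: generic_def E0_def)
      then have r0: "r z \<noteq> 0" by (intro unit_nonzero) auto
      then have zL: "z \<notin> \<Lambda>" by (auto simp: r_def)
      then have xz: "x z = 1 / r z" using r0 by (simp add: r_def)
      have xV: "x z \<in> V" unfolding xz using unit_divide[OF one_mem rz] .
      have "x z - s \<notin> M" if s: "s \<in> F \<union> G" for s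
      proof
        assume "x z - s \<in> M"
        then have m: "r z * (x z - s) \<in> M" using rz by (intro M_mult')
        have eq: "r z * (x z - s) = 1 - r z * s" using r0 by (simp add: xz algebra_simps)
        have sV: "s \<in> V" using s F(2) G(2) by auto
        show False
        proof (cases "s \<in> M")
          case True
          then have "r z * (x z - s) + r z * s \<in> M" using m rz M_mult' by (intro M_add) auto
          then show False using M_one by (simp add: eq)
        next
          case False
          have s0: "s \<noteq> 0" using unit_nonzero[OF False] .
          have "1 / s * (r z * (x z - s)) \<in> M" using M_mult'[OF unit_divide[OF one_mem sV False] m] .
          moreover have "1 / s * (r z * (x z - s)) = - (r z - 1 / s)" unfolding eq using s0 by (simp add: field_simps)
          ultimately have "r z - 1 / s \<in> M" using M_uminus by fastforce
          moreover have "1 / s \<in> A" using s False by (auto simp: A_def)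
          ultimately show False using g by (simp add: generic_def)
        qed
      qed
      then show ?thesis using zL rz xz xV by (simp add: unit_def)
    qed
    note z = x_mem[OF gz] and w = x_mem[OF gw]
    have f: "poly f (x z) \<noteq> 0 \<and> poly f (x z) / poly f (x w) \<in> V \<and> (x z - x w \<in> M \<longrightarrow> poly f (x z) / poly f (x w) - 1 \<in> M)"
      using F(3) z w by blast
    have f': "poly f (x w) \<noteq> 0" using F(3)[of "x w" "x w"] w by blast
    have g: "poly g (x z) \<noteq> 0" "poly g (x w) \<noteq> 0" "poly g (x w) / poly g (x z) \<in> V \<and> (x w - x z \<in> M \<longrightarrow> poly g (x w) / poly g (x z) - 1 \<in> M)"
      using G(3)[of "x w" "x z"] G(3)[of "x z" "x z"] z w by blast+
    have nz: "\<nu> * z \<notin> \<Lambda>" "x (\<nu> * z) = poly f (x z) / poly g (x z)"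
      and nw: "x (\<nu> * w) = poly f (x w) / poly g (x w)"
      using fg(3)[of z] fg(3)[of w] z w g by (auto simp: field_simps)
    define s t where "s = poly f (x z) / poly f (x w)" and "t = poly g (x w) / poly g (x z)"
    have ratio: "x (\<nu> * z) / x (\<nu> * w) = s * t"
      unfolding nz(2) nw s_def t_def using f f' g by (simp add: field_simps)
    have st: "s \<in> V" "t \<in> V" using f g by (simp_all add: s_def t_def)
    have "s * t - 1 \<in> M" if "r z - r w \<in> M"
    proof -
      have eq: "x w - x z = (r z - r w) * (x z * x w)"
        using z w unit_imp_nonzero by (auto simp: field_simps)
      have m: "x w - x z \<in> M" unfolding eq by (rule M_mult[OF that mult_mem]) (use z w in blast)+
      then have "x z - x w \<in> M" using M_uminus by fastforce
      then have "s - 1 \<in> M" "t - 1 \<in> M" using f g m by (simp_all add: s_def t_def)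
      then have "(s - 1) * t + (t - 1) \<in> M" using st by (intro M_add M_mult)
      then show ?thesis by (simp add: algebra_simps)
    qed
    then show ?thesis using nz f g(1) st unfolding ratio by (auto intro: mult_mem)
  qed
  ultimately show ?thesis using that by blast
qed

text \<open>The point \<open>T\<close> reduces to the node.\<close>

lemma exists_three_torsion:
  obtains T where "T \<notin> \<Lambda>" "x T = 0" "3 * T \<in> \<Lambda>"
proof -
  obtain T where T: "T \<notin> \<Lambda>" "x T = 0" using x_surj by blast
  \<comment> \<open>At \<open>x = 0\<close> the duplication denominator is \<open>b\<^sup>2\<close>,
    not 0, while the numerator vanishes. So \<open>x (2 * T) = x T\<close>, and \<open>2 * T\<close>
    must be \<open>- T\<close> modulo the lattice.\<close>
  have 2: "2 * T \<notin> \<Lambda>"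
    using x_half_period[OF T(1)] T(2) b_nonzero by auto
  have "x (2 * T) = x T" using x_double[OF T(1) 2] T(2) b_nonzero by simp
  then have "2 * T + T \<in> \<Lambda> \<or> 2 * T - T \<in> \<Lambda>" using x_inj[OF 2 T(1)] by blast
  then show ?thesis using that T by simp
qed

lemma E0_of_x_notin_M: "z \<notin> \<Lambda> \<Longrightarrow> x z \<notin> M \<Longrightarrow> E0 z"
  using unit_nonzero[of "x z"] unit_divide[OF one_mem, of "x z"] M_imp_V[OF inverse_in_M'[of "x z"]]
  by (auto simp: E0_def proper_def r_def)

text \<open>Near the node the ratio \<open>\<xi>\<close> of \<open>x q\<close> to \<open>b\<close>
  compares \<open>q\<close> with the 3-torsion point \<open>T\<close>. If \<open>\<xi>\<close> is
  not integral, doubling strictly changes the valuation of \<open>x q\<close>. Otherwise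
  \<open>q + T\<close> or \<open>q - T\<close> has smooth reduction, and tripling removes
  \<open>T\<close>.\<close>

lemma E0_triple_of_double:
  assumes q: "q \<notin> \<Lambda>" "2 * q \<notin> \<Lambda>" and u: "unit (x (2 * q) / x q)"
  shows "E0 (3 * q)"
proof (cases "x q \<in> M")
  case False
  then have "E0 q" using E0_of_x_notin_M q by blast
  then show ?thesis using E0_of_nat_mult[of q 3] by simp
next
  case True
  define c where "c = x q"
  define u where "u = x (2 * q) / c"
  have c: "c \<in> M" using True by (simp add: c_def)
  have uu: "unit u" using assms(3) by (simp add: u_def c_def)
  then have c0: "c \<noteq> 0" and x2: "x (2 * q) = u * c" using unit_imp_nonzero[OF uu] by (auto simp: u_def)
  have cV: "c \<in> V" and bV: "b \<in> V" and uV: "u \<in> V" using c b_in_M M_imp_V uu by (auto simp: unit_def)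
  have "u * c * (4 * c ^ 3 + 1 * c\<^sup>2 + 2 * b * c + b\<^sup>2) = c ^ 4 - b * c\<^sup>2 - 2 * b\<^sup>2 * c - 0"
    using x_double[OF q] unfolding x2 c_def[symmetric] .
  then have "c * (u * (4 * c ^ 3 + (c + b)\<^sup>2)) = c * (c ^ 3 - b * c - 2 * b\<^sup>2)"
    by (simp add: power2_eq_square power3_eq_cube power4_eq_xxxx algebra_simps)
  then have dup: "u * (4 * c ^ 3 + (c + b)\<^sup>2) = c ^ 3 - b * c - 2 * b\<^sup>2" using c0 by simp
  define \<xi> where "\<xi> = c / b"
  have xi_V: "\<xi> \<in> V"
  proof (rule ccontr)
    assume "\<xi> \<notin> V"
    define \<beta> where "\<beta> = b / c"
    have \<beta>: "\<beta> \<in> M" using inverse_in_M[OF \<open>\<xi> \<notin> V\<close>] by (simp add: \<beta>_def \<xi>_def)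
    have b: "b = \<beta> * c" using c0 by (simp add: \<beta>_def)
    have "c\<^sup>2 * (u * (4 * c + (1 + \<beta>)\<^sup>2)) = c\<^sup>2 * (c - \<beta> - 2 * \<beta>\<^sup>2)"
      using dup unfolding b by (simp add: power2_eq_square power3_eq_cube algebra_simps)
    then have eq: "u * (4 * c + (1 + \<beta>)\<^sup>2) = c - \<beta> - 2 * \<beta>\<^sup>2" using c0 by simp
    have \<beta>V: "\<beta> \<in> V" using M_imp_V[OF \<beta>] .
    have "c - \<beta> - 2 * \<beta>\<^sup>2 \<in> M"
      using M_power[OF \<beta>, of 2] by (intro M_diff M_mult' c \<beta> numeral_mem) simp
    then have um: "u * (4 * c + (1 + \<beta>)\<^sup>2) \<in> M" unfolding eq .
    have m: "- (4 * c + \<beta> * (2 + \<beta>)) \<in> M"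
      by (intro M_uminus M_add M_mult'[OF _ c] M_mult[OF \<beta>] V_intros \<beta>V)
    have e1: "4 * c + (1 + \<beta>)\<^sup>2 = 1 - - (4 * c + \<beta> * (2 + \<beta>))"
      by (simp add: power2_eq_square algebra_simps)
    have "unit (4 * c + (1 + \<beta>)\<^sup>2)" unfolding e1 by (rule unit_one_minus_M[OF m])
    then show False using um unit_mult_unit[OF uu] by (auto simp: unit_def)
  qed
  have c_eq: "c = b * \<xi>" using b_nonzero by (simp add: \<xi>_def)
  have "b\<^sup>2 * (u * (4 * b * \<xi> ^ 3 + (\<xi> + 1)\<^sup>2)) = b\<^sup>2 * (b * \<xi> ^ 3 - \<xi> - 2)"
    using dup unfolding c_eq by (simp add: power2_eq_square power3_eq_cube algebra_simps)
  then have dup': "u * (4 * b * \<xi> ^ 3 + (\<xi> + 1)\<^sup>2) = b * \<xi> ^ 3 - \<xi> - 2" using b_nonzero by simp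
  \<comment> \<open>Modulo \<open>M\<close> the relation \<open>dup'\<close> reads
    \<open>u * (\<xi> + 1)\<^sup>2 = - (\<xi> + 1) - 1\<close>, which excludes that
    \<open>\<xi> + 1\<close> vanishes.\<close>
  have xi1: "\<xi> + 1 \<notin> M"
  proof
    assume m: "\<xi> + 1 \<in> M"
    have "(\<xi> + 1)\<^sup>2 \<in> M" using M_power[OF m, of 2] by simp
    moreover have "4 * b * \<xi> ^ 3 = b * (4 * \<xi> ^ 3)" by simp
    moreover have "b * (4 * \<xi> ^ 3) \<in> M" by (rule M_mult[OF b_in_M]) (intro V_intros xi_V)
    ultimately have l: "u * (4 * b * \<xi> ^ 3 + (\<xi> + 1)\<^sup>2) \<in> M" using uV by (metis M_add M_mult')
    have "b * \<xi> ^ 3 \<in> M" by (rule M_mult[OF b_in_M]) (intro V_intros xi_V)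
    then have "b * \<xi> ^ 3 - (\<xi> + 1) - u * (4 * b * \<xi> ^ 3 + (\<xi> + 1)\<^sup>2) \<in> M" using m l by (intro M_diff)
    then show False using M_one unfolding dup' by simp
  qed
  obtain T where T: "T \<notin> \<Lambda>" "x T = 0" "3 * T \<in> \<Lambda>" by (rule exists_three_torsion)
  have ne: "q + T \<notin> \<Lambda>" "q - T \<notin> \<Lambda>"
  proof -
    have "x q = 0" if "q + T \<in> \<Lambda> \<or> q - T \<in> \<Lambda>"
      using that
    proof
      assume "q + T \<in> \<Lambda>"
      from x_periodic[OF _ this, of "- T"] show ?thesis using T by (simp add: x_even uminus_lattice_iff)
    next
      assume "q - T \<in> \<Lambda>"
      from x_periodic[OF T(1) this] show ?thesis using T by simp
    qed
    then show "q + T \<notin> \<Lambda>" "q - T \<notin> \<Lambda>" using c0 by (auto simp: c_def)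
  qed
  have "c\<^sup>2 * (x (q + T) + x (q - T)) = b * c + b\<^sup>2"
    using x_sum[OF q(1) T(1) ne] T(2) by (simp add: c_def)
  then have "b\<^sup>2 * (\<xi>\<^sup>2 * (x (q + T) + x (q - T))) = b\<^sup>2 * (\<xi> + 1)"
    unfolding c_eq by (simp add: power2_eq_square algebra_simps)
  then have sum: "\<xi>\<^sup>2 * (x (q + T) + x (q - T)) = \<xi> + 1" using b_nonzero by simp
  have "x (q + T) \<notin> M \<or> x (q - T) \<notin> M"
    using xi1 M_add[of "x (q + T)" "x (q - T)"] M_mult'[OF power_mem[OF xi_V, of 2]] sum by metis
  then have "E0 (q + T) \<or> E0 (q - T)" using E0_of_x_notin_M ne by blast
  then have "E0 (3 * q + 3 * T) \<or> E0 (3 * q - 3 * T)"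
    using E0_of_nat_mult[of "q + T" 3] E0_of_nat_mult[of "q - T" 3] by (auto simp: algebra_simps)
  then show ?thesis
    using E0_periodic[OF T(3), of "3 * q"] E0_periodic[OF uminus_lattice[OF T(3)], of "3 * q"] by auto
qed

text \<open>Where \<open>z\<close> and \<open>2 z\<close> are generic, \<open>x (\<mu> z)\<close> and \<open>x (2 \<mu> z)\<close> have the same valuation; other points
  are sums of generic ones.\<close>

lemma E0_triple_endo:
  assumes \<mu>: "rational_endo \<mu>" and z: "E0 z"
  shows "E0 (3 * (\<mu> * z))"
proof -
  obtain A where A: "finite A" "A \<subseteq> V" "0 \<in> A"
    "\<And>z w. generic A z \<Longrightarrow> generic A w \<Longrightarrow>
      \<mu> * z \<notin> \<Lambda> \<and> x (\<mu> * z) \<noteq> 0 \<and> x (\<mu> * z) / x (\<mu> * w) \<in> V \<and>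
      (r z - r w \<in> M \<longrightarrow> x (\<mu> * z) / x (\<mu> * w) - 1 \<in> M)"
    by (rule rational_endo_ratio[OF \<mu>]) blast
  obtain B where B: "finite B" "B \<subseteq> V" "A \<subseteq> B" "\<And>z. generic B z \<Longrightarrow> generic A (2 * z)"
    by (rule generic_double[OF A(1,2)]) blast
  have gen: "E0 (3 * (\<mu> * w))" if "generic B w" for w
  proof (rule E0_triple_of_double)
    have g: "generic A w" "generic A (2 * w)" using generic_mono[OF B(3)] B(4) that by blast+
    have eq: "2 * (\<mu> * w) = \<mu> * (2 * w)" by simp
    show "\<mu> * w \<notin> \<Lambda>" using A(4)[OF g(1,1)] by blast
    show "2 * (\<mu> * w) \<notin> \<Lambda>" unfolding eq using A(4)[OF g(2,2)] by blast
    have V: "x (\<mu> * (2 * w)) / x (\<mu> * w) \<in> V" "x (\<mu> * w) / x (\<mu> * (2 * w)) \<in> V"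
      and nz: "x (\<mu> * w) \<noteq> 0" "x (\<mu> * (2 * w)) \<noteq> 0"
      using A(4)[OF g] A(4)[OF g(2,1)] by blast+
    have "x (\<mu> * (2 * w)) / x (\<mu> * w) \<notin> M"
    proof
      assume "x (\<mu> * (2 * w)) / x (\<mu> * w) \<in> M"
      from M_mult[OF this V(2)] show False using nz M_one by simp
    qed
    then show "unit (x (2 * (\<mu> * w)) / x (\<mu> * w))" unfolding eq using V(1) by (simp add: unit_def)
  qed
  have "0 \<in> B" using A(3) B(3) by auto
  then obtain w where w: "generic B w" "generic B (z + w)" by (rule exists_generic[OF B(1,2) _ z])
  have "3 * (\<mu> * z) = 3 * (\<mu> * (z + w)) - 3 * (\<mu> * w)" by (simp add: algebra_simps)
  then show ?thesis using E0_diff[OF gen[OF w(2)] gen[OF w(1)]] by simp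
qed

text \<open>For generic \<open>z\<close> the values of \<open>r\<close> at \<open>\<nu> * z\<close>
  and \<open>\<nu> * (z + w)\<close> are congruent, so either \<open>\<nu> * w\<close> or
  \<open>2 * (\<nu> * z) + \<nu> * w\<close> is in the kernel. Comparing the second alternative for
  \<open>z\<close> and \<open>2 * z\<close> leads back to the first.\<close>

lemma E1_endo:
  assumes \<nu>: "rational_endo \<nu>" and E0: "\<And>z. E0 z \<Longrightarrow> E0 (\<nu> * z)" and w: "E1 w"
  shows "E1 (\<nu> * w)"
proof (rule ccontr)
  assume not: "\<not> E1 (\<nu> * w)"
  obtain A where A: "finite A" "A \<subseteq> V" "0 \<in> A"
    "\<And>z w. generic A z \<Longrightarrow> generic A w \<Longrightarrow>
      \<nu> * z \<notin> \<Lambda> \<and> x (\<nu> * z) \<noteq> 0 \<and> x (\<nu> * z) / x (\<nu> * w) \<in> V \<and>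
      (r z - r w \<in> M \<longrightarrow> x (\<nu> * z) / x (\<nu> * w) - 1 \<in> M)"
    by (rule rational_endo_ratio[OF \<nu>]) blast
  have main: "E1 (2 * (\<nu> * z) + \<nu> * w)" if z: "generic A z" for z
  proof -
    have zw: "generic A (z + w)" using generic_add_E1[OF z w] .
    have E: "E0 (\<nu> * z)" "E0 (\<nu> * (z + w))" using z zw E0 by (auto simp: generic_def)
    have zE: "E0 z" using z by (simp add: generic_def)
    have "r (z + w) - r z \<in> M" using r_add_E1[OF zE w] .
    then have ratio: "x (\<nu> * (z + w)) / x (\<nu> * z) - 1 \<in> M" and nz: "\<nu> * z \<notin> \<Lambda>" "x (\<nu> * z) \<noteq> 0"
      "\<nu> * (z + w) \<notin> \<Lambda>" "x (\<nu> * (z + w)) \<noteq> 0"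
      using A(4)[OF zw z] A(4)[OF z z] by blast+
    have "r (\<nu> * z) - r (\<nu> * (z + w)) = (x (\<nu> * (z + w)) / x (\<nu> * z) - 1) * r (\<nu> * (z + w))"
      using nz by (simp add: r_def field_simps)
    also have "\<dots> \<in> M" using M_mult[OF ratio] E(2) by (simp add: E0_def)
    finally have "E1 (\<nu> * z + \<nu> * (z + w)) \<or> E1 (\<nu> * z - \<nu> * (z + w))"
      using same_r_imp_E1[OF E] by blast
    moreover have "\<nu> * z - \<nu> * (z + w) = - (\<nu> * w)" "\<nu> * z + \<nu> * (z + w) = 2 * (\<nu> * z) + \<nu> * w"
      by (simp_all add: algebra_simps)
    ultimately show ?thesis using not E1_uminus by metis
  qed
  obtain B where B: "finite B" "B \<subseteq> V" "A \<subseteq> B" "\<And>z. generic B z \<Longrightarrow> generic A (2 * z)"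
    by (rule generic_double[OF A(1,2)]) blast
  have "0 \<in> B" using A(3) B(3) by auto
  then obtain z where z: "generic B z"
    by (rule exists_generic[OF B(1,2) _ E1_imp_E0[OF E1_zero]])
  have 1: "E1 (2 * (\<nu> * z) + \<nu> * w)" using main generic_mono[OF B(3) z] by blast
  have 2: "E1 (2 * (\<nu> * (2 * z)) + \<nu> * w)" using main B(4)[OF z] by blast
  have "E1 (2 * (\<nu> * z))" using E1_diff[OF 2 1] by (simp add: algebra_simps)
  from E1_diff[OF 1 this] show False using not by simp
qed

lemma exists_quadratic_nonresidue_modulus:
  fixes D :: int
  assumes "D > 0"
  obtains m s :: nat where "int m = 4 * D * (int s)\<^sup>2 - 1" "s > 0" "of_nat m \<notin> M"
proof (cases "\<exists>s::nat. s > 0 \<and> of_nat s \<in> M")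
  case True
  then obtain s :: nat where s: "s > 0" "of_nat s \<in> M" by blast
  define m where "m = nat (4 * D * (int s)\<^sup>2 - 1)"
  have "4 * D * (int s)\<^sup>2 > 0" using assms s(1) by simp
  then have m: "int m = 4 * D * (int s)\<^sup>2 - 1" by (simp add: m_def)
  have "(of_nat m :: complex) = of_int (int m)" by simp
  also have "\<dots> = of_nat s * (of_int (4 * D) * of_nat s) - 1" unfolding m by (simp add: power2_eq_square)
  finally have eq: "(of_nat m :: complex) = of_nat s * (of_int (4 * D) * of_nat s) - 1" .
  have "of_nat m \<notin> M"
  proof
    assume "of_nat m \<in> M"
    moreover have "of_nat s * (of_int (4 * D) * of_nat s) \<in> M" by (rule M_mult[OF s(2)]) (intro V_intros)
    ultimately have "of_nat s * (of_int (4 * D) * of_nat s) - of_nat m \<in> M" by (intro M_diff)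
    then show False using M_one by (simp add: eq)
  qed
  then show ?thesis using that m s(1) by blast
next
  case False
  have 1: "int (nat (4 * D - 1)) = 4 * D * (int 1)\<^sup>2 - 1" and "nat (4 * D - 1) > 0" using assms by simp_all
  then have "of_nat (nat (4 * D - 1)) \<notin> M" using False by blast
  then show ?thesis by (rule that[OF 1 zero_less_one])
qed

text \<open>An endomorphism would act on the multiplicative group of the nodal reduction through an integer
  \<open>d\<close> modulo \<open>m\<close>, which is impossible when \<open>t\<^sup>2 - 4 n\<close> is not a square modulo \<open>m\<close>.\<close>

theorem no_complex_multiplication:
  fixes t n :: int
  assumes "rational_endo \<mu>" "rational_endo (3 * \<mu>)" and \<mu>: "\<mu>\<^sup>2 = of_int t * \<mu> - of_int n" and disc: "t\<^sup>2 < 4 * n"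
  shows False
proof -
  define \<nu> where "\<nu> = 3 * \<mu>"
  have E0: "E0 (\<nu> * z)" if "E0 z" for z
    using E0_triple_endo[OF assms(1) that] by (simp add: \<nu>_def mult.assoc)
  have E1: "E1 (\<nu> * z)" if "E1 z" for z
    using E1_endo[OF assms(2)[folded \<nu>_def] E0 that] .
  define D where "D = 9 * (4 * n - t\<^sup>2)"
  have D: "D > 0" using disc by (simp add: D_def)
  obtain m s :: nat where ms: "int m = 4 * D * (int s)\<^sup>2 - 1" "s > 0" "of_nat m \<notin> M"
    by (rule exists_quadratic_nonresidue_modulus[OF D])
  have "4 * D * (int s)\<^sup>2 \<ge> 4 * 1 * 1" using D ms(2) by (intro mult_mono) auto
  then have m3: "m \<ge> 3" using ms(1) by linarith
  define \<zeta> where "\<zeta> = cis (2 * pi / of_nat m)"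
  have \<zeta>m: "\<zeta> ^ m = 1" unfolding \<zeta>_def Complex.DeMoivre using m3 by simp
  have \<zeta>0: "\<zeta> \<noteq> 0" by (simp add: \<zeta>_def)
  define \<zeta>' where "\<zeta>' = 1 / \<zeta>"
  have zz: "\<zeta> * \<zeta>' = 1" using \<zeta>0 by (simp add: \<zeta>'_def)
  have \<zeta>_dvd: "m dvd e" if "\<zeta> ^ e = 1" for e
  proof -
    have "\<zeta> ^ e = \<zeta> ^ (e mod m) * (\<zeta> ^ m) ^ (e div m)"
      by (simp flip: power_add power_mult)
    then have 1: "\<zeta> ^ (e mod m) = \<zeta> ^ 0" using that \<zeta>m by simp
    have "inj_on (\<lambda>d. \<zeta> ^ d) {..<m}"
    proof -
      have "\<zeta> ^ d = cis (2 * pi * real d / real m)" for d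
        unfolding \<zeta>_def Complex.DeMoivre by (simp add: mult_ac)
      then show ?thesis using bij_betw_imp_inj_on[OF Complex.bij_betw_roots_unity[of m]] m3 by simp
    qed
    from inj_onD[OF this 1] have "e mod m = 0" using m3 by simp
    then show ?thesis by auto
  qed
  have mpos: "0 < m" using m3 by simp
  have inV: "w \<in> V" if "w ^ m = 1" for w
  proof (rule monic_root_mem[of "monom 1 m - 1"])
    have deg: "degree (monom (1 :: complex) m - 1) = m"
      using degree_add_eq_left[of "- 1" "monom (1 :: complex) m"] mpos by (simp add: degree_monom_eq)
    show "lead_coeff (monom (1 :: complex) m - 1) = 1" unfolding deg using mpos by simp
    show "coeff (monom (1 :: complex) m - 1) i \<in> V" for i using zero_mem one_mem by (auto simp: coeff_1 intro: V_intros)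
    show "poly (monom 1 m - 1) w = 0" using that by (simp add: poly_monom)
  qed
  have \<zeta>V: "\<zeta> \<in> V" "\<zeta>' \<in> V" using inV \<zeta>m by (auto simp: \<zeta>'_def power_divide)
  \<comment> \<open>A point with this value of \<open>r\<close> corresponds, up to inversion, to the
    primitive root of unity \<open>\<zeta>\<close> in the multiplicative group.\<close>
  define \<rho> where "\<rho> = \<zeta> + \<zeta>' - 2"
  have \<zeta>1: "\<zeta> \<noteq> 1"
  proof
    assume "\<zeta> = 1"
    then have "m dvd 1" using \<zeta>_dvd[of 1] by simp
    then show False using m3 by simp
  qed
  have "(\<zeta> - 1)\<^sup>2 * \<zeta>' = (\<zeta> * \<zeta>') * \<zeta> - 2 * (\<zeta> * \<zeta>') + \<zeta>'"
    by (simp add: power2_eq_square algebra_simps)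
  then have "\<rho> = (\<zeta> - 1)\<^sup>2 * \<zeta>'" by (simp add: zz \<rho>_def)
  then have \<rho>0: "\<rho> \<noteq> 0" using \<zeta>1 \<zeta>0 by (simp add: \<zeta>'_def)
  obtain P where P: "P \<notin> \<Lambda>" "x P = 1 / \<rho>" using x_surj by blast
  have rP: "r P = \<rho>" "proper P" using P \<rho>0 by (simp_all add: r_def proper_def)
  have P0: "E0 P" unfolding E0_def rP(1) \<rho>_def using rP(2) \<zeta>V by (auto intro: V_intros)
  have rmP: "r (of_nat j * P) - (\<zeta> ^ j + \<zeta>' ^ j - 2) \<in> M" for j
    by (rule r_multiple[OF P0 zz \<zeta>V]) (simp add: rP(1) \<rho>_def M_zero)
  have \<zeta>'m: "\<zeta>' ^ m = 1" using \<zeta>m by (simp add: \<zeta>'_def power_divide)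
  have "E1 (of_nat m * P)"
    using rmP[of m] E0_of_nat_mult[OF P0, of m] \<zeta>m \<zeta>'m by (simp add: E0_def E1_def)
  from E1[OF this] have mn: "E1 (of_nat m * (\<nu> * P))" by (simp add: mult_ac)
  have nP: "E0 (\<nu> * P)" using E0[OF P0] .
  \<comment> \<open>Multiplicative coordinate of the image point: its roots \<open>w\<close> and
    \<open>v\<close> are inverse to each other and satisfy
    \<open>r (\<nu> * P) = w + v - 2\<close>.\<close>
  obtain w where w: "poly [:1, - (r (\<nu> * P) + 2), 1:] w = 0"
    using alg_closed_imp_poly_has_root[of "[:1, - (r (\<nu> * P) + 2), 1:]"] by auto
  define v where "v = r (\<nu> * P) + 2 - w"
  have wv: "w * v = 1" using w by (simp add: v_def algebra_simps)
  have rnP: "r (\<nu> * P) = w + v - 2" by (simp add: v_def)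
  have wV: "w \<in> V" "v \<in> V"
    using sum_prod_mem[of w v] wv nP one_mem by (auto simp: v_def E0_def intro: V_intros)
  have "r (of_nat m * (\<nu> * P)) - (w ^ m + v ^ m - 2) \<in> M"
    by (rule r_multiple[OF nP wv wV]) (simp add: rnP M_zero)
  then have "w ^ m + v ^ m - 2 \<in> M" by (rule M_of_cong[OF conjunct2[OF mn[unfolded E1_def]]])
  then have "w ^ m * (w ^ m + v ^ m - 2) \<in> M" by (rule M_mult'[OF power_mem[OF wV(1)]])
  moreover have "w ^ m * v ^ m = 1" using wv by (simp flip: power_mult_distrib)
  ultimately have "(w ^ m - 1)\<^sup>2 \<in> M" by (simp add: power2_eq_square algebra_simps)
  then have "w ^ m - 1 \<in> M" using M_prime_power[of "w ^ m - 1" 2] wV by (auto intro: V_intros)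
  \<comment> \<open>\<open>w ^ m - 1\<close> is the product of all \<open>w - \<zeta> ^ d\<close>,
    and \<open>M\<close> is prime.\<close>
  then obtain d where d: "w - \<zeta> ^ d \<in> M"
    using M_prime_prod[of "{..<m}" "\<lambda>d. w - \<zeta> ^ d"] wV \<zeta>V
    unfolding power_minus_1_factorization[OF mpos] \<zeta>_def[symmetric] by (auto intro: V_intros)
  have zzd: "\<zeta> ^ d * \<zeta>' ^ d = 1" using zz by (simp flip: power_mult_distrib)
  have "v - \<zeta>' ^ d = - (w - \<zeta> ^ d) * (v * \<zeta>' ^ d)"
    using wv zzd by (simp add: algebra_simps)
  also have "\<dots> \<in> M" by (intro M_mult M_uminus d V_intros wV \<zeta>V)
  finally have d': "v - \<zeta>' ^ d \<in> M" .
  have "r (\<nu> * P) - r (of_nat d * P) = (w - \<zeta> ^ d) + (v - \<zeta>' ^ d) - (r (of_nat d * P) - (\<zeta> ^ d + \<zeta>' ^ d - 2))"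
    by (simp add: rnP)
  also have "\<dots> \<in> M" by (intro M_diff[OF _ rmP] M_add d d')
  finally have "E1 (\<nu> * P + of_nat d * P) \<or> E1 (\<nu> * P - of_nat d * P)"
    using same_r_imp_E1[OF nP E0_of_nat_mult[OF P0]] by blast
  \<comment> \<open>Allowing negative \<open>d\<close> absorbs the sign ambiguity.\<close>
  then obtain d :: int where d: "E1 (\<nu> * P - of_int d * P)"
    by (metis (no_types, opaque_lifting) diff_minus_eq_add mult_minus_left of_int_minus of_int_of_nat_eq)
  define T N0 where "T = 3 * t" and "N0 = 9 * n"
  have \<nu>2: "\<nu> * \<nu> = of_int T * \<nu> - of_int N0"
  proof -
    have "\<nu> * \<nu> = 9 * \<mu>\<^sup>2" by (simp add: \<nu>_def power2_eq_square)
    then show ?thesis unfolding \<mu> by (simp add: \<nu>_def T_def N0_def algebra_simps)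
  qed
  \<comment> \<open>Division of the quadratic polynomial of \<open>\<nu>\<close> by
    \<open>X - d\<close>: the quotient is \<open>X - (T - d)\<close>, and an integer multiple of
    \<open>P\<close> remains.\<close>
  have "E1 (\<nu> * (\<nu> * P - of_int d * P) - of_int (T - d) * (\<nu> * P - of_int d * P))"
    by (intro E1_diff E1 E1_of_int_mult d)
  moreover have "\<nu> * (\<nu> * P - of_int d * P) - of_int (T - d) * (\<nu> * P - of_int d * P) = of_int ((T - d) * d - N0) * P"
  proof -
    have "\<nu> * (\<nu> * P - of_int d * P) = (\<nu> * \<nu>) * P - of_int d * (\<nu> * P)" by (simp add: algebra_simps)
    then show ?thesis unfolding \<nu>2 by (simp add: algebra_simps)
  qed
  ultimately have "E1 (of_int ((T - d) * d - N0) * P)" by simp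
  define e where "e = nat \<bar>(T - d) * d - N0\<bar>"
  have "E1 (of_nat e * P)"
  proof (cases "(T - d) * d - N0 \<ge> 0")
    case True
    then have "of_nat e = (of_int ((T - d) * d - N0) :: complex)" by (simp add: e_def)
    then show ?thesis using \<open>E1 (of_int ((T - d) * d - N0) * P)\<close> by simp
  next
    case False
    then have "of_nat e = (- of_int ((T - d) * d - N0) :: complex)" by (simp add: e_def)
    then have "of_nat e * P = - (of_int ((T - d) * d - N0) * P)" by (simp only: mult_minus_left)
    then show ?thesis using \<open>E1 (of_int ((T - d) * d - N0) * P)\<close> E1_uminus by (simp only:)
  qed
  then have "r (of_nat e * P) \<in> M" by (simp add: E1_def)
  then have "\<zeta> ^ e + \<zeta>' ^ e - 2 \<in> M" using rmP[of e] by (rule M_of_cong)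
  then have "\<zeta> ^ e * (\<zeta> ^ e + \<zeta>' ^ e - 2) \<in> M" by (rule M_mult'[OF power_mem[OF \<zeta>V(1)]])
  moreover have "\<zeta> ^ e * \<zeta>' ^ e = 1" using zz by (simp flip: power_mult_distrib)
  ultimately have "(\<zeta> ^ e - 1)\<^sup>2 \<in> M" by (simp add: power2_eq_square algebra_simps)
  then have "\<zeta> ^ e - 1 \<in> M" using M_prime_power[of "\<zeta> ^ e - 1" 2] \<zeta>V by (auto intro: V_intros)
  moreover have "(\<zeta> ^ e) ^ m = 1" using \<zeta>m by (metis power_mult mult.commute power_one)
  ultimately have "\<zeta> ^ e = 1" using root_of_unity_cong_1 ms(3) by blast
  then have "m dvd e" by (rule \<zeta>_dvd)
  then have "int m dvd (T - d) * d - N0" by (simp add: e_def)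
  \<comment> \<open>The factor -4 completes the square with \<open>4 * N0 - T\<^sup>2 = D\<close>;
    the factor \<open>4 * (int s)\<^sup>2\<close> turns \<open>D\<close> into
    \<open>int m + 1\<close>.\<close>
  then have "int m dvd - 4 * (4 * (int s)\<^sup>2) * ((T - d) * d - N0)" by (rule dvd_mult)
  moreover have "- 4 * (4 * (int s)\<^sup>2) * ((T - d) * d - N0) = (2 * int s * (2 * d - T))\<^sup>2 + (4 * D * (int s)\<^sup>2)"
    by (simp add: D_def T_def N0_def power2_eq_square algebra_simps)
  moreover have "(2 * int s * (2 * d - T))\<^sup>2 + (4 * D * (int s)\<^sup>2) = (2 * int s * (2 * d - T))\<^sup>2 + 1 + int m"
    by (simp add: ms(1))
  ultimately have "int m dvd (2 * int s * (2 * d - T))\<^sup>2 + 1 + int m" by (simp only:)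
  then have "int m dvd (2 * int s * (2 * d - T))\<^sup>2 + 1" by (metis dvd_add_triv_right_iff)
  moreover have "int m mod 4 = 3" unfolding ms(1) mult.assoc by presburger
  ultimately show False using square_plus_one_not_dvd[of "int m"] mpos by simp
qed

end

section \<open>Integral models of the lattice\<close>

text \<open>In a rational space of dimension 2 the elements 1, \<open>\<alpha>\<close> and its
  square are dependent, while 1 and \<open>\<alpha>\<close> are independent because
  \<open>\<alpha>\<close> is not real. Denominators are then cleared.\<close>

lemma imaginary_quadratic_equation:
  assumes "imaginary_quadratic_point \<alpha>"
  obtains a b c :: int where "a \<noteq> 0" "of_int a * \<alpha>\<^sup>2 + of_int b * \<alpha> + of_int c = 0"
proof -
  interpret C: field complex_field by (rule field_from_type_algebra)
  have ops [simp]: "carrier complex_field = UNIV" "\<And>u v. u \<otimes>\<^bsub>complex_field\<^esub> v = u * v"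
    "\<And>u v. u \<oplus>\<^bsub>complex_field\<^esub> v = u + v" "\<one>\<^bsub>complex_field\<^esub> = 1" "\<zero>\<^bsub>complex_field\<^esub> = 0"
    by (simp_all add: ring_of_type_algebra_def)
  have minus [simp]: "\<ominus>\<^bsub>complex_field\<^esub> u = - u" for u
    by (rule C.minus_equality) simp_all
  have inv: "inv\<^bsub>complex_field\<^esub> u = inverse u" if "u \<noteq> 0" for u
    by (rule C.comm_inv_char) (use that in simp_all)
  have rats: "subfield \<rat> complex_field"
  proof (rule C.subfieldI'[OF C.subringI])
    show "inv\<^bsub>complex_field\<^esub> k \<in> \<rat>" if "k \<in> \<rat> - {\<zero>\<^bsub>complex_field\<^esub>}" for k
      using that inv by simp
  qed simp_all
  define K where "K = generate_field complex_field {\<alpha>}"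
  have dim: "C.dimension 2 \<rat> K" and Im: "Im \<alpha> > 0"
    using assms by (simp_all add: imaginary_quadratic_point_def imaginary_quadratic_field_def K_def)
  have mem: "\<alpha> \<in> K" "1 \<in> K" "\<alpha>\<^sup>2 \<in> K"
    using generate_field.incl[of \<alpha> "{\<alpha>}" complex_field] generate_field.one[of complex_field "{\<alpha>}"]
      generate_field.eng_mult[of \<alpha> complex_field "{\<alpha>}" \<alpha>]
    by (simp_all add: K_def power2_eq_square)
  have dep: "\<not> C.independent \<rat> [\<alpha>\<^sup>2, \<alpha>, 1]"
  proof
    assume "C.independent \<rat> [\<alpha>\<^sup>2, \<alpha>, 1]"
    then have "length [\<alpha>\<^sup>2, \<alpha>, 1] \<le> 2"
      by (rule C.independent_length_le_dimension[OF rats dim]) (use mem in auto)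
    then show False by simp
  qed
  have span0: "C.line_extension \<rat> 1 {0} = \<rat>" by (auto simp: C.line_extension_mem_iff)
  then have span1: "C.Span \<rat> [1] = \<rat>" and span2: "C.Span \<rat> [\<alpha>, 1] = C.line_extension \<rat> \<alpha> \<rat>"
    by simp_all
  have "\<alpha> \<notin> \<rat>"
  proof
    assume "\<alpha> \<in> \<rat>"
    then obtain p q :: int where "\<alpha> = of_int p / of_int q" by (rule Rats_cases')
    then have "\<alpha> = of_real (of_int p / of_int q)" by simp
    then have "Im \<alpha> = 0" by (simp only: Im_complex_of_real)
    then show False using Im by simp
  qed
  have "C.independent \<rat> [\<alpha>, 1]"
    using \<open>\<alpha> \<notin> \<rat>\<close> span1 by (intro C.li_Cons) auto
  then have "\<alpha>\<^sup>2 \<in> C.Span \<rat> [\<alpha>, 1]"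
    using dep C.li_Cons[of "\<alpha>\<^sup>2" \<rat> "[\<alpha>, 1]"] by auto
  then obtain p q where pq: "\<alpha>\<^sup>2 = p * \<alpha> + q" "p \<in> \<rat>" "q \<in> \<rat>" unfolding span2 C.line_extension_mem_iff by auto
  obtain p1 p2 :: int where p: "p = of_int p1 / of_int p2" "p2 > 0"
    using pq(2) by (auto elim!: Rats_cases')
  obtain q1 q2 :: int where q: "q = of_int q1 / of_int q2" "q2 > 0"
    using pq(3) by (auto elim!: Rats_cases')
  show ?thesis
  proof (rule that)
    show "p2 * q2 \<noteq> 0" using p q by simp
    have "of_int (p2 * q2) * \<alpha>\<^sup>2 = of_int (p1 * q2) * \<alpha> + of_int (q1 * p2)"
      unfolding pq(1) p(1) q(1) using p(2) q(2) by (simp add: field_simps)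
    then show "of_int (p2 * q2) * \<alpha>\<^sup>2 + of_int (- p1 * q2) * \<alpha> + of_int (- q1 * p2) = 0" by simp
  qed
qed

section \<open>Weierstrass equations realized by an affine change of \<open>wp\<close>\<close>

context period_ratio
begin

text \<open>The conditions on \<open>c4\<close> and \<open>c6\<close> say that the cubic with
  coefficients 4, \<open>b2\<close>, \<open>2 * b4\<close>, \<open>b6\<close>, evaluated at
  \<open>u * wp z - b2 / 12\<close>, is \<open>u ^ 3\<close> times the Weierstrass cubic.\<close>

lemma wp_model:
  assumes u: "u \<noteq> 0" and b8: "4 * b8 = b2 * b6 - b4\<^sup>2"
    and c4: "b2\<^sup>2 - 24 * b4 = 12 * u\<^sup>2 * g2" and c6: "- (b2 ^ 3) + 36 * b2 * b4 - 216 * b6 = 216 * u ^ 3 * g3"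
  shows "elliptic_model L (\<lambda>z. u * wp z - b2 / 12) b2 b4 b6 b8"
proof -
  define \<beta> where "\<beta> = b2 / 12"
  have b2: "b2 = 12 * \<beta>" by (simp add: \<beta>_def)
  have "24 * b4 = 24 * (6 * \<beta>\<^sup>2 - u\<^sup>2 * g2 / 2)" using c4 by (simp add: b2 power2_eq_square algebra_simps)
  then have b4: "b4 = 6 * \<beta>\<^sup>2 - u\<^sup>2 * g2 / 2" by (subst (asm) mult_left_cancel) auto
  have "216 * b6 = 216 * (4 * \<beta> ^ 3 - \<beta> * u\<^sup>2 * g2 - u ^ 3 * g3)"
    using c6 by (simp add: b2 b4 power2_eq_square power3_eq_cube algebra_simps)
  then have b6: "b6 = 4 * \<beta> ^ 3 - \<beta> * u\<^sup>2 * g2 - u ^ 3 * g3" by (subst (asm) mult_left_cancel) auto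
  have b8': "b8 = (12 * \<beta> * (4 * \<beta> ^ 3 - \<beta> * u\<^sup>2 * g2 - u ^ 3 * g3) - (6 * \<beta>\<^sup>2 - u\<^sup>2 * g2 / 2)\<^sup>2) / 4"
    using b8 unfolding b2 b4 b6 by (simp add: eq_divide_eq mult.commute)
  let ?x = "\<lambda>z. u * wp z - \<beta>"
  have cubic: "4 * (?x z) ^ 3 + b2 * (?x z)\<^sup>2 + 2 * b4 * ?x z + b6 = u ^ 3 * (4 * wp z ^ 3 - g2 * wp z - g3)" for z
    unfolding b2 b4 b6 by (simp add: power2_eq_square power3_eq_cube field_simps)
  have "elliptic_model L ?x b2 b4 b6 b8"
  proof
    show "\<exists>z. z \<notin> L \<and> ?x z = c" for c
    proof -
      obtain z where "z \<notin> L" "wp z = (c + \<beta>) / u" by (rule wp_surj)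
      then show ?thesis using u by (intro exI[of _ z]) simp
    qed
    fix z w
    assume zw: "z \<notin> L" "w \<notin> L" "z + w \<notin> L" "z - w \<notin> L"
    show "?x z \<noteq> ?x w" using wp_inj[OF zw] u by simp
    define a c p q where "a = wp z" and "c = wp w" and "p = wp (z + w)" and "q = wp (z - w)"
    have s: "(a - c)\<^sup>2 * (p + q) = 2 * a * c * (a + c) - g2 / 2 * (a + c) - g3"
      and m: "(a - c)\<^sup>2 * (p * q) = (a * c + g2 / 4)\<^sup>2 + g3 * (a + c)"
      using wp_sum[OF zw] wp_prod[OF zw] by (simp_all add: a_def c_def p_def q_def)
    have "(u * a - \<beta> - (u * c - \<beta>))\<^sup>2 * (u * p - \<beta> + (u * q - \<beta>)) = u ^ 3 * ((a - c)\<^sup>2 * (p + q)) - 2 * \<beta> * u\<^sup>2 * (a - c)\<^sup>2"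
      by (simp add: power2_eq_square power3_eq_cube algebra_simps)
    also have "\<dots> = 2 * (u * a - \<beta>) * (u * c - \<beta>) * (u * a - \<beta> + (u * c - \<beta>)) + b2 * (u * a - \<beta>) * (u * c - \<beta>)
        + b4 * (u * a - \<beta> + (u * c - \<beta>)) + b6"
      unfolding s b2 b4 b6 by (simp add: power2_eq_square power3_eq_cube field_simps)
    finally show "(?x z - ?x w)\<^sup>2 * (?x (z + w) + ?x (z - w)) =
        2 * ?x z * ?x w * (?x z + ?x w) + b2 * ?x z * ?x w + b4 * (?x z + ?x w) + b6"
      by (simp only: a_def c_def p_def q_def)
    have "(u * a - \<beta> - (u * c - \<beta>))\<^sup>2 * ((u * p - \<beta>) * (u * q - \<beta>)) =
        u ^ 4 * ((a - c)\<^sup>2 * (p * q)) - \<beta> * u ^ 3 * ((a - c)\<^sup>2 * (p + q)) + \<beta>\<^sup>2 * u\<^sup>2 * (a - c)\<^sup>2"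
      by (simp add: power2_eq_square power3_eq_cube power4_eq_xxxx algebra_simps)
    also have "\<dots> = ((u * a - \<beta>) * (u * c - \<beta>))\<^sup>2 - b4 * (u * a - \<beta>) * (u * c - \<beta>) - b6 * (u * a - \<beta> + (u * c - \<beta>)) - b8"
      unfolding s m b4 b6 b8' by (simp add: power2_eq_square power3_eq_cube power4_eq_xxxx field_simps)
    finally show "(?x z - ?x w)\<^sup>2 * (?x (z + w) * ?x (z - w)) =
        (?x z * ?x w)\<^sup>2 - b4 * ?x z * ?x w - b6 * (?x z + ?x w) - b8"
      by (simp only: a_def c_def p_def q_def)
  next
    fix z assume z: "z \<notin> L" "2 * z \<notin> L"
    define a p where "a = wp z" and "p = wp (2 * z)"
    have d: "p * (4 * a ^ 3 - g2 * a - g3) = (a\<^sup>2 + g2 / 4)\<^sup>2 + 2 * g3 * a"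
      using wp_double[OF z] by (simp add: a_def p_def)
    have "(u * p - \<beta>) * (u ^ 3 * (4 * a ^ 3 - g2 * a - g3)) = u ^ 4 * (p * (4 * a ^ 3 - g2 * a - g3)) - \<beta> * u ^ 3 * (4 * a ^ 3 - g2 * a - g3)"
      by (simp add: power3_eq_cube power4_eq_xxxx algebra_simps)
    also have "\<dots> = (u * a - \<beta>) ^ 4 - b4 * (u * a - \<beta>)\<^sup>2 - 2 * b6 * (u * a - \<beta>) - b8"
      unfolding d b4 b6 b8' by (simp add: power2_eq_square power3_eq_cube power4_eq_xxxx field_simps)
    finally show "?x (2 * z) * (4 * (?x z) ^ 3 + b2 * (?x z)\<^sup>2 + 2 * b4 * ?x z + b6) =
        (?x z) ^ 4 - b4 * (?x z)\<^sup>2 - 2 * b6 * ?x z - b8"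
      unfolding cubic by (simp only: a_def p_def)
  next
    fix z assume "z \<notin> L" "2 * z \<in> L"
    then show "4 * (?x z) ^ 3 + b2 * (?x z)\<^sup>2 + 2 * b4 * ?x z + b6 = 0"
      unfolding cubic using wp_half_period by simp
  qed (auto simp: zero_in_lattice add_in_lattice uminus_in_lattice wp_even wp_periodic)
  then show ?thesis by (simp add: \<beta>_def)
qed

lemma wp_model_rational_endo:
  assumes "elliptic_model L (\<lambda>z. u * wp z - \<beta>) b2 b4 b6 b8" and u: "u \<noteq> 0"
    and \<nu>: "\<And>l. l \<in> L \<Longrightarrow> \<nu> * l \<in> L" and \<nu>': "\<And>l. l \<in> L \<Longrightarrow> \<nu>' * l \<in> L" and n: "\<nu>' * \<nu> = of_int n" "n \<noteq> 0"
  shows "elliptic_model.rational_endo L (\<lambda>z. u * wp z - \<beta>) \<nu>"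
proof -
  interpret elliptic_model L "\<lambda>z. u * wp z - \<beta>" b2 b4 b6 b8 by fact
  obtain f g where fg: "g \<noteq> 0"
    "\<And>z. z \<notin> L \<Longrightarrow> poly g (wp z) \<noteq> 0 \<Longrightarrow> \<nu> * z \<notin> L \<and> wp (\<nu> * z) * poly g (wp z) = poly f (wp z)"
    by (rule wp_mult_rational[OF \<nu> \<nu>' n]) (assumption, assumption, rule that, assumption, blast)
  define h where "h = [:\<beta> / u, 1 / u:]"
  have h: "poly h (u * y - \<beta>) = y" for y using u by (simp add: h_def field_simps)
  define F G where "F = Polynomial.smult u (f \<circ>\<^sub>p h) - Polynomial.smult \<beta> (g \<circ>\<^sub>p h)" and "G = g \<circ>\<^sub>p h"
  have G: "poly G (u * y - \<beta>) = poly g y" and F: "poly F (u * y - \<beta>) = u * poly f y - \<beta> * poly g y" for y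
    by (simp_all add: F_def G_def poly_pcompose h)
  have "G \<noteq> 0"
  proof
    assume "G = 0"
    then have "\<forall>y. poly g y = 0" using G by simp
    then show False using fg(1) by (simp add: poly_all_0_iff_0)
  qed
  moreover have "\<nu> * z \<notin> L \<and> (u * wp (\<nu> * z) - \<beta>) * poly G (u * wp z - \<beta>) = poly F (u * wp z - \<beta>)"
    if "z \<notin> L" "poly G (u * wp z - \<beta>) \<noteq> 0" for z
    using fg(2)[of z] that unfolding G F by (auto simp: left_diff_distrib mult.assoc)
  moreover have "\<nu> \<noteq> 0" using n by auto
  ultimately show ?thesis unfolding rational_endo_def using \<nu> by blast
qed

definition j_invariant :: complex where
  "j_invariant = 1728 * g2 ^ 3 / (g2 ^ 3 - 27 * g3\<^sup>2)"

text \<open>Here \<open>c4\<close>, \<open>c6\<close> and \<open>d\<close> are the usual covariants and the discriminant of a Weierstrass equation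
  whose \<open>j\<close>-invariant is that of the lattice.\<close>

lemma exists_scaling:
  assumes c: "c4 ^ 3 - c6\<^sup>2 = 1728 * d" "c4 ^ 3 = j_invariant * d" "d \<noteq> 0"
  obtains u where "u \<noteq> 0" "c4 = 12 * u\<^sup>2 * g2" "c6 = 216 * u ^ 3 * g3"
proof -
  have "(g2 ^ 3 - 27 * g3\<^sup>2) * (1728 * c4 ^ 3) = (g2 ^ 3 - 27 * g3\<^sup>2) * j_invariant * (1728 * d)"
    unfolding c(2) by simp
  also have "\<dots> = 1728 * (g2 ^ 3 * (c4 ^ 3 - c6\<^sup>2))"
    unfolding c(1) using discriminant_nonzero by (simp add: j_invariant_def)
  finally have rel: "27 * g3\<^sup>2 * c4 ^ 3 = g2 ^ 3 * c6\<^sup>2" by (simp add: algebra_simps)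
  have c0: "c4 \<noteq> 0 \<or> c6 \<noteq> 0" using c(1,3) by auto
  have g0: "g2 \<noteq> 0 \<or> g3 \<noteq> 0" using discriminant_nonzero by auto
  show ?thesis
  proof (cases "g2 = 0 \<or> g3 = 0")
    case False
    then have nz: "c4 \<noteq> 0" "c6 \<noteq> 0" using rel c0 by auto
    define u where "u = c6 * g2 / (18 * g3 * c4)"
    have u: "u * (18 * g3 * c4) = c6 * g2" using False nz by (simp add: u_def)
    have "(18 * g3 * c4)\<^sup>2 * (12 * u\<^sup>2 * g2) = 12 * (u * (18 * g3 * c4))\<^sup>2 * g2"
      by (simp add: power_mult_distrib)
    also have "\<dots> = 12 * (g2 ^ 3 * c6\<^sup>2)" unfolding u by (simp add: power2_eq_square power3_eq_cube)
    also have "\<dots> = (18 * g3 * c4)\<^sup>2 * c4" unfolding rel[symmetric] by (simp add: power2_eq_square power3_eq_cube)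
    finally have 1: "12 * u\<^sup>2 * g2 = c4" using False nz by simp
    have "g2 * (216 * u ^ 3 * g3) = 18 * g3 * u * (12 * u\<^sup>2 * g2)"
      by (simp add: power2_eq_square power3_eq_cube)
    also have "\<dots> = g2 * c6" unfolding 1 using u by (simp add: mult_ac)
    finally have 2: "216 * u ^ 3 * g3 = c6" using False by simp
    show ?thesis using that[of u] 1 2 nz by auto
  next
    case True
    show ?thesis
    proof (cases "g2 = 0")
      case True
      then have "c4 = 0" "g3 \<noteq> 0" "c6 \<noteq> 0" using rel g0 c0 by auto
      obtain u where "poly [:- (c6 / (216 * g3)), 0, 0, 1:] u = 0"
        using alg_closed_imp_poly_has_root[of "[:- (c6 / (216 * g3)), 0, 0, 1:]"] by auto
      then have "u ^ 3 = c6 / (216 * g3)" by (simp add: power3_eq_cube mult.assoc)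
      moreover from this have "u \<noteq> 0" using \<open>g3 \<noteq> 0\<close> \<open>c6 \<noteq> 0\<close> by auto
      ultimately show ?thesis using that[of u] True \<open>c4 = 0\<close> \<open>g3 \<noteq> 0\<close> by simp
    next
      case False
      then have g3: "g3 = 0" "g2 \<noteq> 0" using True by auto
      then have "c6 = 0" "c4 \<noteq> 0" using rel c0 by auto
      define u where "u = csqrt (c4 / (12 * g2))"
      have "u\<^sup>2 = c4 / (12 * g2)" by (simp add: u_def)
      moreover from this have "u \<noteq> 0" using g3 \<open>c4 \<noteq> 0\<close> by auto
      ultimately show ?thesis using that[of u] g3 \<open>c6 = 0\<close> by simp
    qed
  qed
qed

end

text \<open>Converse of \<open>monic_root_mem\<close>: a monic polynomial with a coefficient outside
  \<open>V\<close> must have a root outside \<open>V\<close>.\<close>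

lemma (in alg_closed_valuation_ring) coeff_mem_if_roots_mem:
  assumes "\<And>t. poly p t = 0 \<Longrightarrow> t \<in> V" "lead_coeff p = 1"
  shows "coeff p i \<in> V"
proof -
  have p0: "p \<noteq> 0" using assms(2) by auto
  obtain A where A: "p = Polynomial.smult (lead_coeff p) (\<Prod>a\<in>#A. [:- a, 1:])"
    using alg_closed_imp_factorization[OF p0] by metis
  then have p: "p = (\<Prod>a\<in>#A. [:- a, 1:])" using assms(2) by simp
  have AV: "a \<in> V" if a: "a \<in># A" for a
  proof (rule assms(1))
    obtain B where "A = add_mset a B" using a by (metis insert_DiffM)
    then show "poly p a = 0" unfolding p by simp
  qed
  have "coeff (\<Prod>a\<in>#B. [:- a, 1:]) i \<in> V" if "B \<subseteq># A" for B i
    using that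
  proof (induction B arbitrary: i)
    case (add a B)
    have a: "a \<in> V" and B: "B \<subseteq># A"
      using add.prems AV by (auto dest: mset_subset_eq_insertD simp: subset_mset.less_imp_le)
    have "coeff ([:- a, 1:] * (\<Prod>a\<in>#B. [:- a, 1:])) i =
        - a * coeff (\<Prod>a\<in>#B. [:- a, 1:]) i + (case i of 0 \<Rightarrow> 0 | Suc j \<Rightarrow> coeff (\<Prod>a\<in>#B. [:- a, 1:]) j)"
      by (simp add: coeff_pCons split: nat.split)
    also have "\<dots> \<in> V"
      using add.IH[OF B] a zero_mem by (cases i) (auto intro!: V_intros)
    finally show ?case by simp
  qed (auto simp: coeff_1 intro: V_intros)
  then show ?thesis unfolding p by simp
qed

section \<open>Integrality of the \<open>j\<close>-invariant and models with good reduction\<close>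

context period_ratio
begin

lemma j_invariant_integral:
  fixes t n :: int
  assumes V: "valuation_ring V" and \<mu>: "\<And>l. l \<in> L \<Longrightarrow> \<mu> * l \<in> L"
    and eq: "\<mu>\<^sup>2 = of_int t * \<mu> - of_int n" and disc: "t\<^sup>2 < 4 * n"
  shows "j_invariant \<in> V"
proof (rule ccontr)
  assume j: "j_invariant \<notin> V"
  interpret valuation_ring V by fact
  interpret alg_closed_valuation_ring V ..
  \<comment> \<open>The nodal model has \<open>c4 = 1 - 24 * b\<close> and discriminant
    \<open>b ^ 3 * (1 - 27 * b)\<close>. With \<open>s = 1 / b\<close> the condition on its
    \<open>j\<close>-invariant is \<open>s * (s - 24) ^ 3 = j_invariant * (s - 27)\<close>, whose
    difference of sides is \<open>p\<close>. A root outside \<open>V\<close> gives \<open>b\<close>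
    in \<open>M\<close>.\<close>
  define p where "p = [:27 * j_invariant, - 13824 - j_invariant, 1728, - 72, 1:]"
  have "\<exists>t. poly p t = 0 \<and> t \<notin> V"
  proof (rule ccontr)
    assume "\<not> ?thesis"
    then have "coeff p 1 \<in> V" by (intro coeff_mem_if_roots_mem) (auto simp: p_def)
    then have "- 13824 - j_invariant \<in> V" by (simp add: p_def)
    from diff_mem[OF _ this, of "- 13824"] have "- 13824 - (- 13824 - j_invariant) \<in> V"
      by (auto intro: V_intros)
    then show False using j by simp
  qed
  then obtain s where s: "poly p s = 0" "s \<notin> V" by blast
  define b where "b = 1 / s"
  have s0: "s \<noteq> 0" using s(2) zero_mem by auto
  have b: "b \<in> M" "b \<noteq> 0" using inverse_in_M'[OF s(2)] s0 by (simp_all add: b_def)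
  have bV: "b \<in> V" using M_imp_V[OF b(1)] .
  have sb: "s * b = 1" using s0 by (simp add: b_def)
  have "b ^ 4 * poly p s = (s * b) * (s * b - 24 * b) ^ 3 - j_invariant * b ^ 3 * (s * b - 27 * b)"
    by (simp add: p_def power3_eq_cube power4_eq_xxxx algebra_simps)
  then have root: "(1 - 24 * b) ^ 3 = j_invariant * (b ^ 3 * (1 - 27 * b))" using s(1) sb by simp
  have unit: "unit (1 - 27 * b)" using M_mult'[OF numeral_mem b(1)] by (rule unit_one_minus_M)
  have d0: "b ^ 3 * (1 - 27 * b) \<noteq> 0" using b(2) unit_imp_nonzero[OF unit] by simp
  obtain u where u: "u \<noteq> 0" "1 - 24 * b = 12 * u\<^sup>2 * g2" "- 1 + 36 * b - 216 * b\<^sup>2 = 216 * u ^ 3 * g3"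
  proof (rule exists_scaling[OF _ root d0])
    show "(1 - 24 * b) ^ 3 - (- 1 + 36 * b - 216 * b\<^sup>2)\<^sup>2 = 1728 * (b ^ 3 * (1 - 27 * b))"
      by (simp add: power2_eq_square power3_eq_cube algebra_simps)
  qed blast
  have model: "elliptic_model L (\<lambda>z. u * wp z - 1 / 12) 1 b (b\<^sup>2) 0"
    by (rule wp_model[OF u(1)]) (use u(2,3) in simp_all)
  interpret bad_model V L "\<lambda>z. u * wp z - 1 / 12" b
    by (intro bad_model.intro integral_model.intro model integral_model_axioms.intro bad_model_axioms.intro)
       (use b bV in \<open>auto intro: V_intros alg_closed_valuation_ring_axioms\<close>)
  have n0: "n > 0" using disc zero_le_power2[of t] by linarith
  \<comment> \<open>The conjugate of \<open>\<mu>\<close>; it preserves the lattice too, and the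
    product of both is \<open>n\<close>, positive by \<open>disc\<close>.\<close>
  define \<mu>' where "\<mu>' = of_int t - \<mu>"
  have \<mu>'_lattice: "\<mu>' * l \<in> L" if "l \<in> L" for l
    using diff_in_lattice[OF of_int_mult_in_lattice[OF that, of t] \<mu>[OF that]] by (simp add: \<mu>'_def left_diff_distrib)
  have prod: "\<mu>' * \<mu> = of_int n" using eq by (simp add: \<mu>'_def power2_eq_square left_diff_distrib)
  have "rational_endo \<mu>"
    by (rule wp_model_rational_endo[OF model u(1) \<mu> \<mu>'_lattice prod]) (use n0 in auto)
  moreover have "rational_endo (3 * \<mu>)"
  proof (rule wp_model_rational_endo[OF model u(1) _ \<mu>'_lattice])
    show "3 * \<mu> * l \<in> L" if "l \<in> L" for l
      using of_int_mult_in_lattice[OF \<mu>[OF that], of 3] by (simp add: mult.assoc)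
    show "\<mu>' * (3 * \<mu>) = of_int (3 * n)" using prod by simp
  qed (use n0 in auto)
  ultimately show False using no_complex_multiplication[OF _ _ eq disc] by blast
qed

text \<open>In residue characteristic different from 3 use \<open>y\<^sup>2 + s x y + y = x\<^sup>3\<close>, and in residue
  characteristic 3 the Legendre form.\<close>

lemma exists_good_model:
  assumes V: "valuation_ring V" and j: "j_invariant \<in> V"
  obtains u b2 b4 b6 b8 where "u \<noteq> 0" "good_model V L (\<lambda>z. u * wp z - b2 / 12) b2 b4 b6 b8"
proof -
  interpret valuation_ring V by fact
  interpret alg_closed_valuation_ring V ..
  note result = that
  have goodI: thesis
    if b: "b2 \<in> V" "b4 \<in> V" "b6 \<in> V" "b8 \<in> V" "4 * b8 = b2 * b6 - b4\<^sup>2"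
      and d: "d = - b2\<^sup>2 * b8 - 8 * b4 ^ 3 - 27 * b6\<^sup>2 + 9 * b2 * b4 * b6" "d \<notin> M"
      and c4: "(b2\<^sup>2 - 24 * b4) ^ 3 = j_invariant * d" for b2 b4 b6 b8 d
  proof -
    have "(b2\<^sup>2 - 24 * b4) ^ 3 - (- (b2 ^ 3) + 36 * b2 * b4 - 216 * b6)\<^sup>2 = 1728 * d"
    proof -
      have "(b2\<^sup>2 - 24 * b4) ^ 3 - (- (b2 ^ 3) + 36 * b2 * b4 - 216 * b6)\<^sup>2
          = 432 * (- b2\<^sup>2 * (b2 * b6 - b4\<^sup>2) - 32 * b4 ^ 3 - 108 * b6\<^sup>2 + 36 * b2 * b4 * b6)"
        by (simp add: power2_eq_square power3_eq_cube algebra_simps)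
      also have "\<dots> = 1728 * d" unfolding b(5)[symmetric] d(1) by (simp add: algebra_simps)
      finally show ?thesis .
    qed
    then obtain u where u: "u \<noteq> 0" "b2\<^sup>2 - 24 * b4 = 12 * u\<^sup>2 * g2" "- (b2 ^ 3) + 36 * b2 * b4 - 216 * b6 = 216 * u ^ 3 * g3"
      using exists_scaling[OF _ c4 unit_nonzero[OF d(2)]] by blast
    have "good_model V L (\<lambda>z. u * wp z - b2 / 12) b2 b4 b6 b8"
      using wp_model[OF u(1) b(5) u(2,3)] b d
      by (intro good_model.intro integral_model.intro integral_model_axioms.intro good_model_axioms.intro)
         (auto intro: alg_closed_valuation_ring_axioms)
    then show thesis by (rule result[OF u(1)])
  qed
  show thesis
  proof (cases "3 \<in> M")
    case False
    \<comment> \<open>For this equation \<open>c4 = s * (s ^ 3 - 24)\<close> and the discriminant is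
      \<open>s ^ 3 - 27\<close>, so \<open>t = s ^ 3\<close> satisfies
      \<open>t * (t - 24) ^ 3 = j_invariant * (t - 27)\<close>.\<close>
    define p where "p = [:27 * j_invariant, - 13824 - j_invariant, 1728, - 72, 1:]"
    obtain t where t: "poly p t = 0"
      using alg_closed_imp_poly_has_root[of p] by (auto simp: p_def)
    have tV: "t \<in> V"
      by (rule monic_root_mem[OF t])
         (use j in \<open>auto simp: p_def coeff_pCons intro!: V_intros split: nat.split\<close>)
    have root: "t * (t - 24) ^ 3 = j_invariant * (t - 27)"
      using t by (simp add: p_def power3_eq_cube algebra_simps)
    obtain s where "poly [:- t, 0, 0, 1:] s = 0"
      using alg_closed_imp_poly_has_root[of "[:- t, 0, 0, 1:]"] by auto
    then have s: "s ^ 3 = t" by (simp add: power3_eq_cube mult.assoc)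
    have "s \<in> V"
    proof (rule monic_root_mem[of "[:- t, 0, 0, 1:]"])
      show "poly [:- t, 0, 0, 1:] s = 0" using s by (simp add: power3_eq_cube mult.assoc)
    qed (use tV in \<open>auto simp: coeff_pCons intro!: V_intros split: nat.split\<close>)
    \<comment> \<open>Otherwise \<open>t\<close> or \<open>t - 24\<close> would lie in
      \<open>M\<close> as well, and the difference from \<open>t - 27\<close> is 27 or 3.\<close>
    have d: "t - 27 \<notin> M"
    proof
      assume m: "t - 27 \<in> M"
      have "t * (t - 24) ^ 3 \<in> M" unfolding root by (rule M_mult'[OF j m])
      then have "t \<in> M \<or> t - 24 \<in> M"
        using M_prime[of t "(t - 24) ^ 3"] M_prime_power[of "t - 24" 3] tV by (auto intro: V_intros)
      then have "3 ^ 3 \<in> M \<or> 3 \<in> M"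
      proof
        assume "t \<in> M"
        from M_of_cong[OF this m] show ?thesis by simp
      next
        assume "t - 24 \<in> M"
        from M_diff[OF this m] show ?thesis by simp
      qed
      then show False using False M_prime_power[of 3 3] numeral_mem by blast
    qed
    show thesis
    proof (rule goodI[of "s\<^sup>2" s 1 0 "t - 27"])
      show "((s\<^sup>2)\<^sup>2 - 24 * s) ^ 3 = j_invariant * (t - 27)"
        unfolding root[symmetric] unfolding s[symmetric]
        by (simp add: power2_eq_square power3_eq_cube algebra_simps)
      show "t - 27 = - (s\<^sup>2)\<^sup>2 * 0 - 8 * s ^ 3 - 27 * 1\<^sup>2 + 9 * s\<^sup>2 * s * 1"
        unfolding s[symmetric] by (simp add: power2_eq_square power3_eq_cube)
    qed (use d \<open>s \<in> V\<close> in \<open>auto intro: V_intros\<close>)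
  next
    case True
    have 2: "2 \<notin> M"
    proof
      assume "2 \<in> M"
      from M_diff[OF True this] show False using M_one by simp
    qed
    have 256: "256 \<notin> M" using M_prime_power[of 2 8] numeral_mem 2 by auto
    define K where "K = j_invariant / 256"
    have K: "K \<in> V" unfolding K_def using unit_divide[OF j numeral_mem 256] .
    \<comment> \<open>The difference
      \<open>(l\<^sup>2 - l + 1) ^ 3 - K * l\<^sup>2 * (1 - l)\<^sup>2\<close>, which expresses that
      the Legendre curve with parameter \<open>l\<close> has the given
      \<open>j\<close>-invariant.\<close>
    define p where "p = [:1, - 3, 6 - K, - 7 + 2 * K, 6 - K, - 3, 1:]"
    obtain l where l: "poly p l = 0"
      using alg_closed_imp_poly_has_root[of p] by (auto simp: p_def)
    have lV: "l \<in> V"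
      by (rule monic_root_mem[OF l])
         (use K in \<open>auto simp: p_def coeff_pCons intro!: V_intros split: nat.split\<close>)
    have root: "(l\<^sup>2 - l + 1) ^ 3 = K * (l\<^sup>2 * (1 - l)\<^sup>2)"
      using l by (simp add: p_def power2_eq_square power3_eq_cube algebra_simps)
    \<comment> \<open>Otherwise \<open>root\<close> would put \<open>l\<^sup>2 - l + 1\<close> into
      \<open>M\<close> too, but the two elements add up to 1.\<close>
    have not_M: "l * (1 - l) \<notin> M"
    proof
      assume m: "l * (1 - l) \<in> M"
      then have "(l * (1 - l)) * (K * (l * (1 - l))) \<in> M" by (rule M_mult) (use K lV in \<open>intro V_intros\<close>)
      then have "(l\<^sup>2 - l + 1) ^ 3 \<in> M" unfolding root by (simp add: power2_eq_square mult_ac)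
      then have "l\<^sup>2 - l + 1 \<in> M" using M_prime_power[of "l\<^sup>2 - l + 1" 3] lV by (auto intro: V_intros)
      from M_add[OF this m] show False using M_one by (simp add: power2_eq_square algebra_simps)
    qed
    show thesis
    proof (rule goodI[of "- 4 * (1 + l)" "2 * l" 0 "- l\<^sup>2" "16 * (l * (1 - l))\<^sup>2"])
      have "(16 * (l\<^sup>2 - l + 1)) ^ 3 = j_invariant * (16 * (l * (1 - l))\<^sup>2)"
        unfolding power_mult_distrib[of 16 _ 3] root by (simp add: power_mult_distrib K_def)
      moreover have "(- 4 * (1 + l))\<^sup>2 - 24 * (2 * l) = 16 * (l\<^sup>2 - l + 1)"
        by (simp add: power2_eq_square algebra_simps)
      ultimately show "((- 4 * (1 + l))\<^sup>2 - 24 * (2 * l)) ^ 3 = j_invariant * (16 * (l * (1 - l))\<^sup>2)" by (simp only:)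
      show "16 * (l * (1 - l))\<^sup>2 = - (- 4 * (1 + l))\<^sup>2 * - l\<^sup>2 - 8 * (2 * l) ^ 3 - 27 * 0\<^sup>2 + 9 * (- 4 * (1 + l)) * (2 * l) * 0"
        by (simp add: power2_eq_square power3_eq_cube algebra_simps)
      have "16 \<notin> M" using M_prime_power[of 2 4] numeral_mem 2 by auto
      moreover have "(l * (1 - l))\<^sup>2 \<notin> M" using not_M M_prime_power[of "l * (1 - l)" 2] lV by (auto intro: V_intros)
      ultimately show "16 * (l * (1 - l))\<^sup>2 \<notin> M"
        using M_prime[of 16 "(l * (1 - l))\<^sup>2"] lV by (auto intro: V_intros)
    qed (use lV in \<open>auto simp: power2_eq_square intro: V_intros\<close>)
  qed
qed

end

section \<open>The quotient at an imaginary quadratic point\<close>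

theorem theorem3p2:
  fixes N k \<delta> :: int and \<alpha> :: complex
  assumes "N > 6"
    and "3 \<le> k" and "real_of_int k < real_of_int N / 2"
    and "\<delta> = gcd k N"
    and "\<delta> = 1 \<or> (\<delta> > 1 \<and> gcd \<delta> 3 = 1 \<and> \<not> primepow (N div \<delta>))"
    and "imaginary_quadratic_point \<alpha>"
  shows "algebraic_int (Lambda_fun N k \<alpha>)"
proof (rule algebraic_int_valuation_criterion)
  fix V :: "complex set"
  assume V: "valuation_ring V"
  have Im: "Im \<alpha> > 0" using assms(6) by (simp add: imaginary_quadratic_point_def)
  interpret period_ratio \<alpha> by unfold_locales (rule Im)
  obtain a b c :: int where a: "a \<noteq> 0" and eq: "of_int a * \<alpha>\<^sup>2 + of_int b * \<alpha> + of_int c = 0"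
    using imaginary_quadratic_equation[OF assms(6)] by blast
  \<comment> \<open>Scaling by the leading coefficient gives an algebraic integer whose
    multiplication preserves the lattice.\<close>
  define \<mu> where "\<mu> = of_int a * \<alpha>"
  have "\<mu>\<^sup>2 - (of_int (- b) * \<mu> - of_int (a * c)) = of_int a * (of_int a * \<alpha>\<^sup>2 + of_int b * \<alpha> + of_int c)"
    by (simp add: \<mu>_def power2_eq_square algebra_simps)
  then have \<mu>2: "\<mu>\<^sup>2 = of_int (- b) * \<mu> - of_int (a * c)" unfolding eq by simp
  have \<mu>: "\<mu> * l \<in> lattice_of \<alpha>" if "l \<in> lattice_of \<alpha>" for l
  proof -
    from that obtain m n where l: "l = of_int m + of_int n * \<alpha>" by (rule latticeE)
    have "\<mu> * l = of_int m * of_int a * \<alpha> + of_int n * (of_int a * \<alpha>\<^sup>2)"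
      by (simp add: l \<mu>_def power2_eq_square algebra_simps)
    also have "of_int a * \<alpha>\<^sup>2 = (of_int a * \<alpha>\<^sup>2 + of_int b * \<alpha> + of_int c) - of_int b * \<alpha> - of_int c"
      by simp
    also have "\<dots> = - of_int b * \<alpha> - of_int c" unfolding eq by simp
    also have "of_int m * of_int a * \<alpha> + of_int n * (- of_int b * \<alpha> - of_int c) =
        of_int (- n * c) + of_int (m * a - n * b) * \<alpha>"
      by (simp add: algebra_simps)
    finally show ?thesis by (simp only: lattice_intro)
  qed
  have disc: "(- b)\<^sup>2 < 4 * (a * c)"
  proof -
    \<comment> \<open>Its square is the integer discriminant. As \<open>y\<close> is not real but
      has a real square, that square is negative.\<close>
    define y where "y = 2 * \<mu> + of_int b"
    have y2: "y\<^sup>2 = of_int (b\<^sup>2 - 4 * (a * c))"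
      proof -
      have "y\<^sup>2 = 4 * \<mu>\<^sup>2 + 4 * of_int b * \<mu> + (of_int b)\<^sup>2"
        by (simp add: y_def power2_eq_square algebra_simps)
      then show ?thesis by (simp add: \<mu>2 algebra_simps)
    qed
    have "Im y \<noteq> 0" using a Im by (simp add: y_def \<mu>_def)
    moreover have "Im (y\<^sup>2) = 0" unfolding y2 by simp
    then have "Re y * Im y = 0" unfolding power2_eq_square by auto
    ultimately have "Re y = 0" "Im y \<noteq> 0" by simp_all
    then have "Re (y\<^sup>2) < 0" by (auto simp: power2_eq_square zero_less_mult_iff)
    then have "b\<^sup>2 - 4 * (a * c) < 0" unfolding y2 by (simp only: complex_Re_of_int of_int_less_0_iff)
    then show ?thesis by simp
  qed
  have "j_invariant \<in> V" by (rule j_invariant_integral[OF V \<mu> \<mu>2 disc])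
  then obtain u b2 b4 b6 b8 where u: "u \<noteq> 0" and good: "good_model V (lattice_of \<alpha>) (\<lambda>z. u * wp z - b2 / 12) b2 b4 b6 b8"
    by (rule exists_good_model[OF V])
  interpret good_model V "lattice_of \<alpha>" "\<lambda>z. u * wp z - b2 / 12" b2 b4 b6 b8 by fact
  have order: "of_int n * (1 / of_int N) \<in> lattice_of \<alpha> \<longleftrightarrow> N dvd n" for n
  proof -
    have "of_int n * (1 / of_int N) = of_real (of_int n / of_int N) + of_real 0 * \<alpha>" by simp
    then have "of_int n * (1 / of_int N) \<in> lattice_of \<alpha> \<longleftrightarrow> real_of_int n / real_of_int N \<in> \<int>"
      using in_lattice_iff[of "of_int n / of_int N" 0] by simp
    also have "\<dots> \<longleftrightarrow> N dvd n"
    proof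
      assume "real_of_int n / real_of_int N \<in> \<int>"
      then obtain i where "real_of_int n / real_of_int N = real_of_int i" by (elim Ints_cases)
      then have "real_of_int n = real_of_int (N * i)" using assms(1) by (simp add: field_simps)
      then have "n = N * i" by (simp only: of_int_eq_iff)
      then show "N dvd n" by simp
    next
      assume "N dvd n"
      then show "real_of_int n / real_of_int N \<in> \<int>" using assms(1) by (auto elim!: dvdE)
    qed
    finally show ?thesis .
  qed
  have k: "2 * k < N" using assms(3) by linarith
  have "gcd k N = 1 \<or> gcd (gcd k N) 3 = 1 \<and> \<not> primepow (N div gcd k N)"
    using assms(4,5) by blast
  from ratio_mem[OF assms(1,2) k this order]
  have "(u * wp (of_int k * (1 / of_int N)) - b2 / 12 - (u * wp (1 / of_int N) - b2 / 12)) /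
      (u * wp (2 * (1 / of_int N)) - b2 / 12 - (u * wp (1 / of_int N) - b2 / 12)) \<in> V" .
  \<comment> \<open>A quotient of differences is invariant under affine changes of the coordinate,
    so the model may depend on \<open>V\<close>.\<close>
  moreover have "(u * p - b2 / 12 - (u * q - b2 / 12)) / (u * p' - b2 / 12 - (u * q - b2 / 12)) = (p - q) / (p' - q)" for p p' q
    using u by (simp flip: right_diff_distrib)
  ultimately show "Lambda_fun N k \<alpha> \<in> V" by (simp add: Lambda_fun_def)
qed

end
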